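(* Let $\Omega\subset\mathbb{R}^N$ be a bounded domain, let $\alpha>0$, let $B\subseteq\Omega$ be measurable, and let $(\lambda_i)_{i\ge 0}\subset\mathbb{R}$ and $(u_i)_{i\ge0}\subset H^1_0(\Omega)$ be the coefficients of the power series expansions $\lambda_\varepsilon=\sum_{i\ge0}\lambda_i\varepsilon^i$ and $u_\varepsilon=\sum_{i\ge0}u_i\varepsilon^i$ at $\varepsilon=0$ of the first eigenvalue $\lambda_\varepsilon=\lambda_\varepsilon(B)$ and of the non-negative $L^2$-normalized first eigenfunction $u_\varepsilon=u_\varepsilon(B)$ of $-\mathrm{div}(\alpha(1+\varepsilon\chi_B)\nabla\,\cdot\,)$ with homogeneous Dirichlet boundary condition. Then: (1) $\lambda_0$ is the first eigenvalue of $-\alpha\Delta$ on $H^1_0(\Omega)$ and $u_0$ is the associated positive eigenfunction with $\int_\Omega u_0^2=1$. (2) For every $i\ge 1$, $$\lambda_i=\int_B\alpha\,\nabla u_{i-1}\cdot\nabla u_0-\sum_{k=2}^{i-1}\lambda_{i-k}\int_\Omega u_0u_k ,$$ where the sum is $0$ when its upper limit is less than its lower limit. (3) For every $i\ge1$, $u_i$ is the unique element of $H^1_0(\Omega)$ satisfying, in the weak sense, $$-\alpha\Delta u_i-\lambda_0u_i=\mathrm{div}(\alpha\chi_B\nabla u_{i-1})+\sum_{k=1}^{i}\lambda_ku_{i-k}\quad\text{in }\Omega,\qquad u_i=0\ \text{on }\partial\Omega,$$ together with $$\int_\Omega u_iu_0=-\frac12\sum_{k=1}^{i-1}\int_\Omega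 u_ku_{i-k}$$ (which for $i=1$ means $\int_\Omega u_1u_0=0$).
   Context: $\chi_B$ is the characteristic function of $B$. For a contrast parameter $\varepsilon$, $\lambda_\varepsilon(B)$ is the smallest $\lambda$ for which there is $0\neq u\in H^1_0(\Omega)$ with $-\mathrm{div}(\alpha(1+\varepsilon\chi_B)\nabla u)=\lambda u$ in $\Omega$ (weak sense). This eigenvalue is simple, and $u_\varepsilon(B)$ denotes the associated eigenfunction that is non-negative with $\|u_\varepsilon\|_{L^2(\Omega)}=1$. For fixed $B$, it is classical (perturbation theory of simple eigenvalues) that $\varepsilon\mapsto(\lambda_\varepsilon,u_\varepsilon)\in\mathbb{R}\times H^1_0(\Omega)$ is analytic near $\varepsilon=0$; this is what defines the coefficients $\lambda_i$, $u_i$. *)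

theory Defs
  imports "HOL-Analysis.Analysis"
begin

primrec Ck :: "nat \<Rightarrow> ('a::euclidean_space \<Rightarrow> real) \<Rightarrow> bool" where
  "Ck 0 f \<longleftrightarrow> continuous_on UNIV f"
| "Ck (Suc k) f \<longleftrightarrow> f differentiable_on UNIV \<and>
     (\<forall>b\<in>Basis. Ck k (\<lambda>x. frechet_derivative f (at x) b))"

definition test_function :: "'a::euclidean_space set \<Rightarrow> ('a \<Rightarrow> real) \<Rightarrow> bool" where
  "test_function \<Omega> \<phi> \<longleftrightarrow>
     (\<forall>k. Ck k \<phi>) \<and> (\<exists>K. compact K \<and> K \<subseteq> \<Omega> \<and> (\<forall>x. x \<notin> K \<longrightarrow> \<phi> x = 0))"

text \<open>Elements of Lebesgue and Sobolev spaces on \<open>\<Omega>\<close> are represented by functions on the whole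
  space whose values outside \<open>\<Omega>\<close> are irrelevant; equality of elements is equality almost
  everywhere in \<open>\<Omega>\<close>.\<close>

definition L2 :: "'a::euclidean_space set \<Rightarrow> ('a \<Rightarrow> 'b::euclidean_space) set" where
  "L2 \<Omega> = {f \<in> borel_measurable (lebesgue_on \<Omega>).
             integrable (lebesgue_on \<Omega>) (\<lambda>x. (norm (f x))\<^sup>2)}"

definition is_weak_gradient ::
    "'a::euclidean_space set \<Rightarrow> ('a \<Rightarrow> real) \<Rightarrow> ('a \<Rightarrow> 'a) \<Rightarrow> bool" where
  "is_weak_gradient \<Omega> u g \<longleftrightarrow>
     (\<forall>\<phi>. test_function \<Omega> \<phi> \<longrightarrow> (\<forall>b\<in>Basis.
        (LINT x|lebesgue_on \<Omega>. u x * frechet_derivative \<phi> (at x) b)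
          = - (LINT x|lebesgue_on \<Omega>. (g x \<bullet> b) * \<phi> x)))"

definition H1 :: "'a::euclidean_space set \<Rightarrow> ('a \<Rightarrow> real) set" where
  "H1 \<Omega> = {u \<in> L2 \<Omega>. \<exists>g\<in>L2 \<Omega>. is_weak_gradient \<Omega> u g}"

text \<open>For open \<open>\<Omega>\<close> the weak gradient of an element of \<open>H1 \<Omega>\<close> is unique up to null sets, so the
  choice below is immaterial.\<close>

definition wgrad :: "'a::euclidean_space set \<Rightarrow> ('a \<Rightarrow> real) \<Rightarrow> ('a \<Rightarrow> 'a)" where
  "wgrad \<Omega> u = (SOME g. g \<in> L2 \<Omega> \<and> is_weak_gradient \<Omega> u g)"

definition H1_norm :: "'a::euclidean_space set \<Rightarrow> ('a \<Rightarrow> real) \<Rightarrow> real" where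
  "H1_norm \<Omega> u = sqrt ((LINT x|lebesgue_on \<Omega>. (u x)\<^sup>2)
                        + (LINT x|lebesgue_on \<Omega>. (norm (wgrad \<Omega> u x))\<^sup>2))"

definition H10 :: "'a::euclidean_space set \<Rightarrow> ('a \<Rightarrow> real) set" where
  "H10 \<Omega> = {u \<in> H1 \<Omega>. \<exists>\<phi>. (\<forall>n. test_function \<Omega> (\<phi> n)) \<and>
               (\<lambda>n::nat. H1_norm \<Omega> (\<lambda>x. u x - \<phi> n x)) \<longlonglongrightarrow> 0}"

text \<open>Weak form of \<open>-div (a \<nabla>u) = l u\<close> in \<open>\<Omega>\<close> with \<open>u = 0\<close> on the boundary.\<close>

definition eigenfunction ::
    "'a::euclidean_space set \<Rightarrow> ('a \<Rightarrow> real) \<Rightarrow> real \<Rightarrow> ('a \<Rightarrow> real) \<Rightarrow> bool" where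
  "eigenfunction \<Omega> a l u \<longleftrightarrow>
     u \<in> H10 \<Omega> \<and> \<not> (AE x in lebesgue_on \<Omega>. u x = 0) \<and>
     (\<forall>v\<in>H10 \<Omega>. (LINT x|lebesgue_on \<Omega>. a x * (wgrad \<Omega> u x \<bullet> wgrad \<Omega> v x))
                   = l * (LINT x|lebesgue_on \<Omega>. u x * v x))"

definition first_eigenvalue :: "'a::euclidean_space set \<Rightarrow> ('a \<Rightarrow> real) \<Rightarrow> real \<Rightarrow> bool" where
  "first_eigenvalue \<Omega> a l \<longleftrightarrow>
     (\<exists>u. eigenfunction \<Omega> a l u) \<and> (\<forall>m. (\<exists>u. eigenfunction \<Omega> a m u) \<longrightarrow> l \<le> m)"

text \<open>Weak form of \<open>-\<alpha> \<Delta>w - l w = div G + f\<close> in \<open>\<Omega>\<close> with \<open>w = 0\<close> on the boundary.\<close>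

definition weak_solution ::
    "'a::euclidean_space set \<Rightarrow> real \<Rightarrow> real \<Rightarrow> ('a \<Rightarrow> 'a) \<Rightarrow> ('a \<Rightarrow> real) \<Rightarrow> ('a \<Rightarrow> real) \<Rightarrow> bool" where
  "weak_solution \<Omega> \<alpha> l G f w \<longleftrightarrow>
     w \<in> H10 \<Omega> \<and>
     (\<forall>v\<in>H10 \<Omega>.
        (LINT x|lebesgue_on \<Omega>. \<alpha> * (wgrad \<Omega> w x \<bullet> wgrad \<Omega> v x))
          - l * (LINT x|lebesgue_on \<Omega>. w x * v x)
        = - (LINT x|lebesgue_on \<Omega>. G x \<bullet> wgrad \<Omega> v x) + (LINT x|lebesgue_on \<Omega>. f x * v x))"

end

theory Submission
  imports Defs
begin

text \<open>
  Expanding the weak eigenvalue equation and the normalization of \<open>u\<^sub>\<epsilon>\<close> in powers of \<open>\<epsilon>\<close> and comparing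
  coefficients gives the equations for \<open>\<lambda>\<^sub>i\<close> and \<open>u\<^sub>i\<close>; testing with \<open>u\<^sub>0\<close> gives the formula for \<open>\<lambda>\<^sub>i\<close>.
  What remains is that \<open>u\<^sub>0\<close> is positive and that \<open>\<lambda>\<^sub>0\<close> is simple. Positivity is the strong maximum
  principle for distributional supersolutions, proved by monotonicity of averages against shrinking
  bumps. A positive solution makes \<open>\<lambda>\<^sub>0\<close> the minimum of the Rayleigh quotient (Picone), without any
  compactness. Hence, for another solution \<open>w\<close>, smoothed truncations of test functions approximating
  \<open>w\<close> form a minimizing sequence for \<open>|w|\<close>, and \<open>|w|\<close> is a distributional solution as well. By the
  maximum principle, each of \<open>|w| + w\<close> and \<open>|w| - w\<close> is either zero or positive almost everywhere, so
  a \<open>w\<close> orthogonal to \<open>u\<^sub>0\<close> vanishes.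
\<close>

section \<open>Smooth functions\<close>

definition smooth :: "('a::euclidean_space \<Rightarrow> real) \<Rightarrow> bool" where
  "smooth f \<longleftrightarrow> (\<forall>k. Ck k f)"

abbreviation pd :: "('a::euclidean_space \<Rightarrow> real) \<Rightarrow> 'a \<Rightarrow> 'a \<Rightarrow> real" where
  "pd f b \<equiv> (\<lambda>x. frechet_derivative f (at x) b)"

lemma Ck_SucI:
  assumes "\<And>x. (f has_derivative f' x) (at x)"
    and "\<And>b. b \<in> Basis \<Longrightarrow> Ck k (\<lambda>x. f' x b)"
  shows "Ck (Suc k) f"
proof -
  have "frechet_derivative f (at x) = f' x" for x
    using frechet_derivative_at[OF assms(1)] by metis
  moreover have "f differentiable_on UNIV"
    using assms(1) by (auto simp: differentiable_on_def differentiable_def)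
  ultimately show ?thesis
    using assms(2) by simp
qed

lemma Ck_Suc_has_derivative:
  assumes "Ck (Suc k) f"
  shows "(f has_derivative frechet_derivative f (at x)) (at x)"
  using assms by (simp add: differentiable_on_def frechet_derivative_works[symmetric])

lemma Ck_SucD:
  assumes "Ck (Suc k) f"
  shows "Ck k f"
  using assms
proof (induction k arbitrary: f)
  case 0
  then show ?case
    by (auto intro!: differentiable_imp_continuous_on)
next
  case (Suc k)
  then show ?case
    by (metis Ck.simps(2))
qed

lemma Ck_const: "Ck k (\<lambda>x. c)"
proof (induction k arbitrary: c)
  case (Suc k)
  show ?case
    by (rule Ck_SucI[where f' = "\<lambda>x h. 0"]) (use Suc in auto)
qed simp

lemma Ck_inner: "Ck k (\<lambda>x. x \<bullet> c)"
proof (induction k)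
  case (Suc k)
  show ?case
    by (rule Ck_SucI[where f' = "\<lambda>x h. h \<bullet> c"]) (auto intro!: derivative_eq_intros Ck_const)
qed (auto intro!: continuous_intros)

lemma Ck_add:
  assumes "Ck k f" "Ck k g"
  shows "Ck k (\<lambda>x. f x + g x)"
  using assms
proof (induction k arbitrary: f g)
  case (Suc k)
  note d = Ck_Suc_has_derivative[OF Suc.prems(1)] Ck_Suc_has_derivative[OF Suc.prems(2)]
  show ?case
    by (rule Ck_SucI[OF has_derivative_add[OF d]]) (use Suc in auto)
qed (auto intro: continuous_intros)

lemma Ck_mult:
  assumes "Ck k f" "Ck k g"
  shows "Ck k (\<lambda>x. f x * g x)"
  using assms
proof (induction k arbitrary: f g)
  case (Suc k)
  note d = Ck_Suc_has_derivative[OF Suc.prems(1)] Ck_Suc_has_derivative[OF Suc.prems(2)]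
  show ?case
  proof (rule Ck_SucI[OF has_derivative_mult[OF d]])
    fix b :: 'a assume b: "b \<in> Basis"
    show "Ck k (\<lambda>x. f x * pd g b x + pd f b x * g x)"
      using Suc.prems b by (intro Ck_add Suc.IH) (auto dest: Ck_SucD simp del: Ck.simps, auto)
  qed
qed (auto intro: continuous_intros)

lemma Ck_compose:
  fixes F :: "nat \<Rightarrow> real \<Rightarrow> real"
  assumes F: "\<And>n s. s \<in> T \<Longrightarrow> (F n has_real_derivative F (Suc n) s) (at s)"
    and q: "\<And>x. q x \<in> T" and "Ck k q"
  shows "Ck k (\<lambda>x. F n (q x))"
  using assms(3)
proof (induction k arbitrary: n)
  case 0
  have "isCont (\<lambda>x. F n (q x)) x" for x
  proof (rule isCont_o2[where f = q and g = "F n"])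
    show "isCont q x"
      using 0 by (simp add: continuous_on_eq_continuous_at)
    show "isCont (F n) (q x)"
      by (rule DERIV_isCont[OF F[OF q]])
  qed
  then show ?case
    by (simp add: continuous_at_imp_continuous_on)
next
  case (Suc k)
  have q': "(q has_derivative frechet_derivative q (at x)) (at x)" for x
    by (rule Ck_Suc_has_derivative[OF Suc.prems])
  have "((\<lambda>x. F n (q x)) has_derivative (\<lambda>h. F (Suc n) (q x) * frechet_derivative q (at x) h)) (at x)"
    for x
    using has_derivative_compose[OF q' F[OF q, unfolded has_field_derivative_def]]
    by simp
  then show ?case
  proof (rule Ck_SucI)
    fix b :: 'a assume "b \<in> Basis"
    then have "Ck k (pd q b)"
      using Suc.prems by simp
    then show "Ck k (\<lambda>x. F (Suc n) (q x) * pd q b x)"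
      by (rule Ck_mult[OF Suc.IH[OF Ck_SucD[OF Suc.prems]]])
  qed
qed

lemma smooth_const: "smooth (\<lambda>x. c)"
  and smooth_inner: "smooth (\<lambda>x. x \<bullet> b)"
  by (auto simp: smooth_def Ck_const Ck_inner)

lemma smooth_add: "smooth f \<Longrightarrow> smooth g \<Longrightarrow> smooth (\<lambda>x. f x + g x)"
  and smooth_mult: "smooth f \<Longrightarrow> smooth g \<Longrightarrow> smooth (\<lambda>x. f x * g x)"
  by (auto simp: smooth_def intro: Ck_add Ck_mult)

lemma smooth_cmult: "smooth f \<Longrightarrow> smooth (\<lambda>x. c * f x)"
  by (intro smooth_mult smooth_const)

lemma smooth_uminus: "smooth f \<Longrightarrow> smooth (\<lambda>x. - f x)"
  using smooth_cmult[of f "-1"] by simp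

lemma smooth_diff: "smooth f \<Longrightarrow> smooth g \<Longrightarrow> smooth (\<lambda>x. f x - g x)"
  using smooth_add[OF _ smooth_uminus] by force

lemma smooth_compose:
  assumes "\<And>n s. s \<in> T \<Longrightarrow> (F n has_real_derivative F (Suc n) s) (at s)"
    and "\<And>x. q x \<in> T" and "smooth q"
  shows "smooth (\<lambda>x. F n (q x))"
  unfolding smooth_def
proof
  show "Ck k (\<lambda>x. F n (q x))" for k
    by (rule Ck_compose[where T = T]) (use assms in \<open>auto simp: smooth_def\<close>)
qed

lemma smooth_pd: "smooth f \<Longrightarrow> b \<in> Basis \<Longrightarrow> smooth (pd f b)"
  unfolding smooth_def by (metis Ck.simps(2))

lemma smooth_has_derivative:
  "smooth f \<Longrightarrow> (f has_derivative frechet_derivative f (at x)) (at x)"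
  unfolding smooth_def by (metis Ck_Suc_has_derivative)

lemma smooth_continuous: "smooth f \<Longrightarrow> continuous_on S f"
  unfolding smooth_def by (metis Ck.simps(1) continuous_on_subset top_greatest)

lemma frechet_derivative_eqI:
  "(f has_derivative f') (at x) \<Longrightarrow> frechet_derivative f (at x) = f'"
  by (metis frechet_derivative_at)

section \<open>Bump functions\<close>

text \<open>The functions \<open>p (1 / s) * exp (- 1 / s)\<close>, extended by \<open>0\<close> to \<open>s \<le> 0\<close>, are closed under
  differentiation; \<open>bp0\<close>, \<open>bp2\<close>, \<open>bp4\<close> are the polynomials of \<open>exp (- 1 / s)\<close> and its first two
  derivatives.\<close>

definition bexp :: "real poly \<Rightarrow> real \<Rightarrow> real" where
  "bexp p s = (if s > 0 then poly p (1 / s) * exp (- 1 / s) else 0)"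

definition bexp_step :: "real poly \<Rightarrow> real poly" where
  "bexp_step p = monom 1 2 * (p - pderiv p)"

lemma poly_exp_tendsto_0: "((\<lambda>t::real. poly p t * exp (- t)) \<longlongrightarrow> 0) at_top"
proof -
  have "((\<lambda>t. (\<Sum>i\<le>degree p. coeff p i * (t ^ i / exp t))) \<longlongrightarrow> (\<Sum>i\<le>degree p. coeff p i * 0)) at_top"
    by (intro tendsto_sum tendsto_mult tendsto_const tendsto_power_div_exp_0)
  then show ?thesis
    by (simp add: poly_altdef sum_distrib_right sum_divide_distrib exp_minus field_simps)
qed

lemma bexp_tendsto_0: "(bexp p \<longlongrightarrow> 0) (at 0)"
proof -
  have "((\<lambda>s. poly p (inverse s) * exp (- inverse s)) \<longlongrightarrow> 0) (at_right (0::real))"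
    by (rule filterlim_compose[OF poly_exp_tendsto_0 filterlim_inverse_at_top_right])
  then have "(bexp p \<longlongrightarrow> 0) (at_right 0)"
    by (rule Lim_transform_eventually)
       (auto simp: bexp_def eventually_at_filter divide_inverse intro!: always_eventually)
  moreover have "(bexp p \<longlongrightarrow> 0) (at_left 0)"
    by (rule Lim_transform_eventually[OF tendsto_const])
       (auto simp: bexp_def eventually_at_filter intro!: always_eventually)
  ultimately show ?thesis
    by (simp add: filterlim_split_at)
qed

lemma bexp_deriv: "(bexp p has_real_derivative bexp (bexp_step p) s) (at s)"
proof -
  consider "s > 0" | "s < 0" | "s = 0" by linarith
  then show ?thesis
  proof cases
    case 1
    have "((\<lambda>s. poly p (1 / s) * exp (- 1 / s)) has_real_derivative bexp (bexp_step p) s) (at s)"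
      using 1
      by (auto intro!: derivative_eq_intros poly_DERIV[THEN DERIV_chain2]
          simp: bexp_def bexp_step_def poly_monom field_simps power2_eq_square)
    moreover have "\<forall>\<^sub>F t in nhds s. t > 0"
      using 1 by (intro eventually_nhds_in_open[of "{0<..}", simplified]) auto
    ultimately show ?thesis
      by (subst DERIV_cong_ev[OF refl _ refl]) (auto elim!: eventually_mono simp: bexp_def)
  next
    case 2
    have "\<forall>\<^sub>F t in nhds s. t < 0"
      using 2 by (intro eventually_nhds_in_open[of "{..<0}", simplified]) auto
    then show ?thesis
      using 2
      by (subst DERIV_cong_ev[OF refl, where g = "\<lambda>_. 0" and v = 0])
         (auto elim!: eventually_mono simp: bexp_def)
  next
    case 3
    have "((\<lambda>h. bexp (monom 1 1 * p) h) \<longlongrightarrow> 0) (at 0)"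
      by (rule bexp_tendsto_0)
    then have "((\<lambda>h. (bexp p (0 + h) - bexp p 0) / h) \<longlongrightarrow> 0) (at 0)"
      by (rule Lim_transform_eventually)
         (auto simp: bexp_def poly_monom eventually_at_filter intro!: always_eventually)
    then show ?thesis
      using 3 by (simp add: DERIV_def bexp_def)
  qed
qed

lemma smooth_bexp:
  assumes "smooth q"
  shows "smooth (\<lambda>x. bexp p (q x))"
  using smooth_compose[of UNIV "\<lambda>n. bexp ((bexp_step ^^ n) p)" q 0] assms bexp_deriv by simp

lemma bexp_bounded: "\<exists>C>0. \<forall>s\<le>1. \<bar>bexp p s\<bar> \<le> C"
proof -
  have "continuous_on {0..1} (bexp p)"
    using bexp_deriv by (meson DERIV_isCont continuous_at_imp_continuous_on)
  then have "bounded (bexp p ` {0..1})"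
    using compact_continuous_image compact_imp_bounded by blast
  then obtain C where C: "C > 0" "\<forall>s\<in>{0..1}. \<bar>bexp p s\<bar> \<le> C"
    by (auto simp: bounded_pos)
  have "\<bar>bexp p s\<bar> \<le> C" if "s \<le> 1" for s
    using C that by (cases "s \<ge> 0") (auto simp: bexp_def)
  then show ?thesis
    using C(1) by blast
qed

definition bp0 :: "real poly" where "bp0 = 1"
definition bp2 :: "real poly" where "bp2 = bexp_step bp0"
definition bp4 :: "real poly" where "bp4 = bexp_step bp2"

lemma bexp_bp0_nonneg: "bexp bp0 s \<ge> 0"
  by (auto simp: bexp_def bp0_def)

lemma bexp_bp2: "bexp bp2 s = (if s > 0 then exp (- 1 / s) / s\<^sup>2 else 0)"
  by (auto simp: bexp_def bp2_def bp0_def bexp_step_def poly_monom pderiv_1 power_one_over)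

lemma bexp_bp2_nonneg: "bexp bp2 s \<ge> 0"
  and bexp_bp2_pos: "s > 0 \<Longrightarrow> bexp bp2 s > 0"
  by (auto simp: bexp_bp2)

definition bump :: "real poly \<Rightarrow> real \<Rightarrow> 'a::euclidean_space \<Rightarrow> 'a \<Rightarrow> real" where
  "bump p s x y = bexp p (1 - s\<^sup>2 * ((y - x) \<bullet> (y - x)))"

lemma bump_has_derivative:
  "(bump p s x has_derivative (\<lambda>h. bump (bexp_step p) s x y * (- 2 * s\<^sup>2 * ((y - x) \<bullet> h)))) (at y)"
proof -
  have "((\<lambda>y. 1 - s\<^sup>2 * ((y - x) \<bullet> (y - x))) has_derivative (\<lambda>h. - 2 * s\<^sup>2 * ((y - x) \<bullet> h))) (at y)"
    by (auto intro!: derivative_eq_intros simp: inner_commute algebra_simps)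
  from has_derivative_compose[OF this bexp_deriv[unfolded has_field_derivative_def]]
  show ?thesis
    by (simp add: bump_def[abs_def])
qed

lemma pd_bump: "pd (bump p s x) b y = bump (bexp_step p) s x y * (- 2 * s\<^sup>2 * ((y - x) \<bullet> b))"
  using frechet_derivative_eqI[OF bump_has_derivative] by metis

lemma smooth_bump: "smooth (bump p s x)"
proof -
  have "smooth (\<lambda>y. (y - x) \<bullet> (y - x))"
  proof -
    have "smooth (\<lambda>y. (y \<bullet> b - x \<bullet> b))" for b :: 'a
      by (intro smooth_diff smooth_inner smooth_const)
    then have "smooth (\<lambda>y. (y - x) \<bullet> b)" for b :: 'a
      by (simp add: inner_diff_left)
    then have *: "Ck k (\<lambda>y. (y - x) \<bullet> b)" for b :: 'a and k
      by (simp add: smooth_def)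
    have "Ck k (\<lambda>y. (y - x) \<bullet> (y - x))" for k
    proof (cases k)
      case (Suc n)
      have "((\<lambda>y. (y - x) \<bullet> (y - x)) has_derivative (\<lambda>h. 2 * ((y - x) \<bullet> h))) (at y)" for y
        by (auto intro!: derivative_eq_intros simp: inner_commute)
      then show ?thesis
        unfolding Suc by (rule Ck_SucI) (intro Ck_mult[OF Ck_const] *)
    qed (auto intro!: continuous_intros)
    then show ?thesis
      by (simp add: smooth_def)
  qed
  then show ?thesis
    unfolding bump_def[abs_def]
    by (intro smooth_bexp smooth_diff smooth_const smooth_cmult)
qed

lemma bump_eq_0:
  assumes "s > 0" "dist x y \<ge> 1 / s"
  shows "bump p s x y = 0"
proof -
  have "1 \<le> (s * norm (y - x))\<^sup>2"
    using assms by (intro one_le_power) (simp_all add: dist_norm norm_minus_commute field_simps)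
  then show ?thesis
    by (simp add: bump_def bexp_def power2_norm_eq_inner[symmetric] power_mult_distrib)
qed

lemma bump_bp2_pos:
  assumes "s > 0" "dist x y < 1 / s"
  shows "bump bp2 s x y > 0"
proof -
  have "(s * norm (y - x))\<^sup>2 < 1"
    using assms by (subst power_less_one_iff)
      (simp_all add: dist_norm norm_minus_commute field_simps)
  then show ?thesis
    by (simp add: bump_def bexp_bp2_pos power2_norm_eq_inner[symmetric] power_mult_distrib)
qed

lemma bump_bp0_nonneg: "bump bp0 s x y \<ge> 0" and bump_bp2_nonneg: "bump bp2 s x y \<ge> 0"
  by (simp_all add: bump_def bexp_bp0_nonneg bexp_bp2_nonneg)

lemma bump_bounded: "\<exists>C>0. \<forall>s x y. \<bar>bump p s x y\<bar> \<le> C"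
proof -
  obtain C where "C > 0" "\<forall>s\<le>1. \<bar>bexp p s\<bar> \<le> C"
    using bexp_bounded by blast
  moreover have "1 - s\<^sup>2 * ((y - x) \<bullet> (y - x)) \<le> 1" for s and x y :: 'a
    by simp
  ultimately show ?thesis
    unfolding bump_def by blast
qed

section \<open>Test functions\<close>

lemma test_functionI:
  "smooth \<phi> \<Longrightarrow> compact K \<Longrightarrow> K \<subseteq> \<Omega> \<Longrightarrow> (\<And>x. x \<notin> K \<Longrightarrow> \<phi> x = 0) \<Longrightarrow> test_function \<Omega> \<phi>"
  unfolding test_function_def smooth_def by blast

lemma test_functionE:
  assumes "test_function \<Omega> \<phi>"
  obtains K where "smooth \<phi>" "compact K" "K \<subseteq> \<Omega>" "\<And>x. x \<notin> K \<Longrightarrow> \<phi> x = 0"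
  using assms unfolding test_function_def smooth_def by blast

lemma test_smooth: "test_function \<Omega> \<phi> \<Longrightarrow> smooth \<phi>"
  by (auto elim: test_functionE)

lemma test_function_bump:
  assumes "s > 0" "cball x (1 / s) \<subseteq> \<Omega>"
  shows "test_function \<Omega> (bump p s x)"
  by (rule test_functionI[OF smooth_bump _ assms(2)]) (auto intro: bump_eq_0 assms(1))

lemma test_function_cmult: "test_function \<Omega> \<phi> \<Longrightarrow> test_function \<Omega> (\<lambda>x. c * \<phi> x)"
  by (elim test_functionE, rule test_functionI) (auto intro: smooth_cmult)

lemma test_function_add:
  assumes "test_function \<Omega> \<phi>" "test_function \<Omega> \<psi>"
  shows "test_function \<Omega> (\<lambda>x. \<phi> x + \<psi> x)"
proof -
  obtain K L where "smooth \<phi>" "compact K" "K \<subseteq> \<Omega>" "\<And>x. x \<notin> K \<Longrightarrow> \<phi> x = 0"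
    "smooth \<psi>" "compact L" "L \<subseteq> \<Omega>" "\<And>x. x \<notin> L \<Longrightarrow> \<psi> x = 0"
    using assms by (metis test_functionE)
  then show ?thesis
    by (intro test_functionI[of _ "K \<union> L"] smooth_add) auto
qed

lemma pd_eq_0_outside:
  assumes "compact K" "\<And>x. x \<notin> K \<Longrightarrow> f x = 0" "x \<notin> K"
  shows "pd f b x = 0"
proof -
  have "open (- K)" "x \<in> - K"
    using assms by (auto simp: compact_imp_closed)
  then have "(f has_derivative (\<lambda>h. 0)) (at x)"
    by (rule has_derivative_transform_within_open[where f = "\<lambda>_. 0", rotated])
       (use assms in auto)
  then show ?thesis
    using frechet_derivative_eqI by fastforce
qed

lemma test_function_pd:
  assumes "test_function \<Omega> \<phi>" "b \<in> Basis"
  shows "test_function \<Omega> (pd \<phi> b)"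
proof -
  obtain K where "smooth \<phi>" "compact K" "K \<subseteq> \<Omega>" "\<And>x. x \<notin> K \<Longrightarrow> \<phi> x = 0"
    using assms(1) by (rule test_functionE) blast
  then show ?thesis
    using assms(2) by (intro test_functionI[of _ K] smooth_pd pd_eq_0_outside[of K]) auto
qed

lemma compact_support_bounded:
  fixes f :: "'a::euclidean_space \<Rightarrow> real"
  assumes "continuous_on UNIV f" "compact K" "\<And>x. x \<notin> K \<Longrightarrow> f x = 0"
  shows "\<exists>C>0. \<forall>x. \<bar>f x\<bar> \<le> C"
proof -
  have "bounded (f ` K)"
    using assms by (meson compact_continuous_image compact_imp_bounded continuous_on_subset top_greatest)
  then obtain C where "C > 0" "\<forall>x\<in>K. \<bar>f x\<bar> \<le> C"
    by (auto simp: bounded_pos)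
  then show ?thesis
    using assms(3) by (metis abs_zero less_imp_le)
qed

lemma test_function_bounded: "test_function \<Omega> \<phi> \<Longrightarrow> \<exists>C>0. \<forall>x. \<bar>\<phi> x\<bar> \<le> C"
  by (meson compact_support_bounded smooth_continuous test_functionE)

definition soft_abs :: "real \<Rightarrow> real \<Rightarrow> real" where
  "soft_abs d t = sqrt (t\<^sup>2 + d\<^sup>2) - d"

lemma smooth_sqrt:
  assumes "smooth q" "\<And>x. q x > 0"
  shows "smooth (\<lambda>x. sqrt (q x))"
proof -
  define F where "F = (\<lambda>(n::nat) s. (\<Prod>i<n. 1/2 - real i) * s powr (1/2 - real n))"
  have "(F n has_real_derivative F (Suc n) s) (at s)" if "s \<in> {0<..}" for n s
    using that unfolding F_def
    by (auto intro!: derivative_eq_intros simp: algebra_simps)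
  then have "smooth (\<lambda>x. F 0 (q x))"
    using assms by (intro smooth_compose[of "{0<..}" F q 0]) auto
  moreover have "F 0 (q x) = sqrt (q x)" for x
    using assms(2)[of x] by (simp add: F_def powr_half_sqrt)
  ultimately show ?thesis
    by simp
qed

lemma test_function_soft_abs:
  assumes "test_function \<Omega> \<phi>" "d > 0"
  shows "test_function \<Omega> (\<lambda>x. soft_abs d (\<phi> x))"
proof -
  obtain K where K: "smooth \<phi>" "compact K" "K \<subseteq> \<Omega>" "\<And>x. x \<notin> K \<Longrightarrow> \<phi> x = 0"
    using assms(1) by (rule test_functionE) blast
  have "smooth (\<lambda>x. soft_abs d (\<phi> x))"
    unfolding soft_abs_def power2_eq_square
    using assms(2) K(1)
    by (intro smooth_diff smooth_sqrt smooth_add smooth_mult smooth_const)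
       (auto intro: add_nonneg_pos)
  then show ?thesis
    using K assms(2) by (intro test_functionI[of _ K]) (auto simp: soft_abs_def)
qed

lemma soft_abs_approx:
  assumes "d > 0"
  shows "\<bar>t\<bar> - d \<le> soft_abs d t" "soft_abs d t \<le> \<bar>t\<bar>" "0 \<le> soft_abs d t"
proof -
  have "sqrt (t\<^sup>2 + d\<^sup>2) \<le> \<bar>t\<bar> + d"
    using assms by (intro real_le_lsqrt) (auto simp: power2_sum)
  moreover have "\<bar>t\<bar> \<le> sqrt (t\<^sup>2 + d\<^sup>2)" "d \<le> sqrt (t\<^sup>2 + d\<^sup>2)"
    using assms by (auto intro: real_le_rsqrt)
  ultimately show "\<bar>t\<bar> - d \<le> soft_abs d t" "soft_abs d t \<le> \<bar>t\<bar>" "0 \<le> soft_abs d t"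
    by (auto simp: soft_abs_def)
qed

lemma pd_soft_abs_le:
  assumes "smooth \<phi>" "d > 0"
  shows "\<bar>pd (\<lambda>x. soft_abs d (\<phi> x)) b x\<bar> \<le> \<bar>pd \<phi> b x\<bar>"
proof -
  let ?r = "sqrt ((\<phi> x)\<^sup>2 + d\<^sup>2)"
  have pos: "(\<phi> x)\<^sup>2 + d\<^sup>2 > 0"
    using assms(2) by (intro add_nonneg_pos) auto
  have "((\<lambda>x. soft_abs d (\<phi> x)) has_derivative (\<lambda>h. \<phi> x / ?r * frechet_derivative \<phi> (at x) h)) (at x)"
    unfolding soft_abs_def using pos
    by (auto intro!: derivative_eq_intros smooth_has_derivative assms simp: field_simps)
  then have "pd (\<lambda>x. soft_abs d (\<phi> x)) b x = \<phi> x / ?r * pd \<phi> b x"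
    using frechet_derivative_eqI by fastforce
  moreover have "\<bar>\<phi> x\<bar> \<le> ?r"
    by (auto intro: real_le_rsqrt)
  then have "\<bar>\<phi> x / ?r\<bar> \<le> 1"
    using pos by (simp add: abs_divide divide_le_eq)
  ultimately show ?thesis
    by (metis abs_ge_zero abs_mult mult_left_le_one_le)
qed

section \<open>Integration tools\<close>

lemma nonneg_quadratic_imp:
  fixes A B C :: real
  assumes "\<And>t. A - 2 * t * C + t\<^sup>2 * B \<ge> 0" and "B \<ge> 0"
  shows "C\<^sup>2 \<le> A * B"
proof (cases "B = 0")
  case True
  have "C = 0"
  proof (rule ccontr)
    assume "C \<noteq> 0"
    then show False
      using assms(1)[of "(A + 1) / (2 * C)"] True by simp
  qed
  then show ?thesis
    using True by simp
next
  case False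
  show ?thesis
    using assms(1)[of "C / B"] assms(2) False by (simp add: field_simps power2_eq_square)
qed

lemma integrable_inner_L2:
  fixes f g :: "'x \<Rightarrow> 'b::euclidean_space"
  assumes "f \<in> borel_measurable M" "g \<in> borel_measurable M"
    and "integrable M (\<lambda>x. (norm (f x))\<^sup>2)" "integrable M (\<lambda>x. (norm (g x))\<^sup>2)"
  shows "integrable M (\<lambda>x. f x \<bullet> g x)"
proof (rule Bochner_Integration.integrable_bound[OF Bochner_Integration.integrable_add[OF assms(3,4)]])
  have "\<bar>f x \<bullet> g x\<bar> \<le> (norm (f x))\<^sup>2 + (norm (g x))\<^sup>2" for x
  proof -
    have "\<bar>f x \<bullet> g x\<bar> \<le> norm (f x) * norm (g x)"
      by (rule Cauchy_Schwarz_ineq2)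
    also have "\<dots> \<le> (norm (f x))\<^sup>2 + (norm (g x))\<^sup>2"
      using sum_squares_bound[of "norm (f x)" "norm (g x)"]
        mult_nonneg_nonneg[OF norm_ge_zero norm_ge_zero, of "f x" "g x"] by linarith
    finally show ?thesis .
  qed
  then show "AE x in M. norm (f x \<bullet> g x) \<le> norm ((norm (f x))\<^sup>2 + (norm (g x))\<^sup>2)"
    by (auto intro!: always_eventually)
qed (use assms in auto)

lemma Cauchy_Schwarz_integral:
  fixes f g :: "'x \<Rightarrow> 'b::euclidean_space"
  assumes "f \<in> borel_measurable M" "g \<in> borel_measurable M"
    and "integrable M (\<lambda>x. (norm (f x))\<^sup>2)" "integrable M (\<lambda>x. (norm (g x))\<^sup>2)"
  shows "\<bar>LINT x|M. f x \<bullet> g x\<bar> \<le> sqrt (LINT x|M. (norm (f x))\<^sup>2) * sqrt (LINT x|M. (norm (g x))\<^sup>2)"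
proof -
  let ?A = "LINT x|M. (norm (f x))\<^sup>2" and ?B = "LINT x|M. (norm (g x))\<^sup>2"
    and ?C = "LINT x|M. f x \<bullet> g x"
  note int = integrable_inner_L2[OF assms]
  have "?A - 2 * t * ?C + t\<^sup>2 * ?B = (LINT x|M. (norm (f x - t *\<^sub>R g x))\<^sup>2)" for t
  proof -
    have "(norm (f x - t *\<^sub>R g x))\<^sup>2 = (norm (f x))\<^sup>2 - 2 * t * (f x \<bullet> g x) + t\<^sup>2 * (norm (g x))\<^sup>2" for x
    proof -
      have "g x \<bullet> f x = f x \<bullet> g x"
        by (rule inner_commute)
      then show ?thesis
        by (simp add: power2_norm_eq_inner inner_diff_left inner_diff_right)
           (simp add: power2_eq_square algebra_simps)
    qed
    then show ?thesis
      using int assms by simp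
  qed
  then have "?C\<^sup>2 \<le> ?A * ?B"
    by (intro nonneg_quadratic_imp) (auto intro!: integral_nonneg_AE)
  then have "sqrt (?C\<^sup>2) \<le> sqrt (?A * ?B)"
    by (rule real_sqrt_le_mono)
  then show ?thesis
    by (simp add: real_sqrt_mult)
qed

lemma DERIV_integral:
  fixes f :: "'x \<Rightarrow> real" and K :: "real \<Rightarrow> 'x \<Rightarrow> real"
  assumes f: "integrable M f" and r: "r > 0"
    and meas: "\<And>t. K t \<in> borel_measurable M"
    and bdd: "\<And>t x. \<bar>t - t0\<bar> < r \<Longrightarrow> \<bar>K t x\<bar> \<le> C"
    and deriv: "\<And>t x. \<bar>t - t0\<bar> < r \<Longrightarrow> ((\<lambda>t. K t x) has_real_derivative K' t x) (at t)"
    and bdd': "\<And>t x. \<bar>t - t0\<bar> < r \<Longrightarrow> \<bar>K' t x\<bar> \<le> L"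
    and meas': "K' t0 \<in> borel_measurable M"
  shows "((\<lambda>t. LINT x|M. f x * K t x) has_real_derivative (LINT x|M. f x * K' t0 x)) (at t0)"
proof -
  have int: "integrable M (\<lambda>x. f x * K t x)" if "\<bar>t - t0\<bar> < r" for t
  proof (rule Bochner_Integration.integrable_bound)
    show "integrable M (\<lambda>x. C * \<bar>f x\<bar>)"
      using f by auto
    have "\<bar>f x\<bar> * \<bar>K t x\<bar> \<le> \<bar>f x\<bar> * C" for x
      by (intro mult_left_mono bdd that) auto
    then show "AE x in M. norm (f x * K t x) \<le> norm (C * \<bar>f x\<bar>)"
      by (intro always_eventually) (metis abs_ge_self abs_mult mult.commute order_trans real_norm_def)
  qed (use f meas in auto)
  have "((\<lambda>h. LINT x|M. f x * ((K (t0 + h) x - K t0 x) / h)) \<longlongrightarrow> (LINT x|M. f x * K' t0 x)) (at 0)"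
    unfolding tendsto_at_iff_sequentially
  proof (intro allI impI)
    fix X :: "nat \<Rightarrow> real"
    assume X: "\<forall>i. X i \<in> UNIV - {0}" "X \<longlonglongrightarrow> 0"
    have "\<forall>\<^sub>F i in sequentially. \<bar>X i\<bar> < r"
      using X(2) r by (auto simp: LIMSEQ_iff eventually_sequentially)
    then obtain N where N: "\<And>i. i \<ge> N \<Longrightarrow> \<bar>X i\<bar> < r"
      by (auto simp: eventually_sequentially)
    define Y where "Y = (\<lambda>i. X (i + N))"
    have Y: "\<And>i. Y i \<noteq> 0" "Y \<longlonglongrightarrow> 0" "\<And>i. \<bar>Y i\<bar> < r"
      using X N LIMSEQ_ignore_initial_segment[of X 0 N] by (auto simp: Y_def)
    have "(\<lambda>i. LINT x|M. f x * ((K (t0 + Y i) x - K t0 x) / Y i)) \<longlonglongrightarrow> (LINT x|M. f x * K' t0 x)"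
    proof (rule integral_dominated_convergence[where w = "\<lambda>x. L * \<bar>f x\<bar>"])
      have "(\<lambda>i. (K (t0 + Y i) x - K t0 x) / Y i) \<longlonglongrightarrow> K' t0 x" for x
        using deriv[of t0 x] r Y(1,2)
        by (auto simp: DERIV_def tendsto_at_iff_sequentially comp_def)
      then show "AE x in M. (\<lambda>i. f x * ((K (t0 + Y i) x - K t0 x) / Y i)) \<longlonglongrightarrow> f x * K' t0 x"
        by (intro always_eventually allI tendsto_mult tendsto_const)
    next
      fix i
      have "\<bar>(K (t0 + Y i) x - K t0 x) / Y i\<bar> \<le> L" for x
      proof -
        have seg: "\<bar>t - t0\<bar> < r" if "t \<in> closed_segment t0 (t0 + Y i)" for t
          using that Y(3)[of i] by (auto simp: closed_segment_eq_real_ivl split: if_splits)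
        have "norm (K (t0 + Y i) x - K t0 x) \<le> L * norm (t0 + Y i - t0)"
          by (rule field_differentiable_bound[where S = "closed_segment t0 (t0 + Y i)" and f' = "\<lambda>t. K' t x"])
             (use deriv bdd' seg in \<open>auto intro: has_field_derivative_at_within\<close>)
        then show ?thesis
          using Y(1)[of i] by (simp add: abs_divide divide_le_eq)
      qed
      then have "\<bar>f x\<bar> * \<bar>(K (t0 + Y i) x - K t0 x) / Y i\<bar> \<le> \<bar>f x\<bar> * L" for x
        by (rule mult_left_mono) auto
      then show "AE x in M. norm (f x * ((K (t0 + Y i) x - K t0 x) / Y i)) \<le> L * \<bar>f x\<bar>"
        by (intro always_eventually allI) (simp only: real_norm_def abs_mult mult.commute)
    qed (use f meas meas' in auto)
    then have "(\<lambda>i. LINT x|M. f x * ((K (t0 + X i) x - K t0 x) / X i)) \<longlonglongrightarrow> (LINT x|M. f x * K' t0 x)"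
      unfolding Y_def by (rule LIMSEQ_offset)
    then show "((\<lambda>h. LINT x|M. f x * ((K (t0 + h) x - K t0 x) / h)) \<circ> X) \<longlonglongrightarrow> (LINT x|M. f x * K' t0 x)"
      by (simp add: comp_def)
  qed
  moreover have "\<forall>\<^sub>F h in at 0. (LINT x|M. f x * ((K (t0 + h) x - K t0 x) / h))
      = ((LINT x|M. f x * K (t0 + h) x) - (LINT x|M. f x * K t0 x)) / h"
    unfolding eventually_at
  proof (intro exI[of _ r] conjI ballI impI r)
    fix h :: real assume "h \<noteq> 0 \<and> dist h 0 < r"
    then have "integrable M (\<lambda>x. f x * K (t0 + h) x)" "integrable M (\<lambda>x. f x * K t0 x)"
      using int r by auto
    then have "((LINT x|M. f x * K (t0 + h) x) - (LINT x|M. f x * K t0 x)) / h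
        = (LINT x|M. (f x * K (t0 + h) x - f x * K t0 x) / h)"
      by simp
    also have "\<dots> = (LINT x|M. f x * ((K (t0 + h) x - K t0 x) / h))"
      by (simp add: right_diff_distrib)
    finally show "(LINT x|M. f x * ((K (t0 + h) x - K t0 x) / h))
      = ((LINT x|M. f x * K (t0 + h) x) - (LINT x|M. f x * K t0 x)) / h" ..
  qed
  ultimately show ?thesis
    unfolding DERIV_def by (rule Lim_transform_eventually)
qed

lemma integral_lborel_translate:
  fixes f :: "'a::euclidean_space \<Rightarrow> real"
  assumes "f \<in> borel_measurable borel"
  shows "(LINT x|lborel. f (x + c)) = (LINT x|lborel. f x)"
proof -
  have "(LINT x|lborel. f x) = (LINT x|distr lborel borel ((+) c). f x)"
    by (simp add: lborel_distr_plus)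
  also have "\<dots> = (LINT x|lborel. f (c + x))"
    using assms by (subst integral_distr) auto
  finally show ?thesis
    by (simp add: add.commute)
qed

lemma integrable_lborel_translate:
  fixes f :: "'a::euclidean_space \<Rightarrow> real"
  assumes "integrable lborel f"
  shows "integrable lborel (\<lambda>x. f (x + c))"
proof -
  have "integrable (distr lborel borel ((+) c)) f"
    using assms by (simp add: lborel_distr_plus)
  then show ?thesis
    using borel_measurable_integrable[OF assms]
    by (subst (asm) integrable_distr_eq) (auto simp: add.commute)
qed

lemma integrable_bounded_support:
  fixes f :: "'a::euclidean_space \<Rightarrow> real"
  assumes "f \<in> borel_measurable borel" "\<And>x. \<bar>f x\<bar> \<le> C" "bounded S" "\<And>x. x \<notin> S \<Longrightarrow> f x = 0"
  shows "integrable lborel f"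
proof -
  obtain r where r: "S \<subseteq> ball 0 r"
    using assms(3) bounded_subset_ballD by blast
  have int: "integrable lborel (\<lambda>x. C * indicator (ball 0 r) x :: real)"
    by (intro integrable_mult_right integrable_real_indicator)
       (use emeasure_bounded_finite[of "ball 0 r"] in auto)
  have "\<bar>f x\<bar> \<le> \<bar>C * indicator (ball 0 r) x\<bar>" for x :: 'a
    using assms(2)[of x] assms(4)[of x] r by (cases "x \<in> S") auto
  then have ae: "AE x in lborel. norm (f x) \<le> norm (C * indicator (ball 0 r) x :: real)"
    by (simp add: always_eventually)
  show ?thesis
    by (rule Bochner_Integration.integrable_bound[OF int _ ae]) (use assms(1) in simp)
qed

lemma integral_partial_derivative_eq_0:
  fixes F F' :: "'a::euclidean_space \<Rightarrow> real"
  assumes der: "\<And>x. ((\<lambda>t. F (x + t *\<^sub>R b)) has_real_derivative F' x) (at 0)"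
    and cont: "continuous_on UNIV F" "continuous_on UNIV F'"
    and K: "compact K" "\<And>x. x \<notin> K \<Longrightarrow> F x = 0" "\<And>x. x \<notin> K \<Longrightarrow> F' x = 0"
  shows "(LINT x|lborel. F' x) = 0"
proof -
  obtain C L where C: "\<And>x. \<bar>F x\<bar> \<le> C" and L: "\<And>x. \<bar>F' x\<bar> \<le> L"
    using compact_support_bounded[OF cont(1) K(1,2)] compact_support_bounded[OF cont(2) K(1,3)]
    by blast
  obtain r where r: "K \<subseteq> ball 0 r" "r > 0"
    using compact_imp_bounded[OF K(1)] bounded_subset_ballD by blast
  define S where "S = ball (0::'a) (r + norm b)"
  have "integrable lborel (indicator S :: 'a \<Rightarrow> real)"
    unfolding S_def by (intro integrable_real_indicator) (use emeasure_bounded_finite[of "ball 0 (r + norm b)"] in auto)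
  moreover have "((\<lambda>s. F (x + s *\<^sub>R b)) has_real_derivative F' (x + t *\<^sub>R b)) (at t)" for t x
    using DERIV_shift[of "\<lambda>s. F (x + s *\<^sub>R b)" "F' (x + t *\<^sub>R b)" 0 t] der[of "x + t *\<^sub>R b"]
    by (simp add: algebra_simps)
  ultimately have "((\<lambda>t. LINT x|lborel. indicator S x * F (x + t *\<^sub>R b)) has_real_derivative
      (LINT x|lborel. indicator S x * F' (x + 0 *\<^sub>R b))) (at 0)"
    using cont
    by (intro DERIV_integral[where r = 1 and C = C and L = L and K' = "\<lambda>t x. F' (x + t *\<^sub>R b)"])
       (auto intro!: C L borel_measurable_continuous_onI continuous_on_compose2[of UNIV F] continuous_intros)
  moreover have ev: "\<forall>\<^sub>F t in nhds 0. (LINT x|lborel. indicator S x * F (x + t *\<^sub>R b)) = (LINT x|lborel. F x)"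
    unfolding eventually_nhds_metric
  proof (intro exI[of _ 1] conjI allI impI)
    fix t :: real assume t: "dist t 0 < 1"
    have eq: "indicator S x * F (x + t *\<^sub>R b) = F (x + t *\<^sub>R b)" for x
    proof (cases "x \<in> S")
      case False
      have "norm x \<le> norm (x + t *\<^sub>R b) + norm (t *\<^sub>R b)"
        by (metis add_diff_cancel norm_triangle_ineq4)
      moreover have "norm (t *\<^sub>R b) \<le> norm b"
        using t by (simp add: mult_left_le_one_le)
      ultimately have "x + t *\<^sub>R b \<notin> K"
        using False r by (auto simp: S_def)
      then show ?thesis
        by (simp add: K)
    qed simp
    then show "(LINT x|lborel. indicator S x * F (x + t *\<^sub>R b)) = (LINT x|lborel. F x)"
      unfolding eq using cont by (intro integral_lborel_translate borel_measurable_continuous_onI)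
  qed simp
  moreover have "(\<lambda>x. indicator S x * F' (x + 0 *\<^sub>R b)) = F'"
  proof
    fix x
    show "indicator S x * F' (x + 0 *\<^sub>R b) = F' x"
    proof (cases "x \<in> K")
      case True
      then have "x \<in> S"
        using r(1) subset_ball[of r "r + norm b" 0] by (auto simp only: S_def norm_ge_zero le_add_same_cancel1)
      then show ?thesis
        by simp
    qed (simp add: K(3))
  qed
  ultimately have "((\<lambda>t. LINT x|lborel. indicator S x * F (x + t *\<^sub>R b)) has_real_derivative
      (LINT x|lborel. F' x)) (at 0)"
    by simp
  then have "((\<lambda>t. LINT x|lborel. F x) has_real_derivative (LINT x|lborel. F' x)) (at (0::real))"
    using DERIV_cong_ev[OF refl ev refl] by simp
  then show ?thesis
    using DERIV_unique DERIV_const by blast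
qed

lemma has_derivative_imp_directional:
  "(f has_derivative f') (at x) \<Longrightarrow> ((\<lambda>t. f (x + t *\<^sub>R b)) has_real_derivative f' b) (at 0)"
proof -
  assume f: "(f has_derivative f') (at x)"
  have "((\<lambda>t. x + t *\<^sub>R b) has_derivative (\<lambda>t. t *\<^sub>R b)) (at 0)"
    by (auto intro!: derivative_eq_intros)
  then have "((\<lambda>t. f (x + t *\<^sub>R b)) has_derivative (\<lambda>t. f' (t *\<^sub>R b))) (at 0)"
    by (rule has_derivative_compose) (use f in simp)
  then show ?thesis
    using has_derivative_bounded_linear[OF f]
    by (simp add: has_field_derivative_def linear_cmul bounded_linear.linear mult_commute_abs)
qed

lemma smooth_directional:
  "smooth f \<Longrightarrow> ((\<lambda>t. f (x + t *\<^sub>R b)) has_real_derivative pd f b x) (at 0)"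
  by (rule has_derivative_imp_directional[OF smooth_has_derivative])

lemma integral_by_parts_test:
  assumes "test_function \<Omega> \<phi>" "smooth \<psi>" "b \<in> Basis"
  shows "(LINT x|lborel. \<psi> x * pd \<phi> b x) = - (LINT x|lborel. pd \<psi> b x * \<phi> x)"
proof -
  obtain K where K: "smooth \<phi>" "compact K" "\<And>x. x \<notin> K \<Longrightarrow> \<phi> x = 0"
    using assms(1) by (rule test_functionE) blast
  have cont: "continuous_on UNIV \<phi>" "continuous_on UNIV \<psi>" "continuous_on UNIV (pd \<phi> b)"
    "continuous_on UNIV (pd \<psi> b)"
    using K(1) assms(2,3) by (auto intro: smooth_continuous smooth_pd)
  have "(LINT x|lborel. \<psi> x * pd \<phi> b x + pd \<psi> b x * \<phi> x) = 0"
  proof (rule integral_partial_derivative_eq_0)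
    show "((\<lambda>t. \<psi> (x + t *\<^sub>R b) * \<phi> (x + t *\<^sub>R b)) has_real_derivative
        \<psi> x * pd \<phi> b x + pd \<psi> b x * \<phi> x) (at 0)" for x
      using DERIV_mult[OF smooth_directional[OF assms(2)] smooth_directional[OF K(1)]]
      by (simp add: algebra_simps)
    show "\<psi> x * \<phi> x = 0" "\<psi> x * pd \<phi> b x + pd \<psi> b x * \<phi> x = 0" if "x \<notin> K" for x
      using K(3) pd_eq_0_outside[OF K(2,3)] that by auto
  qed (use cont K in \<open>auto intro!: continuous_intros\<close>)
  moreover have "integrable lborel (\<lambda>x. \<psi> x * pd \<phi> b x)" "integrable lborel (\<lambda>x. pd \<psi> b x * \<phi> x)"
  proof -
    have "integrable lborel f" if "continuous_on UNIV f" "\<And>x. x \<notin> K \<Longrightarrow> f x = 0" for f :: "'a \<Rightarrow> real"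
      using compact_support_bounded[of f, OF that(1) K(2)] that K(2)
      by (auto intro!: integrable_bounded_support[of f _ K] borel_measurable_continuous_onI compact_imp_bounded)
    then show "integrable lborel (\<lambda>x. \<psi> x * pd \<phi> b x)" "integrable lborel (\<lambda>x. pd \<psi> b x * \<phi> x)"
      using cont K(3) pd_eq_0_outside[where f = \<phi>, OF K(2,3)]
      by (simp_all add: continuous_on_mult)
  qed
  ultimately show ?thesis
    by simp
qed

section \<open>Averaging against shrinking bumps\<close>

lemma AE_lborel_open_empty:
  fixes S :: "'a::euclidean_space set"
  assumes "open S" "AE x in lborel. x \<notin> S"
  shows "S = {}"
proof -
  have "S \<in> null_sets lborel"
    using assms by (subst AE_iff_null_sets) auto
  then have "negligible S"
    by (simp add: negligible_iff_null_sets null_sets_completionI)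
  then show ?thesis
    using assms(1) open_not_negligible by blast
qed

lemma AE_lborel_locally:
  fixes \<Omega> :: "'a::euclidean_space set"
  assumes "\<And>x. x \<in> \<Omega> \<Longrightarrow> \<exists>r>0. AE y in lborel. y \<in> ball x r \<longrightarrow> P y"
  shows "AE y in lborel. y \<in> \<Omega> \<longrightarrow> P y"
proof -
  obtain r where r: "\<And>x. x \<in> \<Omega> \<Longrightarrow> r x > 0" "\<And>x. x \<in> \<Omega> \<Longrightarrow> AE y in lborel. y \<in> ball x (r x) \<longrightarrow> P y"
    using assms by metis
  obtain F where F: "F \<subseteq> (\<lambda>x. ball x (r x)) ` \<Omega>" "countable F" "\<Union>F = \<Union>((\<lambda>x. ball x (r x)) ` \<Omega>)"
    using Lindelof[of "(\<lambda>x. ball x (r x)) ` \<Omega>"] by auto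
  have "AE y in lborel. \<forall>B\<in>F. y \<in> B \<longrightarrow> P y"
    using F(1,2) r(2) by (subst AE_ball_countable) auto
  moreover have "\<Omega> \<subseteq> \<Union>F"
    unfolding F(3) using r(1) by fastforce
  ultimately show ?thesis
    by (auto elim!: eventually_mono)
qed

definition kern :: "real \<Rightarrow> 'a::euclidean_space \<Rightarrow> 'a \<Rightarrow> real" where
  "kern s x y = s ^ DIM('a) * bump bp2 s x y"

definition avg :: "('a::euclidean_space \<Rightarrow> real) \<Rightarrow> real \<Rightarrow> 'a \<Rightarrow> real" where
  "avg f s x = (LINT y|lborel. f y * kern s x y)"

lemma kern_shift: "kern s x (w + x) = kern s 0 w"
  by (simp add: kern_def bump_def)

lemma kern_nonneg: "s > 0 \<Longrightarrow> kern s x y \<ge> 0"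
  by (simp add: kern_def bump_bp2_nonneg)

lemma kern_continuous: "continuous_on S (kern s x)"
  unfolding kern_def by (intro continuous_intros smooth_continuous smooth_bump)

lemma kern_measurable [measurable]: "kern s x \<in> borel_measurable borel"
  by (intro borel_measurable_continuous_onI kern_continuous)

lemma kern_bounded: "\<exists>C>0. \<forall>x y. \<bar>kern s x y\<bar> \<le> C"
proof -
  obtain C where C: "C > 0" "\<And>x y :: 'a. \<bar>bump bp2 s x y\<bar> \<le> C"
    using bump_bounded by blast
  have "\<bar>kern s x y\<bar> \<le> \<bar>s\<bar> ^ DIM('a) * C" for x y :: 'a
    unfolding kern_def abs_mult power_abs using C(2) by (intro mult_left_mono) auto
  then have "\<bar>kern s x y\<bar> \<le> \<bar>s\<bar> ^ DIM('a) * C + 1" for x y :: 'a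
    by (meson le_add_same_cancel1 order_trans zero_le_one)
  moreover have "\<bar>s\<bar> ^ DIM('a) * C + 1 > 0"
    using C(1) by (intro add_nonneg_pos mult_nonneg_nonneg) auto
  ultimately show ?thesis
    by blast
qed

lemma kern_integrable:
  assumes "s > 0"
  shows "integrable lborel (kern s x)"
proof -
  obtain C where "\<And>y. \<bar>kern s x y\<bar> \<le> C"
    using kern_bounded[of s] by blast
  then show ?thesis
    using assms by (intro integrable_bounded_support[of _ C "cball x (1 / s)"])
      (auto simp: kern_def bump_eq_0)
qed

lemma integrable_mult_bounded:
  fixes f g :: "'x \<Rightarrow> real"
  assumes "integrable M f" "g \<in> borel_measurable M" "\<And>x. \<bar>g x\<bar> \<le> C"
  shows "integrable M (\<lambda>x. f x * g x)"
proof -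
  have int: "integrable M (\<lambda>x. C * \<bar>f x\<bar>)"
    using assms by auto
  have "\<bar>f x\<bar> * \<bar>g x\<bar> \<le> \<bar>f x\<bar> * C" for x
    by (intro mult_left_mono assms) auto
  then have "\<bar>f x * g x\<bar> \<le> C * \<bar>f x\<bar>" for x
    by (simp add: abs_mult mult.commute)
  then have ae: "AE x in M. norm (f x * g x) \<le> norm (C * \<bar>f x\<bar>)"
    by (intro always_eventually) (metis abs_ge_self order_trans real_norm_def)
  show ?thesis
    by (rule Bochner_Integration.integrable_bound[OF int _ ae]) (use assms in auto)
qed

lemma integrable_mult_kern:
  fixes f :: "'a::euclidean_space \<Rightarrow> real"
  assumes "integrable lborel f"
  shows "integrable lborel (\<lambda>y. f y * kern s x y)"
proof -
  obtain C where "\<And>x y :: 'a. \<bar>kern s x y\<bar> \<le> C"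
    using kern_bounded by blast
  then show ?thesis
    by (intro integrable_mult_bounded[OF assms, where C = C]) auto
qed

lemma kern_mass:
  "\<exists>c>0. \<forall>s>0. (LINT w|lborel. kern s (0::'a::euclidean_space) w) = c"
proof (intro exI conjI allI impI)
  let ?c = "LINT w|lborel. kern 1 (0::'a) w"
  show "?c > 0"
  proof (rule ccontr)
    assume "\<not> ?c > 0"
    moreover have "?c \<ge> 0"
      by (intro integral_nonneg_AE always_eventually allI kern_nonneg) simp
    ultimately have "?c = 0"
      by linarith
    then have "AE w in lborel. kern 1 (0::'a) w = 0"
      by (subst (asm) integral_nonneg_eq_0_iff_AE) (simp_all add: kern_nonneg kern_integrable)
    then have "AE w in lborel. w \<notin> ball (0::'a) 1"
      using bump_bp2_pos[of 1 "0::'a"] by (auto simp: kern_def elim!: eventually_mono) force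
    then show False
      using AE_lborel_open_empty[of "ball (0::'a) 1"] by simp
  qed
  fix s :: real assume "s > 0"
  have "?c = (LINT w|density (distr lborel borel (\<lambda>x. 0 + s *\<^sub>R x)) (\<lambda>_. \<bar>s\<bar> ^ DIM('a)). kern 1 (0::'a) w)"
    using lborel_affine[of s "0::'a"] \<open>s > 0\<close> by simp
  also have "\<dots> = (LINT w|lborel. \<bar>s\<bar> ^ DIM('a) * kern 1 (0::'a) (s *\<^sub>R w))"
    by (subst integral_density) (auto simp: integral_distr)
  also have "\<dots> = (LINT w|lborel. kern s (0::'a) w)"
    using \<open>s > 0\<close> by (simp add: kern_def bump_def power2_eq_square mult_ac)
  finally show "(LINT w|lborel. kern s (0::'a) w) = ?c" ..
qed

lemma translate_continuity:
  fixes f :: "'a::euclidean_space \<Rightarrow> real"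
  assumes f: "f \<in> borel_measurable borel" "integrable lborel (\<lambda>x. (f x)\<^sup>2)"
    and E: "E \<in> sets borel" "bounded E" and "e > 0"
  obtains d where "d > 0"
    "\<And>w. norm w < d \<Longrightarrow> \<bar>LINT y|lborel. f y * (indicator E (y - w) - indicator E y)\<bar> \<le> e"
proof -
  define M where "M = (LINT x|lborel. (f x)\<^sup>2)"
  define \<eta> where "\<eta> = (e / (sqrt M + 1))\<^sup>2 / 4"
  have M: "M \<ge> 0"
    by (simp add: M_def)
  then have "sqrt M + 1 > 0"
    by (intro add_nonneg_pos) auto
  then have \<eta>: "\<eta> > 0"
    using \<open>e > 0\<close> by (simp add: \<eta>_def)
  obtain U where U: "open U" "E \<subseteq> U" "emeasure lborel (U - E) < ennreal \<eta>"
    using outer_regular_lborel[OF E(1) \<eta>] by metis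
  obtain V where V: "open V" "- E \<subseteq> V" "emeasure lborel (V - - E) < ennreal \<eta>"
    using outer_regular_lborel[of "- E" \<eta>] E(1) \<eta> by (metis borel_comp)
  define K where "K = - V"
  have K: "compact K" "K \<subseteq> E"
    using V(1,2) E(2) bounded_subset[of E K] by (auto simp: K_def compact_eq_bounded_closed)
  obtain d where d: "d > 0" "(\<Union>x\<in>K. ball x d) \<subseteq> U"
    using compact_subset_open_imp_ball_epsilon_subset[OF K(1) U(1)] K(2) U(2) by blast
  let ?D = "U - K"
  have D: "?D \<in> sets borel"
    using U(1) K(1) by (auto intro: borel_compact)
  have "?D = (U - E) \<union> (V - - E)"
    using K(2) U(2) by (auto simp: K_def)
  then have "emeasure lborel ?D \<le> emeasure lborel (U - E) + emeasure lborel (V - - E)"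
    using U(1) V(1) E(1) by (simp add: emeasure_subadditive)
  also have "\<dots> \<le> ennreal \<eta> + ennreal \<eta>"
    using U(3) V(3) by (intro add_mono) auto
  also have "\<dots> = ennreal (2 * \<eta>)"
    using \<eta> by (simp flip: ennreal_plus)
  finally have em: "emeasure lborel ?D \<le> ennreal (2 * \<eta>)" .
  then have intD: "integrable lborel (indicator ?D :: 'a \<Rightarrow> real)"
    using D by (intro integrable_real_indicator) (auto intro: le_less_trans)
  have mD: "(LINT y|lborel. indicator ?D y) \<le> 2 * \<eta>"
    using D em \<eta> by (simp add: measure_def enn2real_leI)
  show thesis
  proof
    show "d > 0" by fact
    fix w :: 'a assume w: "norm w < d"
    let ?g = "\<lambda>y. indicator E (y - w) - indicator E y :: real"
    have gm: "?g \<in> borel_measurable borel"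
      using E(1) by measurable
    have near: "y + w \<in> U" "y - w \<in> U" if "y \<in> K" for y
    proof -
      have "y + w \<in> ball y d" "y - w \<in> ball y d"
        using w by (simp_all add: dist_norm)
      moreover have "ball y d \<subseteq> U"
        using d(2) that by blast
      ultimately show "y + w \<in> U" "y - w \<in> U"
        by (metis subsetD)+
    qed
    have g2: "(norm (?g y))\<^sup>2 \<le> indicator ?D (y - w) + indicator ?D y" for y
    proof -
      consider "y \<in> E" "y - w \<in> E" | "y \<notin> E" "y - w \<notin> E" | "y \<in> E" "y - w \<notin> E" | "y \<notin> E" "y - w \<in> E"
        by blast
      then show ?thesis
      proof cases
        case 3
        then have "y \<in> ?D \<or> y - w \<in> ?D"
          using near(2)[of y] U(2) K(2) by auto
        with 3 show ?thesis by (auto simp: indicator_def)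
      next
        case 4
        then have "y \<in> ?D \<or> y - w \<in> ?D"
          using near(1)[of "y - w"] U(2) K(2) by auto
        with 4 show ?thesis by (auto simp: indicator_def)
      qed (auto simp: indicator_def)
    qed
    have intD': "integrable lborel (\<lambda>y. indicator ?D (y - w) :: real)"
      using integrable_lborel_translate[OF intD, of "- w"] by simp
    have intS: "integrable lborel (\<lambda>y. indicator ?D (y - w) + indicator ?D y :: real)"
      using intD intD' by simp
    have intg: "integrable lborel (\<lambda>y. (norm (?g y))\<^sup>2)"
    proof (rule Bochner_Integration.integrable_bound[OF intS])
      show "AE y in lborel. norm ((norm (?g y))\<^sup>2) \<le> norm (indicator ?D (y - w) + indicator ?D y :: real)"
        using g2 by (intro always_eventually) (metis abs_ge_self abs_norm_cancel order_trans power_abs real_norm_def)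
    qed (use gm in simp)
    have "(LINT y|lborel. (norm (?g y))\<^sup>2) \<le> (LINT y|lborel. indicator ?D (y - w) + indicator ?D y)"
      using g2 by (intro integral_mono intg intS) auto
    also have "\<dots> = (LINT y|lborel. indicator ?D (y + - w)) + (LINT y|lborel. indicator ?D y)"
      using intD intD' by simp
    also have "\<dots> = 2 * (LINT y|lborel. indicator ?D y)"
      using D by (subst integral_lborel_translate) auto
    also have "\<dots> \<le> (e / (sqrt M + 1))\<^sup>2"
      using mD by (simp add: \<eta>_def)
    finally have "sqrt (LINT y|lborel. (norm (?g y))\<^sup>2) \<le> e / (sqrt M + 1)"
      using \<open>e > 0\<close> M by (intro real_le_lsqrt) auto
    then have "sqrt M * sqrt (LINT y|lborel. (norm (?g y))\<^sup>2) \<le> sqrt M * (e / (sqrt M + 1))"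
      by (rule mult_left_mono) (use M in simp)
    also have "\<dots> \<le> e"
    proof -
      have "e * sqrt M \<le> e * (sqrt M + 1)" "sqrt M + 1 > 0"
        using \<open>e > 0\<close> M by (auto intro: add_nonneg_pos)
      then show ?thesis
        by (simp add: divide_le_eq mult.commute)
    qed
    finally have "sqrt M * sqrt (LINT y|lborel. (norm (?g y))\<^sup>2) \<le> e" .
    moreover have "\<bar>LINT y|lborel. f y * ?g y\<bar> \<le> sqrt M * sqrt (LINT y|lborel. (norm (?g y))\<^sup>2)"
      using Cauchy_Schwarz_integral[of f lborel ?g] f gm intg by (simp add: M_def)
    ultimately show "\<bar>LINT y|lborel. f y * ?g y\<bar> \<le> e"
      by linarith
  qed
qed

lemma avg_localized:
  fixes f :: "'a::euclidean_space \<Rightarrow> real"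
  assumes f: "f \<in> borel_measurable borel" "integrable lborel f"
    and E: "E \<in> sets borel" "bounded E" and "s > 0"
  shows "integrable lborel (\<lambda>x. indicator E x * avg f s x)" (is ?int)
    and "(LINT x|lborel. indicator E x * avg f s x)
      = (LINT w|lborel. kern s 0 w * (LINT y|lborel. f y * indicator E (y - w)))" (is ?eq)
    and "integrable lborel (\<lambda>w. kern s 0 w * (LINT y|lborel. f y * indicator E (y - w)))" (is ?int2)
proof -
  let ?F = "\<lambda>x w. indicator E x * (f (x + w) * kern s 0 w) :: real"
  note [measurable] = f(1) E(1)
  obtain C where C: "\<And>x w :: 'a. \<bar>kern s x w\<bar> \<le> C"
    using kern_bounded by blast
  have avg_eq: "avg f s x = (LINT w|lborel. f (x + w) * kern s 0 w)" for x
    using integral_lborel_translate[of "\<lambda>y. f y * kern s x y" x]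
    by (simp add: avg_def kern_shift add.commute)
  have inner: "integrable lborel (\<lambda>w. f (x + w) * kern s 0 w)" for x
    using integrable_lborel_translate[OF f(2), of x]
    by (intro integrable_mult_kern) (simp add: add.commute)
  have meas: "case_prod ?F \<in> borel_measurable (lborel \<Otimes>\<^sub>M lborel)"
    by measurable
  have "integrable (lborel \<Otimes>\<^sub>M lborel) (case_prod ?F)"
  proof (rule lborel_pair.Fubini_integrable[OF meas])
    have bound: "(LINT w|lborel. norm (?F x w)) \<le> indicator E x * (C * (LINT y|lborel. \<bar>f y\<bar>))" for x
    proof (cases "x \<in> E")
      case True
      have "(LINT w|lborel. norm (?F x w)) \<le> (LINT w|lborel. C * \<bar>f (w + x)\<bar>)"
      proof (rule integral_mono)
        show "integrable lborel (\<lambda>w. norm (?F x w))"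
          using inner[of x] by (intro integrable_norm integrable_mult_right) simp
        show "integrable lborel (\<lambda>w. C * \<bar>f (w + x)\<bar>)"
          using integrable_lborel_translate[OF f(2), of x] by simp
        show "norm (?F x w) \<le> C * \<bar>f (w + x)\<bar>" for w
          using mult_left_mono[OF C[of 0 w], of "\<bar>f (x + w)\<bar>"] True
          by (simp add: abs_mult mult.commute add.commute)
      qed
      also have "\<dots> = C * (LINT y|lborel. \<bar>f y\<bar>)"
        using integral_lborel_translate[of "\<lambda>y. \<bar>f y\<bar>" x] by simp
      finally show ?thesis
        using True by simp
    qed simp
    show "integrable lborel (\<lambda>x. LINT w|lborel. norm (case (x, w) of (x, w) \<Rightarrow> ?F x w))"
    proof (rule Bochner_Integration.integrable_bound)
      show "integrable lborel (\<lambda>x. indicator E x * (C * (LINT y|lborel. \<bar>f y\<bar>)))"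
        using E emeasure_bounded_finite[OF E(2)]
        by (intro integrable_mult_left integrable_real_indicator) auto
      show "AE x in lborel. norm (LINT w|lborel. norm (case (x, w) of (x, w) \<Rightarrow> ?F x w))
          \<le> norm (indicator E x * (C * (LINT y|lborel. \<bar>f y\<bar>)))"
      proof (intro always_eventually allI)
        fix x
        have "0 \<le> (LINT w|lborel. norm (?F x w))"
          by (intro integral_nonneg_AE always_eventually) simp
        then show "norm (LINT w|lborel. norm (case (x, w) of (x, w) \<Rightarrow> ?F x w))
          \<le> norm (indicator E x * (C * (LINT y|lborel. \<bar>f y\<bar>)))"
          using bound[of x] by (simp only: prod.case real_norm_def abs_of_nonneg)
      qed
    qed measurable
    show "AE x in lborel. integrable lborel (\<lambda>w. case (x, w) of (x, w) \<Rightarrow> ?F x w)"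
      using inner by (intro always_eventually) (auto intro!: integrable_mult_right)
  qed
  then have Fub: "(LINT w|lborel. LINT x|lborel. ?F x w) = (LINT x|lborel. LINT w|lborel. ?F x w)"
    "integrable lborel (\<lambda>x. LINT w|lborel. ?F x w)" "integrable lborel (\<lambda>w. LINT x|lborel. ?F x w)"
    using lborel_pair.Fubini_integral lborel_pair.integrable_fst lborel_pair.integrable_snd by blast+
  have 1: "(LINT w|lborel. ?F x w) = indicator E x * avg f s x" for x
    by (simp add: avg_eq)
  have 2: "(LINT x|lborel. ?F x w) = kern s 0 w * (LINT y|lborel. f y * indicator E (y - w))" for w
  proof -
    have "(LINT x|lborel. ?F x w) = (LINT x|lborel. kern s 0 w * (f (x + w) * indicator E (x + w - w)))"
      by (simp add: mult_ac)
    also have "\<dots> = kern s 0 w * (LINT x|lborel. f (x + w) * indicator E (x + w - w))"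
      by (rule integral_mult_right_zero)
    also have "(LINT x|lborel. f (x + w) * indicator E (x + w - w)) = (LINT y|lborel. f y * indicator E (y - w))"
      using integral_lborel_translate[of "\<lambda>y. f y * indicator E (y - w)" w] by simp
    finally show ?thesis .
  qed
  show ?int ?eq ?int2
    using Fub unfolding 1 2 by simp_all
qed

lemma avg_localized_limit:
  fixes f :: "'a::euclidean_space \<Rightarrow> real"
  assumes f: "f \<in> borel_measurable borel" "integrable lborel f" "integrable lborel (\<lambda>x. (f x)\<^sup>2)"
    and E: "E \<in> sets borel" "bounded E"
  shows "\<exists>c>0. \<forall>e>0. \<exists>S. \<forall>s\<ge>S.
    \<bar>(LINT x|lborel. indicator E x * avg f s x) - c * (LINT y|lborel. f y * indicator E y)\<bar> \<le> e"
proof -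
  obtain c where c: "c > 0" "\<And>s. s > 0 \<Longrightarrow> (LINT w|lborel. kern s (0::'a) w) = c"
    using kern_mass by blast
  let ?T = "\<lambda>w. LINT y|lborel. f y * indicator E (y - w)"
  note [measurable] = f(1) E(1)
  show ?thesis
  proof (rule exI[of _ c], intro conjI c(1) allI impI)
    fix e :: real assume "e > 0"
    then have "e / c > 0"
      using c(1) by simp
    then obtain d where d: "d > 0"
      "\<And>w. norm w < d \<Longrightarrow> \<bar>LINT y|lborel. f y * (indicator E (y - w) - indicator E y)\<bar> \<le> e / c"
      using translate_continuity[OF f(1,3) E] by metis
    have T: "\<bar>?T w - ?T 0\<bar> \<le> e / c" if "norm w < d" for w
    proof -
      have int: "integrable lborel (\<lambda>y. f y * indicator E (y - v))" for v
        by (rule integrable_mult_bounded[OF f(2), where C = 1]) (auto simp: indicator_def)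
      have "?T w - ?T 0 = (LINT y|lborel. f y * (indicator E (y - w) - indicator E y))"
        using int[of w] int[of 0] by (simp add: right_diff_distrib)
      then show ?thesis
        using d(2)[OF that] by simp
    qed
    show "\<exists>S. \<forall>s\<ge>S. \<bar>(LINT x|lborel. indicator E x * avg f s x) - c * (LINT y|lborel. f y * indicator E y)\<bar> \<le> e"
    proof (intro exI[of _ "2 / d"] allI impI)
      fix s assume s: "s \<ge> 2 / d"
      have "s > 0"
        using s d(1) by (meson divide_pos_pos less_le_trans zero_less_numeral)
      have "2 \<le> s * d"
        using s d(1) by (simp add: field_simps)
      then have "1 / s < d"
        using \<open>s > 0\<close> by (simp add: field_simps)
      note loc = avg_localized[OF f(1,2) E \<open>s > 0\<close>]
      have "(LINT x|lborel. indicator E x * avg f s x) - c * ?T 0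
          = (LINT w|lborel. kern s 0 w * ?T w) - (LINT w|lborel. kern s (0::'a) w * ?T 0)"
        using c(2)[OF \<open>s > 0\<close>] loc(2) by simp
      also have "\<dots> = (LINT w|lborel. kern s 0 w * (?T w - ?T 0))"
        using loc(3) kern_integrable[OF \<open>s > 0\<close>, of 0]
        by (subst Bochner_Integration.integral_diff[symmetric]) (auto simp: right_diff_distrib)
      finally have eq: "(LINT x|lborel. indicator E x * avg f s x) - c * ?T 0
          = (LINT w|lborel. kern s 0 w * (?T w - ?T 0))" .
      have int: "integrable lborel (\<lambda>w. kern s 0 w * (?T w - ?T 0))"
        using loc(3) kern_integrable[OF \<open>s > 0\<close>, of 0] by (auto simp: right_diff_distrib)
      have "\<bar>LINT w|lborel. kern s 0 w * (?T w - ?T 0)\<bar> \<le> (LINT w|lborel. \<bar>kern s 0 w * (?T w - ?T 0)\<bar>)"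
        using integral_norm_bound[of lborel "\<lambda>w. kern s 0 w * (?T w - ?T 0)"] by simp
      also have "\<dots> \<le> (LINT w|lborel. kern s (0::'a) w * (e / c))"
      proof (rule integral_mono)
        fix w :: 'a
        show "\<bar>kern s 0 w * (?T w - ?T 0)\<bar> \<le> kern s 0 w * (e / c)"
        proof (cases "norm w < d")
          case True
          then show ?thesis
            using mult_left_mono[OF T[of w] kern_nonneg[OF \<open>s > 0\<close>, of 0 w]] kern_nonneg[OF \<open>s > 0\<close>, of 0 w]
            by (simp only: abs_mult abs_of_nonneg)
        next
          case False
          then have "kern s 0 w = 0"
            using \<open>1 / s < d\<close> \<open>s > 0\<close> by (simp add: kern_def bump_eq_0)
          then show ?thesis
            by simp
        qed
      qed (use int kern_integrable[OF \<open>s > 0\<close>] in \<open>auto simp del: times_divide_eq_right intro: integrable_mult_left\<close>)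
      also have "\<dots> = e"
        using c(1) c(2)[OF \<open>s > 0\<close>] by simp
      finally show "\<bar>(LINT x|lborel. indicator E x * avg f s x) - c * (LINT y|lborel. f y * indicator E y)\<bar> \<le> e"
        using eq by simp
    qed
  qed
qed

section \<open>The fundamental lemma and the strong maximum principle\<close>

lemma ball_around_in_open:
  fixes \<Omega> :: "'a::euclidean_space set"
  assumes "open \<Omega>" "x0 \<in> \<Omega>"
  obtains r where "r > 0" "\<And>x s. x \<in> ball x0 r \<Longrightarrow> s \<ge> 1 / r \<Longrightarrow> s > 0 \<and> cball x (1 / s) \<subseteq> \<Omega>"
proof -
  obtain e where e: "e > 0" "cball x0 e \<subseteq> \<Omega>"
    using assms open_contains_cball by blast
  show thesis
  proof
    show "e / 2 > 0"
      using e by simp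
    fix x s assume x: "x \<in> ball x0 (e / 2)" and s: "s \<ge> 1 / (e / 2)"
    have "s > 0"
      using s e(1) by (meson \<open>e / 2 > 0\<close> divide_pos_pos less_le_trans zero_less_one)
    moreover have "1 \<le> s * (e / 2)"
      using s e(1) by (simp add: field_simps)
    then have "1 / s \<le> e / 2"
      using \<open>s > 0\<close> by (simp add: field_simps)
    then have "cball x (1 / s) \<subseteq> cball x0 e"
      using x by (intro cball_subset_cball_iff[THEN iffD2]) (simp add: dist_commute)
    ultimately show "s > 0 \<and> cball x (1 / s) \<subseteq> \<Omega>"
      using e(2) by blast
  qed
qed

lemma test_function_kern:
  "s > 0 \<Longrightarrow> cball x (1 / s) \<subseteq> \<Omega> \<Longrightarrow> test_function \<Omega> (kern s x)"
  unfolding kern_def by (intro test_function_cmult test_function_bump)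

lemma fundamental_lemma_aux:
  fixes f :: "'a::euclidean_space \<Rightarrow> real"
  assumes f: "f \<in> borel_measurable borel" "integrable lborel f" "integrable lborel (\<lambda>x. (f x)\<^sup>2)"
    and "open \<Omega>" and zero: "\<And>\<phi>. test_function \<Omega> \<phi> \<Longrightarrow> (LINT y|lborel. f y * \<phi> y) = 0"
  shows "AE x in lborel. x \<in> \<Omega> \<longrightarrow> f x \<le> 0"
proof (rule AE_lborel_locally)
  fix x0 assume "x0 \<in> \<Omega>"
  then obtain r where r: "r > 0"
    "\<And>x s. x \<in> ball x0 r \<Longrightarrow> s \<ge> 1 / r \<Longrightarrow> s > 0 \<and> cball x (1 / s) \<subseteq> \<Omega>"
    using ball_around_in_open[OF \<open>open \<Omega>\<close>] by metis
  note [measurable] = f(1)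
  define E where "E = {x \<in> space borel. f x > 0} \<inter> ball x0 r"
  have E: "E \<in> sets borel" "bounded E"
    unfolding E_def by (measurable, auto intro: bounded_Int)
  obtain c where c: "c > 0" "\<And>e. e > 0 \<Longrightarrow> \<exists>S. \<forall>s\<ge>S.
      \<bar>(LINT x|lborel. indicator E x * avg f s x) - c * (LINT y|lborel. f y * indicator E y)\<bar> \<le> e"
    using avg_localized_limit[OF f E] by metis
  let ?I = "LINT y|lborel. f y * indicator E y"
  have "\<bar>c * ?I\<bar> \<le> e" if e: "e > 0" for e
  proof -
    obtain S where S: "\<And>s. s \<ge> S \<Longrightarrow> \<bar>(LINT x|lborel. indicator E x * avg f s x) - c * ?I\<bar> \<le> e"
      using c(2)[OF e] by blast
    define s where "s = max S (1 / r)"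
    have "avg f s x = 0" if "x \<in> E" for x
      using r(2)[of x s] that unfolding avg_def by (intro zero test_function_kern) (auto simp: s_def E_def)
    then have "(LINT x|lborel. indicator E x * avg f s x) = 0"
      by (intro integral_eq_zero_AE always_eventually) (auto simp: indicator_def)
    then show ?thesis
      using S[of s] by (simp add: s_def)
  qed
  then have "\<bar>c * ?I\<bar> \<le> 0"
    by (rule field_le_epsilon[of _ 0, simplified])
  then have "?I = 0"
    using c(1) by simp
  moreover have "integrable lborel (\<lambda>y. f y * indicator E y)"
    using E by (intro integrable_mult_bounded[OF f(2), where C = 1]) (auto simp: indicator_def)
  moreover have "AE y in lborel. 0 \<le> f y * indicator E y"
    by (intro always_eventually) (auto simp: E_def indicator_def)
  ultimately have "AE y in lborel. f y * indicator E y = 0"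
    by (simp add: integral_nonneg_eq_0_iff_AE)
  then have "AE y in lborel. y \<in> ball x0 r \<longrightarrow> f y \<le> 0"
    by (rule eventually_mono) (auto simp: E_def indicator_def split: if_splits)
  then show "\<exists>r>0. AE y in lborel. y \<in> ball x0 r \<longrightarrow> f y \<le> 0"
    using r(1) by blast
qed

lemma fundamental_lemma:
  fixes f :: "'a::euclidean_space \<Rightarrow> real"
  assumes f: "f \<in> borel_measurable borel" "integrable lborel f" "integrable lborel (\<lambda>x. (f x)\<^sup>2)"
    and "open \<Omega>" and zero: "\<And>\<phi>. test_function \<Omega> \<phi> \<Longrightarrow> (LINT y|lborel. f y * \<phi> y) = 0"
  shows "AE x in lborel. x \<in> \<Omega> \<longrightarrow> f x = 0"
proof -
  have "AE x in lborel. x \<in> \<Omega> \<longrightarrow> f x \<le> 0"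
    by (rule fundamental_lemma_aux[OF assms])
  moreover have "AE x in lborel. x \<in> \<Omega> \<longrightarrow> - f x \<le> 0"
    using f zero \<open>open \<Omega>\<close> by (intro fundamental_lemma_aux) auto
  ultimately show ?thesis
    by eventually_elim auto
qed

definition lap :: "('a::euclidean_space \<Rightarrow> real) \<Rightarrow> 'a \<Rightarrow> real" where
  "lap \<phi> x = (\<Sum>b\<in>Basis. pd (pd \<phi> b) b x)"

definition superharmonic :: "'a::euclidean_space set \<Rightarrow> ('a \<Rightarrow> real) \<Rightarrow> bool" where
  "superharmonic \<Omega> f \<longleftrightarrow> (\<forall>\<phi>. test_function \<Omega> \<phi> \<longrightarrow> (\<forall>x. 0 \<le> \<phi> x) \<longrightarrow>
     (LINT x|lborel. f x * lap \<phi> x) \<le> 0)"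

lemma lap_bump:
  fixes x y :: "'a::euclidean_space"
  shows "lap (bump bp0 s x) y = 4 * s ^ 4 * ((y - x) \<bullet> (y - x)) * bump bp4 s x y
    - 2 * real DIM('a) * s\<^sup>2 * bump bp2 s x y"
proof -
  have "pd (pd (bump bp0 s x) b) b y = 4 * s ^ 4 * ((y - x) \<bullet> b)\<^sup>2 * bump bp4 s x y - 2 * s\<^sup>2 * bump bp2 s x y"
    if "b \<in> Basis" for b
  proof -
    have eq: "pd (bump bp0 s x) b = (\<lambda>y. bump bp2 s x y * (- 2 * s\<^sup>2 * ((y - x) \<bullet> b)))"
      unfolding pd_bump bp2_def ..
    have "((\<lambda>y. bump bp2 s x y * (- 2 * s\<^sup>2 * ((y - x) \<bullet> b))) has_derivative
        (\<lambda>h. bump bp2 s x y * (- 2 * s\<^sup>2 * (h \<bullet> b))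
          + (bump bp4 s x y * (- 2 * s\<^sup>2 * ((y - x) \<bullet> h))) * (- 2 * s\<^sup>2 * ((y - x) \<bullet> b)))) (at y)"
      unfolding bp4_def
      by (rule has_derivative_mult[OF bump_has_derivative]) (auto intro!: derivative_eq_intros)
    from frechet_derivative_eqI[OF this] show ?thesis
      unfolding eq using that by (simp add: power2_eq_square power4_eq_xxxx)
  qed
  then have "lap (bump bp0 s x) y
      = (\<Sum>b\<in>Basis. 4 * s ^ 4 * bump bp4 s x y * ((y - x) \<bullet> b)\<^sup>2 - 2 * s\<^sup>2 * bump bp2 s x y)"
    unfolding lap_def by (intro sum.cong) auto
  also have "\<dots> = 4 * s ^ 4 * bump bp4 s x y * (\<Sum>b\<in>Basis. ((y - x) \<bullet> b)\<^sup>2) - real DIM('a) * (2 * s\<^sup>2 * bump bp2 s x y)"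
    by (simp add: sum_subtractf sum_distrib_left)
  also have "(\<Sum>b\<in>Basis. ((y - x) \<bullet> b)\<^sup>2) = (y - x) \<bullet> (y - x)"
    by (subst euclidean_inner) (simp add: power2_eq_square)
  finally show ?thesis
    by (simp add: mult_ac)
qed

text \<open>The derivative of the averaging kernel in the scaling parameter is a negative multiple of the
  Laplacian of a bump function, so averages of superharmonic functions increase with \<open>s\<close>.\<close>

lemma kern_DERIV:
  fixes x y :: "'a::euclidean_space"
  assumes "s > 0"
  shows "((\<lambda>s. kern s x y) has_real_derivative - (s ^ DIM('a) / (2 * s ^ 3)) * lap (bump bp0 s x) y) (at s)"
proof -
  let ?q = "(y - x) \<bullet> (y - x)"
  obtain n where n: "DIM('a) = Suc n"
    using DIM_positive[where 'a = 'a] gr0_conv_Suc by blast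
  have "((\<lambda>s. bump bp2 s x y) has_real_derivative bump bp4 s x y * (- (2 * s * ?q))) (at s)"
    unfolding bump_def bp4_def
    by (rule DERIV_chain2[OF bexp_deriv]) (auto intro!: derivative_eq_intros)
  from DERIV_mult[OF DERIV_pow[of "Suc n" s] this] have "((\<lambda>s. kern s x y) has_real_derivative
      s ^ Suc n * (bump bp4 s x y * (- (2 * s * ?q))) + real (Suc n) * s ^ n * bump bp2 s x y) (at s)"
    unfolding kern_def n by (simp add: mult_ac add.commute)
  moreover have "s ^ Suc n * (bump bp4 s x y * (- (2 * s * ?q))) + real (Suc n) * s ^ n * bump bp2 s x y
      = - (s ^ DIM('a) / (2 * s ^ 3)) * lap (bump bp0 s x) y"
    unfolding lap_bump n using assms
    by (simp add: field_simps power2_eq_square power3_eq_cube power4_eq_xxxx)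
  ultimately show ?thesis
    by simp
qed

lemma lap_bump_bounded:
  "\<exists>C>0. \<forall>s>0. \<forall>(x :: 'a::euclidean_space) y. \<bar>lap (bump bp0 s x) y\<bar> \<le> C * s\<^sup>2"
proof -
  obtain C D where C: "C > 0" "\<And>s (x::'a) y. \<bar>bump bp2 s x y\<bar> \<le> C"
    and D: "D > 0" "\<And>s (x::'a) y. \<bar>bump bp4 s x y\<bar> \<le> D"
    using bump_bounded by metis
  have "\<bar>lap (bump bp0 s x) y\<bar> \<le> (4 * D + 2 * real DIM('a) * C) * s\<^sup>2" if "s > 0" for s and x y :: 'a
  proof -
    let ?q = "(y - x) \<bullet> (y - x)"
    have "s\<^sup>2 * ?q * \<bar>bump bp4 s x y\<bar> \<le> 1 * D"
    proof (cases "dist x y < 1 / s")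
      case True
      then have "(s * norm (y - x))\<^sup>2 \<le> 1\<^sup>2"
        using that by (intro power_mono) (simp_all add: dist_norm norm_minus_commute field_simps)
      then have "s\<^sup>2 * ?q \<le> 1"
        by (simp add: power_mult_distrib power2_norm_eq_inner)
      then show ?thesis
        using D by (intro mult_mono) auto
    next
      case False
      then have "bump bp4 s x y = 0"
        using that by (intro bump_eq_0) auto
      then show ?thesis
        using D(1) by simp
    qed
    then have "4 * s\<^sup>2 * (s\<^sup>2 * ?q * \<bar>bump bp4 s x y\<bar>) \<le> 4 * s\<^sup>2 * D"
      by (intro mult_left_mono) auto
    moreover have "2 * real DIM('a) * s\<^sup>2 * \<bar>bump bp2 s x y\<bar> \<le> 2 * real DIM('a) * s\<^sup>2 * C"
      by (intro mult_left_mono C) auto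
    moreover have "\<bar>lap (bump bp0 s x) y\<bar>
        \<le> \<bar>4 * s ^ 4 * ?q * bump bp4 s x y\<bar> + \<bar>2 * real DIM('a) * s\<^sup>2 * bump bp2 s x y\<bar>"
      unfolding lap_bump by (rule abs_triangle_ineq4)
    moreover have "\<bar>4 * s ^ 4 * ?q * bump bp4 s x y\<bar> = 4 * s\<^sup>2 * (s\<^sup>2 * ?q * \<bar>bump bp4 s x y\<bar>)"
      by (simp add: abs_mult power2_eq_square power4_eq_xxxx)
    moreover have "\<bar>2 * real DIM('a) * s\<^sup>2 * bump bp2 s x y\<bar> = 2 * real DIM('a) * s\<^sup>2 * \<bar>bump bp2 s x y\<bar>"
      by (simp add: abs_mult)
    moreover have "4 * s\<^sup>2 * D + 2 * real DIM('a) * s\<^sup>2 * C = (4 * D + 2 * real DIM('a) * C) * s\<^sup>2"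
      by (simp add: algebra_simps)
    ultimately show ?thesis
      by linarith
  qed
  moreover have "4 * D + 2 * real DIM('a) * C > 0"
    using C(1) D(1) by (simp add: add_pos_nonneg)
  ultimately show ?thesis
    by blast
qed

lemma lap_measurable:
  assumes "smooth \<phi>"
  shows "lap \<phi> \<in> borel_measurable borel" "continuous_on UNIV (lap \<phi>)"
proof -
  show "continuous_on UNIV (lap \<phi>)"
    unfolding lap_def[abs_def] using assms
    by (intro continuous_on_sum smooth_continuous smooth_pd) auto
  then show "lap \<phi> \<in> borel_measurable borel"
    by (rule borel_measurable_continuous_onI)
qed

lemma avg_mono:
  fixes f :: "'a::euclidean_space \<Rightarrow> real"
  assumes f: "integrable lborel f" and sup: "superharmonic \<Omega> f"
    and \<Omega>: "\<And>s. s \<ge> S \<Longrightarrow> s > 0 \<and> cball x (1 / s) \<subseteq> \<Omega>" and "S \<le> s" "s \<le> t"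
  shows "avg f s x \<le> avg f t x"
proof (rule DERIV_nonneg_imp_nondecreasing[OF \<open>s \<le> t\<close>])
  fix r assume r: "s \<le> r" "r \<le> t"
  then have "r > 0" "cball x (1 / r) \<subseteq> \<Omega>"
    using \<Omega> \<open>S \<le> s\<close> by auto
  obtain C where C: "C > 0" "\<And>s y. s > 0 \<Longrightarrow> \<bar>lap (bump bp0 s x) y\<bar> \<le> C * s\<^sup>2"
    using lap_bump_bounded by metis
  obtain D where D: "D > 0" "\<And>s y. \<bar>bump bp2 s x y\<bar> \<le> D"
    using bump_bounded by metis
  let ?N = "DIM('a)"
  have r2: "0 < u \<and> \<bar>u\<bar> \<le> 2 * r \<and> r / 2 \<le> u" if "\<bar>u - r\<bar> < r / 2" for u
    using that \<open>r > 0\<close> unfolding abs_if by (auto split: if_splits)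
  have "((\<lambda>t. LINT y|lborel. f y * kern t x y) has_real_derivative
      (LINT y|lborel. f y * (- (r ^ ?N / (2 * r ^ 3)) * lap (bump bp0 r x) y))) (at r)"
  proof (rule DERIV_integral[where r = "r / 2" and C = "(2 * r) ^ ?N * D"
        and L = "(2 * r) ^ ?N / (2 * (r / 2) ^ 3) * (C * (2 * r)\<^sup>2)"
        and K' = "\<lambda>r y. - (r ^ ?N / (2 * r ^ 3)) * lap (bump bp0 r x) y"])
    show "integrable lborel f" by fact
    show "r / 2 > 0" using \<open>r > 0\<close> by simp
    show "kern u x \<in> borel_measurable lborel" for u
      by simp
    fix u y assume u: "\<bar>u - r\<bar> < r / 2"
    note u2 = r2[OF u]
    show "((\<lambda>t. kern t x y) has_real_derivative - (u ^ ?N / (2 * u ^ 3)) * lap (bump bp0 u x) y) (at u)"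
      using u2 by (intro kern_DERIV) auto
    show "\<bar>kern u x y\<bar> \<le> (2 * r) ^ ?N * D"
      unfolding kern_def abs_mult power_abs using u2 \<open>r > 0\<close> by (intro mult_mono power_mono D) auto
    have "u ^ ?N / (2 * u ^ 3) \<le> (2 * r) ^ ?N / (2 * (r / 2) ^ 3)"
      using u2 \<open>r > 0\<close> by (intro frac_le mult_left_mono power_mono) auto
    moreover have "C * u\<^sup>2 \<le> C * (2 * r)\<^sup>2"
      using u2 \<open>r > 0\<close> C(1) by (intro mult_left_mono power_mono) auto
    then have "\<bar>lap (bump bp0 u x) y\<bar> \<le> C * (2 * r)\<^sup>2"
      using C(2)[of u y] u2 by linarith
    moreover have "\<bar>- (u ^ ?N / (2 * u ^ 3)) * lap (bump bp0 u x) y\<bar>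
        = u ^ ?N / (2 * u ^ 3) * \<bar>lap (bump bp0 u x) y\<bar>"
      using u2 by (simp add: abs_mult)
    ultimately show "\<bar>- (u ^ ?N / (2 * u ^ 3)) * lap (bump bp0 u x) y\<bar>
        \<le> (2 * r) ^ ?N / (2 * (r / 2) ^ 3) * (C * (2 * r)\<^sup>2)"
      using \<open>r > 0\<close> by (simp only:) (intro mult_mono, auto)
  next
    show "(\<lambda>y. - (r ^ ?N / (2 * r ^ 3)) * lap (bump bp0 r x) y) \<in> borel_measurable lborel"
      using lap_measurable(1)[OF smooth_bump, of bp0 r x] by (intro borel_measurable_times) auto
  qed
  also have "(LINT y|lborel. f y * (- (r ^ ?N / (2 * r ^ 3)) * lap (bump bp0 r x) y))
      = - (r ^ ?N / (2 * r ^ 3)) * (LINT y|lborel. f y * lap (bump bp0 r x) y)"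
    by (subst integral_mult_right_zero[symmetric]) (simp add: mult_ac)
  finally have "((\<lambda>t. avg f t x) has_real_derivative
      - (r ^ ?N / (2 * r ^ 3)) * (LINT y|lborel. f y * lap (bump bp0 r x) y)) (at r)"
    unfolding avg_def .
  moreover have "(LINT y|lborel. f y * lap (bump bp0 r x) y) \<le> 0"
    using sup test_function_bump[OF \<open>r > 0\<close> \<open>cball x (1 / r) \<subseteq> \<Omega>\<close>] bump_bp0_nonneg
    unfolding superharmonic_def by blast
  then have "- (r ^ ?N / (2 * r ^ 3)) * (LINT y|lborel. f y * lap (bump bp0 r x) y) \<ge> 0"
    using \<open>r > 0\<close> by (intro mult_nonpos_nonpos) auto
  ultimately show "\<exists>y. ((\<lambda>t. avg f t x) has_real_derivative y) (at r) \<and> 0 \<le> y"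
    by blast
qed

lemma superharmonic_local_dichotomy:
  fixes f :: "'a::euclidean_space \<Rightarrow> real"
  assumes f: "f \<in> borel_measurable borel" "integrable lborel f" "integrable lborel (\<lambda>x. (f x)\<^sup>2)"
    and "open \<Omega>" and sup: "superharmonic \<Omega> f" and nonneg: "AE x in lborel. 0 \<le> f x" and "x0 \<in> \<Omega>"
  obtains r where "r > 0" "(AE y in lborel. y \<in> ball x0 r \<longrightarrow> f y = 0) \<or> (AE y in lborel. y \<in> ball x0 r \<longrightarrow> f y > 0)"
proof -
  obtain r where r: "r > 0"
    "\<And>x s. x \<in> ball x0 r \<Longrightarrow> s \<ge> 1 / r \<Longrightarrow> s > 0 \<and> cball x (1 / s) \<subseteq> \<Omega>"
    using ball_around_in_open[OF \<open>open \<Omega>\<close> \<open>x0 \<in> \<Omega>\<close>] by metis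
  define B where "B = ball x0 (r / 2)"
  have B: "x \<in> ball x0 r" "B \<subseteq> ball x (1 / (1 / r))" if "x \<in> B" for x
  proof -
    show "x \<in> ball x0 r"
      using that r(1) by (auto simp: B_def)
    show "B \<subseteq> ball x (1 / (1 / r))"
    proof
      fix y assume "y \<in> B"
      then have "dist x0 y < r / 2" "dist x0 x < r / 2"
        using that by (auto simp: B_def)
      then show "y \<in> ball x (1 / (1 / r))"
        using dist_triangle[of x y x0] by (simp add: dist_commute)
    qed
  qed
  have "AE y in lborel. y \<in> B \<longrightarrow> f y > 0" if not0: "\<not> (AE y in lborel. y \<in> B \<longrightarrow> f y = 0)"
  proof -
    note [measurable] = f(1)
    define E where "E = {x \<in> space borel. f x \<le> 0} \<inter> B"
    have E: "E \<in> sets borel" "bounded E"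
      unfolding E_def B_def by (measurable, auto intro: bounded_Int)
    obtain c where c: "c > 0" "\<And>e. e > 0 \<Longrightarrow> \<exists>S. \<forall>s\<ge>S.
        \<bar>(LINT x|lborel. indicator E x * avg f s x) - c * (LINT y|lborel. f y * indicator E y)\<bar> \<le> e"
      using avg_localized_limit[OF f E] by metis
    have pos: "avg f (1 / r) x > 0" if "x \<in> B" for x
    proof (rule ccontr)
      assume "\<not> avg f (1 / r) x > 0"
      moreover have nn: "AE y in lborel. 0 \<le> f y * kern (1 / r) x y"
        using nonneg r(1) by (auto elim!: eventually_mono intro!: mult_nonneg_nonneg kern_nonneg)
      then have "avg f (1 / r) x \<ge> 0"
        unfolding avg_def by (rule integral_nonneg_AE)
      ultimately have "avg f (1 / r) x = 0"
        by linarith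
      then have "AE y in lborel. f y * kern (1 / r) x y = 0"
        using integral_nonneg_eq_0_iff_AE[OF integrable_mult_kern[OF f(2)] nn] unfolding avg_def by simp
      moreover have "kern (1 / r) x y > 0" if "y \<in> B" for y
        using B(2)[OF \<open>x \<in> B\<close>] that r(1) unfolding kern_def
        by (intro mult_pos_pos bump_bp2_pos) auto
      ultimately have "AE y in lborel. y \<in> B \<longrightarrow> f y = 0"
        by (auto elim!: eventually_mono) force
      then show False
        using not0 by blast
    qed
    note int = avg_localized(1)[OF f(1,2) E]
    let ?m = "LINT x|lborel. indicator E x * avg f (1 / r) x"
    have m_nonneg: "AE x in lborel. 0 \<le> indicator E x * avg f (1 / r) x"
      using pos by (intro always_eventually) (auto simp: E_def indicator_def less_imp_le)
    have "AE y in lborel. 0 \<le> - (f y * indicator E y)"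
      by (intro always_eventually) (auto simp: E_def indicator_def)
    from integral_nonneg_AE[OF this] have "(LINT y|lborel. f y * indicator E y) \<le> 0"
      by simp
    then have cI: "c * (LINT y|lborel. f y * indicator E y) \<le> 0"
      using c(1) by (simp add: mult_le_0_iff)
    have "?m \<le> e" if e: "e > 0" for e
    proof -
      obtain S where S: "\<And>s. s \<ge> S \<Longrightarrow>
          \<bar>(LINT x|lborel. indicator E x * avg f s x) - c * (LINT y|lborel. f y * indicator E y)\<bar> \<le> e"
        using c(2)[OF e] by blast
      define s where "s = max S (1 / r)"
      have "s > 0" "1 / r > 0"
        using r(1) by (auto simp: s_def less_max_iff_disj)
      have "?m \<le> (LINT x|lborel. indicator E x * avg f s x)"
      proof (rule integral_mono[OF int[OF \<open>1 / r > 0\<close>] int[OF \<open>s > 0\<close>]])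
        fix x
        show "indicator E x * avg f (1 / r) x \<le> indicator E x * avg f s x"
        proof (cases "x \<in> E")
          case True
          then have "x \<in> ball x0 r"
            using B by (auto simp: E_def)
          then have "avg f (1 / r) x \<le> avg f s x"
            using r(2) by (intro avg_mono[OF f(2) sup, where S = "1 / r"]) (auto simp: s_def)
          then show ?thesis
            using True by simp
        qed simp
      qed
      also have "\<dots> \<le> e"
        using S[of s] cI by (simp add: s_def abs_le_iff)
      finally show ?thesis .
    qed
    then have "?m \<le> 0"
      by (rule field_le_epsilon[of _ 0, simplified])
    moreover have "?m \<ge> 0"
      by (rule integral_nonneg_AE[OF m_nonneg])
    ultimately have "AE x in lborel. indicator E x * avg f (1 / r) x = 0"
      using integral_nonneg_eq_0_iff_AE[OF int m_nonneg] r(1) by simp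
    then show ?thesis
    proof (rule eventually_mono, intro impI)
      fix x assume "indicator E x * avg f (1 / r) x = 0" "x \<in> B"
      then show "f x > 0"
        using pos[of x] by (auto simp: E_def indicator_def split: if_splits)
    qed
  qed
  then show thesis
    using that[of "r / 2"] r(1) unfolding B_def by auto
qed

lemma open_locally:
  fixes \<Omega> :: "'a::euclidean_space set"
  assumes "open \<Omega>"
  shows "open {x \<in> \<Omega>. \<exists>r>0. AE y in lborel. y \<in> ball x r \<longrightarrow> P y}" (is "open ?S")
  unfolding open_contains_ball
proof
  fix x assume "x \<in> ?S"
  then obtain r where r: "r > 0" "AE y in lborel. y \<in> ball x r \<longrightarrow> P y" and "x \<in> \<Omega>"
    by blast
  then obtain d where d: "d > 0" "ball x d \<subseteq> \<Omega>"
    using assms open_contains_ball by blast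
  show "\<exists>e>0. ball x e \<subseteq> ?S"
  proof (intro exI[of _ "min d (r / 2)"] conjI subsetI)
    fix z assume z: "z \<in> ball x (min d (r / 2))"
    then have "ball z (r / 2) \<subseteq> ball x r"
      using dist_triangle[of x _ z] by (auto simp: subset_iff) (smt (verit) dist_triangle field_sum_of_halves)
    then have "AE y in lborel. y \<in> ball z (r / 2) \<longrightarrow> P y"
      using r(2) by (auto elim!: eventually_mono)
    then show "z \<in> ?S"
      using z d r(1) by (auto intro: exI[of _ "r / 2"])
  qed (use r d in auto)
qed

theorem strong_maximum_principle:
  fixes f :: "'a::euclidean_space \<Rightarrow> real"
  assumes f: "f \<in> borel_measurable borel" "integrable lborel f" "integrable lborel (\<lambda>x. (f x)\<^sup>2)"
    and "open \<Omega>" "connected \<Omega>"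
    and sup: "superharmonic \<Omega> f" and nonneg: "AE x in lborel. 0 \<le> f x"
  shows "(AE x in lborel. x \<in> \<Omega> \<longrightarrow> f x = 0) \<or> (AE x in lborel. x \<in> \<Omega> \<longrightarrow> f x > 0)"
proof -
  let ?Z = "{x \<in> \<Omega>. \<exists>r>0. AE y in lborel. y \<in> ball x r \<longrightarrow> f y = 0}"
  let ?P = "{x \<in> \<Omega>. \<exists>r>0. AE y in lborel. y \<in> ball x r \<longrightarrow> f y > 0}"
  have cover: "\<Omega> \<subseteq> ?Z \<union> ?P"
  proof
    fix x assume "x \<in> \<Omega>"
    then obtain r where "r > 0" "(AE y in lborel. y \<in> ball x r \<longrightarrow> f y = 0) \<or> (AE y in lborel. y \<in> ball x r \<longrightarrow> f y > 0)"
      by (rule superharmonic_local_dichotomy[OF f \<open>open \<Omega>\<close> sup nonneg])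
    then show "x \<in> ?Z \<union> ?P"
      using \<open>x \<in> \<Omega>\<close> by blast
  qed
  have "?Z \<inter> ?P = {}"
  proof (rule ccontr)
    assume "?Z \<inter> ?P \<noteq> {}"
    then obtain x r s where x: "r > 0" "AE y in lborel. y \<in> ball x r \<longrightarrow> f y = 0"
      "s > 0" "AE y in lborel. y \<in> ball x s \<longrightarrow> f y > 0"
      by auto
    have "AE y in lborel. y \<notin> ball x (min r s)"
      using x(2,4) by eventually_elim auto
    then show False
      using AE_lborel_open_empty[of "ball x (min r s)"] x(1,3) by simp
  qed
  moreover have "open ?Z" "open ?P"
    by (rule open_locally[OF \<open>open \<Omega>\<close>])+
  ultimately have "?Z \<inter> \<Omega> = {} \<or> ?P \<inter> \<Omega> = {}"
    using connectedD[OF \<open>connected \<Omega>\<close>, of ?Z ?P] cover by blast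
  then have "\<Omega> \<subseteq> ?P \<or> \<Omega> \<subseteq> ?Z"
    using cover by blast
  then show ?thesis
  proof
    assume "\<Omega> \<subseteq> ?P"
    then have "AE x in lborel. x \<in> \<Omega> \<longrightarrow> f x > 0"
      by (intro AE_lborel_locally) blast
    then show ?thesis ..
  next
    assume "\<Omega> \<subseteq> ?Z"
    then have "AE x in lborel. x \<in> \<Omega> \<longrightarrow> f x = 0"
      by (intro AE_lborel_locally) blast
    then show ?thesis ..
  qed
qed

section \<open>Square integrable functions and weak gradients\<close>

locale bounded_open =
  fixes \<Omega> :: "'a::euclidean_space set"
  assumes open_dom: "open \<Omega>" and bounded_dom: "bounded \<Omega>"
begin

abbreviation "M \<equiv> lebesgue_on \<Omega>"

lemma dom_sets: "\<Omega> \<in> sets lebesgue" "\<Omega> \<in> sets borel" "\<Omega> \<inter> space lebesgue \<in> sets lebesgue"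
  using open_dom by auto

lemma finite_measure_dom: "finite_measure M"
  using bounded_dom dom_sets(1) by (intro finite_measure_lebesgue_on) (simp add: bounded_set_imp_lmeasurable)

lemma AE_lborel_imp_dom: "(AE x in lborel. x \<in> \<Omega> \<longrightarrow> P x) \<Longrightarrow> AE x in M. P x"
  using AE_completion[of "\<lambda>x. x \<in> \<Omega> \<longrightarrow> P x" lborel] dom_sets by (simp add: AE_restrict_space_iff)

lemma borel_imp_dom: "f \<in> borel_measurable borel \<Longrightarrow> f \<in> borel_measurable M"
  by (simp add: measurable_restrict_space1 measurable_completion)

lemma integral_dom_eq_lborel:
  fixes F :: "'a \<Rightarrow> real"
  assumes "F \<in> borel_measurable borel" "\<And>x. x \<notin> \<Omega> \<Longrightarrow> F x = 0"
  shows "(LINT x|M. F x) = (LINT x|lborel. F x)"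
proof -
  have "(LINT x|M. F x) = (LINT x|lebesgue. indicator \<Omega> x *\<^sub>R F x)"
    using dom_sets by (subst integral_restrict_space) auto
  also have "\<dots> = (LINT x|lebesgue. F x)"
    by (rule Bochner_Integration.integral_cong) (auto simp: indicator_def assms(2))
  also have "\<dots> = (LINT x|lborel. F x)"
    using assms(1) by (intro integral_completion) simp
  finally show ?thesis .
qed

lemma L2I: "f \<in> borel_measurable M \<Longrightarrow> integrable M (\<lambda>x. (norm (f x))\<^sup>2) \<Longrightarrow> f \<in> L2 \<Omega>"
  by (simp add: L2_def)

lemma L2D: "f \<in> L2 \<Omega> \<Longrightarrow> f \<in> borel_measurable M" "f \<in> L2 \<Omega> \<Longrightarrow> integrable M (\<lambda>x. (norm (f x))\<^sup>2)"
  by (simp_all add: L2_def)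

lemma L2_bounded:
  fixes f :: "'a \<Rightarrow> 'b::euclidean_space"
  assumes "g \<in> L2 \<Omega>" "f \<in> borel_measurable M" "\<And>x. norm (f x) \<le> C * norm (g x)"
  shows "f \<in> L2 \<Omega>"
proof (rule L2I[OF assms(2)])
  have int: "integrable M (\<lambda>x. C\<^sup>2 * (norm (g x))\<^sup>2)"
    using L2D(2)[OF assms(1)] by simp
  have "(norm (f x))\<^sup>2 \<le> C\<^sup>2 * (norm (g x))\<^sup>2" for x
    using power_mono[OF assms(3)[of x] norm_ge_zero, of 2] by (simp add: power_mult_distrib)
  then have ae: "AE x in M. norm ((norm (f x))\<^sup>2) \<le> norm (C\<^sup>2 * (norm (g x))\<^sup>2)"
    by (intro always_eventually) simp
  show "integrable M (\<lambda>x. (norm (f x))\<^sup>2)"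
    by (rule Bochner_Integration.integrable_bound[OF int _ ae]) (use assms(2) in simp)
qed

lemma L2_add:
  fixes f g :: "'a \<Rightarrow> 'b::euclidean_space"
  assumes "f \<in> L2 \<Omega>" "g \<in> L2 \<Omega>"
  shows "(\<lambda>x. f x + g x) \<in> L2 \<Omega>"
proof (rule L2I)
  show meas: "(\<lambda>x. f x + g x) \<in> borel_measurable M"
    using L2D(1)[OF assms(1)] L2D(1)[OF assms(2)] by simp
  have int: "integrable M (\<lambda>x. 2 * (norm (f x))\<^sup>2 + 2 * (norm (g x))\<^sup>2)"
    using L2D(2)[OF assms(1)] L2D(2)[OF assms(2)] by simp
  have "(norm (f x + g x))\<^sup>2 \<le> 2 * (norm (f x))\<^sup>2 + 2 * (norm (g x))\<^sup>2" for x
  proof -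
    have "(norm (f x + g x))\<^sup>2 \<le> (norm (f x) + norm (g x))\<^sup>2"
      by (intro power_mono norm_triangle_ineq) auto
    also have "\<dots> \<le> 2 * (norm (f x))\<^sup>2 + 2 * (norm (g x))\<^sup>2"
      using sum_squares_bound[of "norm (f x)" "norm (g x)"] by (simp add: power2_sum)
    finally show ?thesis .
  qed
  then have ae: "AE x in M. norm ((norm (f x + g x))\<^sup>2) \<le> norm (2 * (norm (f x))\<^sup>2 + 2 * (norm (g x))\<^sup>2)"
    by (intro always_eventually) simp
  show "integrable M (\<lambda>x. (norm (f x + g x))\<^sup>2)"
    by (rule Bochner_Integration.integrable_bound[OF int _ ae]) (use meas in simp)
qed

lemma L2_mult:
  fixes f :: "'a \<Rightarrow> 'b::euclidean_space" and c :: "'a \<Rightarrow> real"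
  assumes "f \<in> L2 \<Omega>" "c \<in> borel_measurable M" "\<And>x. \<bar>c x\<bar> \<le> C"
  shows "(\<lambda>x. c x *\<^sub>R f x) \<in> L2 \<Omega>"
  using assms L2D(1)[OF assms(1)]
  by (intro L2_bounded[OF assms(1), where C = C]) (auto simp: mult_right_mono)

lemma L2_scaleR: "f \<in> L2 \<Omega> \<Longrightarrow> (\<lambda>x. c *\<^sub>R f x) \<in> L2 \<Omega>"
  for f :: "'a \<Rightarrow> 'b::euclidean_space"
  by (rule L2_mult[where C = "\<bar>c\<bar>"]) auto

lemma L2_cmult: "f \<in> L2 \<Omega> \<Longrightarrow> (\<lambda>x. c * f x) \<in> L2 \<Omega>"
  for f :: "'a \<Rightarrow> real"
  using L2_scaleR[of f c] by simp

lemma L2_diff: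
  fixes f g :: "'a \<Rightarrow> 'b::euclidean_space"
  assumes "f \<in> L2 \<Omega>" "g \<in> L2 \<Omega>"
  shows "(\<lambda>x. f x - g x) \<in> L2 \<Omega>"
  using L2_add[OF assms(1) L2_scaleR[OF assms(2), of "-1"]] by simp

lemma L2_inner:
  fixes f :: "'a \<Rightarrow> 'b::euclidean_space"
  assumes "f \<in> L2 \<Omega>"
  shows "(\<lambda>x. f x \<bullet> b) \<in> L2 \<Omega>"
proof (rule L2_bounded[OF assms, where C = "norm b"])
  show "(\<lambda>x. f x \<bullet> b) \<in> borel_measurable M"
    using L2D(1)[OF assms] by simp
  show "norm (f x \<bullet> b) \<le> norm b * norm (f x)" for x
    using Cauchy_Schwarz_ineq2[of "f x" b] by (simp add: mult.commute)
qed

lemma L2_zero: "(\<lambda>x. 0 :: 'b::euclidean_space) \<in> L2 \<Omega>"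
  by (simp add: L2_def)

lemma L2_borel_bounded:
  fixes f :: "'a \<Rightarrow> real"
  assumes "f \<in> borel_measurable borel" "\<And>x. \<bar>f x\<bar> \<le> C"
  shows "f \<in> L2 \<Omega>"
proof -
  have "(\<lambda>x. 1) \<in> L2 \<Omega>"
    using finite_measure.integrable_const[OF finite_measure_dom] by (auto simp: L2_def)
  then show ?thesis
    using assms borel_imp_dom by (intro L2_bounded[of "\<lambda>x. 1::real" f C]) auto
qed

lemma L2_borel_rep:
  fixes u :: "'a \<Rightarrow> real"
  assumes "u \<in> L2 \<Omega>"
  obtains f where "f \<in> borel_measurable borel" "integrable lborel f" "integrable lborel (\<lambda>x. (f x)\<^sup>2)"
    "AE x in M. f x = u x" "\<And>x. x \<notin> \<Omega> \<Longrightarrow> f x = 0"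
proof -
  have "u \<in> borel_measurable M"
    using assms by (rule L2D)
  then have "(\<lambda>x. indicator \<Omega> x *\<^sub>R u x) \<in> borel_measurable lebesgue"
    using borel_measurable_restrict_space_iff[OF dom_sets(3), of u] by simp
  then obtain f0 where f0: "f0 \<in> borel_measurable lborel" "AE x in lborel. indicator \<Omega> x *\<^sub>R u x = f0 x"
    using completion_ex_borel_measurable_real by metis
  define f where "f = (\<lambda>x. indicator \<Omega> x * f0 x)"
  have fb: "f \<in> borel_measurable borel"
    unfolding f_def using f0(1) dom_sets(2) by (intro borel_measurable_times borel_measurable_indicator) auto
  have ae: "AE x in M. f x = u x"
    using f0(2) by (intro AE_lborel_imp_dom) (auto simp: f_def elim!: eventually_mono)
  have "integrable M (\<lambda>x. (f x)\<^sup>2)"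
  proof (subst integrable_cong_AE)
    show "AE x in M. (f x)\<^sup>2 = (u x)\<^sup>2"
      using ae by (auto elim!: eventually_mono)
    show "integrable M (\<lambda>x. (u x)\<^sup>2)"
      using L2D(2)[OF assms] by simp
  qed (use borel_imp_dom[OF fb] L2D(1)[OF assms] in auto)
  then have "integrable lebesgue (\<lambda>x. indicator \<Omega> x *\<^sub>R (f x)\<^sup>2)"
    using integrable_restrict_space[OF dom_sets(3), of "\<lambda>x. (f x)\<^sup>2"] by simp
  also have "(\<lambda>x. indicator \<Omega> x *\<^sub>R (f x)\<^sup>2) = (\<lambda>x. (f x)\<^sup>2)"
    by (auto simp: f_def indicator_def)
  finally have sq: "integrable lborel (\<lambda>x. (f x)\<^sup>2)"
    using fb by (subst (asm) integrable_completion) auto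
  have ind: "integrable lborel (indicator \<Omega> :: 'a \<Rightarrow> real)"
    using dom_sets(2) emeasure_bounded_finite[OF bounded_dom] by (intro integrable_real_indicator) auto
  have int: "integrable lborel (\<lambda>x. (f x)\<^sup>2 + indicator \<Omega> x)"
    using sq ind by simp
  have "\<bar>f x\<bar> \<le> (f x)\<^sup>2 + indicator \<Omega> x" for x
  proof (cases "x \<in> \<Omega>")
    case True
    have "0 \<le> (\<bar>f x\<bar> - 1)\<^sup>2 + \<bar>f x\<bar>" by simp
    then show ?thesis using True by (simp add: power2_diff)
  qed (simp add: f_def)
  then have ae': "AE x in lborel. norm (f x) \<le> norm ((f x)\<^sup>2 + indicator \<Omega> x :: real)"
    by (intro always_eventually) (simp add: abs_of_nonneg)
  have "integrable lborel f"
    by (rule Bochner_Integration.integrable_bound[OF int _ ae']) (use fb in simp)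
  then show thesis
    using that fb sq ae by (simp add: f_def)
qed

lemma integral_rep:
  fixes u f \<phi> :: "'a \<Rightarrow> real"
  assumes "u \<in> L2 \<Omega>" "f \<in> borel_measurable borel" "AE x in M. f x = u x" "\<And>x. x \<notin> \<Omega> \<Longrightarrow> f x = 0"
    and "\<phi> \<in> borel_measurable borel"
  shows "(LINT x|M. u x * \<phi> x) = (LINT x|lborel. f x * \<phi> x)"
proof -
  have "(LINT x|M. u x * \<phi> x) = (LINT x|M. f x * \<phi> x)"
    using assms(3) L2D(1)[OF assms(1)] borel_imp_dom[OF assms(2)] borel_imp_dom[OF assms(5)]
    by (intro integral_cong_AE) (auto elim!: eventually_mono)
  also have "\<dots> = (LINT x|lborel. f x * \<phi> x)"
    using assms by (intro integral_dom_eq_lborel) auto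
  finally show ?thesis .
qed

definition ip :: "('a \<Rightarrow> 'b::euclidean_space) \<Rightarrow> ('a \<Rightarrow> 'b) \<Rightarrow> real" where
  "ip f g = (LINT x|M. f x \<bullet> g x)"

lemma ip_integrable: "f \<in> L2 \<Omega> \<Longrightarrow> g \<in> L2 \<Omega> \<Longrightarrow> integrable M (\<lambda>x. f x \<bullet> g x)"
  by (intro integrable_inner_L2) (auto simp: L2D)

lemma ip_commute: "ip f g = ip g f"
  by (simp add: ip_def inner_commute)

lemma ip_add_left: "f \<in> L2 \<Omega> \<Longrightarrow> g \<in> L2 \<Omega> \<Longrightarrow> h \<in> L2 \<Omega> \<Longrightarrow> ip (\<lambda>x. f x + g x) h = ip f h + ip g h"
  by (simp add: ip_def inner_add_left ip_integrable)

lemma ip_diff_left: "f \<in> L2 \<Omega> \<Longrightarrow> g \<in> L2 \<Omega> \<Longrightarrow> h \<in> L2 \<Omega> \<Longrightarrow> ip (\<lambda>x. f x - g x) h = ip f h - ip g h"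
  by (simp add: ip_def inner_diff_left ip_integrable)

lemma ip_scaleR_left: "ip (\<lambda>x. c *\<^sub>R f x) h = c * ip f h"
  by (simp add: ip_def)

lemma ip_cmult_left: "ip (\<lambda>x. c * f x) h = c * ip f h"
  using ip_scaleR_left[of c f h] by simp

lemma ip_self: "ip f f = (LINT x|M. (norm (f x))\<^sup>2)"
  by (simp add: ip_def power2_norm_eq_inner)

lemma ip_self_nonneg: "ip f f \<ge> 0"
  by (simp add: ip_self)

lemma ip_Cauchy_Schwarz: "f \<in> L2 \<Omega> \<Longrightarrow> g \<in> L2 \<Omega> \<Longrightarrow> \<bar>ip f g\<bar> \<le> sqrt (ip f f) * sqrt (ip g g)"
  unfolding ip_self unfolding ip_def by (intro Cauchy_Schwarz_integral) (auto simp: L2D)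

lemma ip_cong_AE:
  "f \<in> L2 \<Omega> \<Longrightarrow> f' \<in> L2 \<Omega> \<Longrightarrow> g \<in> L2 \<Omega> \<Longrightarrow> AE x in M. f x = f' x \<Longrightarrow> ip f g = ip f' g"
  unfolding ip_def
  by (intro integral_cong_AE borel_measurable_inner L2D) (auto elim!: eventually_mono)

lemma ip_self_eq_0: "f \<in> L2 \<Omega> \<Longrightarrow> ip f f = 0 \<Longrightarrow> AE x in M. f x = 0"
  unfolding ip_self by (subst (asm) integral_nonneg_eq_0_iff_AE) (auto simp: L2D)

lemma test_borel:
  assumes "test_function \<Omega> \<phi>"
  shows "\<phi> \<in> borel_measurable borel"
  by (intro borel_measurable_continuous_onI smooth_continuous test_smooth[OF assms])

lemma test_outside: "test_function \<Omega> \<phi> \<Longrightarrow> x \<notin> \<Omega> \<Longrightarrow> \<phi> x = 0"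
  by (auto simp: test_function_def)

lemma test_L2:
  assumes "test_function \<Omega> \<phi>"
  shows "\<phi> \<in> L2 \<Omega>"
proof -
  obtain C where "\<And>x. \<bar>\<phi> x\<bar> \<le> C"
    using test_function_bounded[OF assms] by blast
  then show ?thesis
    by (intro L2_borel_bounded test_borel[OF assms])
qed

lemma L2_AE_zeroI:
  fixes f :: "'a \<Rightarrow> real"
  assumes "f \<in> L2 \<Omega>" "\<And>\<phi>. test_function \<Omega> \<phi> \<Longrightarrow> (LINT x|M. f x * \<phi> x) = 0"
  shows "AE x in M. f x = 0"
proof -
  obtain g where g: "g \<in> borel_measurable borel" "integrable lborel g" "integrable lborel (\<lambda>x. (g x)\<^sup>2)"
    "AE x in M. g x = f x" "\<And>x. x \<notin> \<Omega> \<Longrightarrow> g x = 0"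
    using L2_borel_rep[OF assms(1)] by blast
  have "AE x in lborel. x \<in> \<Omega> \<longrightarrow> g x = 0"
  proof (rule fundamental_lemma[OF g(1-3) open_dom])
    fix \<phi> assume \<phi>: "test_function \<Omega> \<phi>"
    show "(LINT y|lborel. g y * \<phi> y) = 0"
      using integral_rep[OF assms(1) g(1,4,5) test_borel[OF \<phi>]] assms(2)[OF \<phi>] by simp
  qed
  then have "AE x in M. g x = 0"
    by (rule AE_lborel_imp_dom)
  then show ?thesis
    using g(4) by eventually_elim simp
qed

lemma weak_gradient_unique:
  assumes "g \<in> L2 \<Omega>" "h \<in> L2 \<Omega>" "is_weak_gradient \<Omega> u g" "is_weak_gradient \<Omega> u h"
  shows "AE x in M. g x = h x"
proof -
  have "AE x in M. \<forall>b\<in>Basis. g x \<bullet> b - h x \<bullet> b = 0"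
  proof (subst AE_finite_all)
    show "\<forall>b\<in>Basis. AE x in M. g x \<bullet> b - h x \<bullet> b = 0"
    proof
      fix b :: 'a assume b: "b \<in> Basis"
      have gb: "(\<lambda>x. g x \<bullet> b) \<in> L2 \<Omega>" and hb: "(\<lambda>x. h x \<bullet> b) \<in> L2 \<Omega>"
        using assms L2_inner by blast+
      show "AE x in M. g x \<bullet> b - h x \<bullet> b = 0"
      proof (rule L2_AE_zeroI)
        show "(\<lambda>x. g x \<bullet> b - h x \<bullet> b) \<in> L2 \<Omega>"
          by (rule L2_diff[OF gb hb])
        fix \<phi> assume \<phi>: "test_function \<Omega> \<phi>"
        have "(LINT x|M. (g x \<bullet> b) * \<phi> x) = (LINT x|M. (h x \<bullet> b) * \<phi> x)"
          using assms(3,4) \<phi> b unfolding is_weak_gradient_def by force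
        then show "(LINT x|M. (g x \<bullet> b - h x \<bullet> b) * \<phi> x) = 0"
          using ip_diff_left[OF gb hb test_L2[OF \<phi>]] by (simp add: ip_def)
      qed
    qed
  qed simp
  then show ?thesis
    by (rule eventually_mono) (auto intro: euclidean_eqI)
qed

lemma H1_L2: "u \<in> H1 \<Omega> \<Longrightarrow> u \<in> L2 \<Omega>"
  by (simp add: H1_def)

lemma wgrad_spec:
  assumes "u \<in> H1 \<Omega>"
  shows "wgrad \<Omega> u \<in> L2 \<Omega>" "is_weak_gradient \<Omega> u (wgrad \<Omega> u)"
proof -
  have "\<exists>g. g \<in> L2 \<Omega> \<and> is_weak_gradient \<Omega> u g"
    using assms by (auto simp: H1_def)
  from someI_ex[OF this] show "wgrad \<Omega> u \<in> L2 \<Omega>" "is_weak_gradient \<Omega> u (wgrad \<Omega> u)"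
    by (simp_all add: wgrad_def)
qed

lemma H1_wgradI:
  assumes "u \<in> L2 \<Omega>" "g \<in> L2 \<Omega>" "is_weak_gradient \<Omega> u g"
  shows "u \<in> H1 \<Omega>" "AE x in M. wgrad \<Omega> u x = g x"
proof -
  show "u \<in> H1 \<Omega>"
    using assms by (auto simp: H1_def)
  then show "AE x in M. wgrad \<Omega> u x = g x"
    using assms wgrad_spec by (intro weak_gradient_unique)
qed

lemma is_weak_gradientD:
  "is_weak_gradient \<Omega> u g \<Longrightarrow> test_function \<Omega> \<phi> \<Longrightarrow> b \<in> Basis \<Longrightarrow> ip u (pd \<phi> b) = - ip (\<lambda>x. g x \<bullet> b) \<phi>"
  by (simp add: is_weak_gradient_def ip_def)

lemma H1_add:
  assumes "u \<in> H1 \<Omega>" "v \<in> H1 \<Omega>"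
  shows "(\<lambda>x. u x + v x) \<in> H1 \<Omega>"
    "AE x in M. wgrad \<Omega> (\<lambda>x. u x + v x) x = wgrad \<Omega> u x + wgrad \<Omega> v x"
proof -
  have L: "(\<lambda>x. u x + v x) \<in> L2 \<Omega>" "(\<lambda>x. wgrad \<Omega> u x + wgrad \<Omega> v x) \<in> L2 \<Omega>"
    using assms by (simp_all add: L2_add H1_L2 wgrad_spec)
  have "ip (\<lambda>x. u x + v x) (pd \<phi> b) = - ip (\<lambda>x. (wgrad \<Omega> u x + wgrad \<Omega> v x) \<bullet> b) \<phi>"
    if \<phi>: "test_function \<Omega> \<phi>" and b: "b \<in> Basis" for \<phi> b
    using is_weak_gradientD[OF wgrad_spec(2)[OF assms(1)] \<phi> b]
      is_weak_gradientD[OF wgrad_spec(2)[OF assms(2)] \<phi> b]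
    by (simp add: inner_add_left ip_add_left H1_L2 assms test_L2 \<phi> test_function_pd[OF \<phi> b]
        L2_inner wgrad_spec)
  then have "is_weak_gradient \<Omega> (\<lambda>x. u x + v x) (\<lambda>x. wgrad \<Omega> u x + wgrad \<Omega> v x)"
    by (simp add: is_weak_gradient_def ip_def)
  from H1_wgradI[OF L this] show "(\<lambda>x. u x + v x) \<in> H1 \<Omega>"
    "AE x in M. wgrad \<Omega> (\<lambda>x. u x + v x) x = wgrad \<Omega> u x + wgrad \<Omega> v x"
    by blast+
qed

lemma H1_cmult:
  assumes "u \<in> H1 \<Omega>"
  shows "(\<lambda>x. c * u x) \<in> H1 \<Omega>"
    "AE x in M. wgrad \<Omega> (\<lambda>x. c * u x) x = c *\<^sub>R wgrad \<Omega> u x"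
proof -
  have L: "(\<lambda>x. c * u x) \<in> L2 \<Omega>" "(\<lambda>x. c *\<^sub>R wgrad \<Omega> u x) \<in> L2 \<Omega>"
    using assms by (simp_all add: L2_cmult L2_scaleR H1_L2 wgrad_spec)
  have "ip (\<lambda>x. c * u x) (pd \<phi> b) = - ip (\<lambda>x. (c *\<^sub>R wgrad \<Omega> u x) \<bullet> b) \<phi>"
    if \<phi>: "test_function \<Omega> \<phi>" and b: "b \<in> Basis" for \<phi> b
    using is_weak_gradientD[OF wgrad_spec(2)[OF assms(1)] \<phi> b]
    by (simp add: ip_cmult_left)
  then have "is_weak_gradient \<Omega> (\<lambda>x. c * u x) (\<lambda>x. c *\<^sub>R wgrad \<Omega> u x)"
    by (simp add: is_weak_gradient_def ip_def)
  from H1_wgradI[OF L this] show "(\<lambda>x. c * u x) \<in> H1 \<Omega>"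
    "AE x in M. wgrad \<Omega> (\<lambda>x. c * u x) x = c *\<^sub>R wgrad \<Omega> u x"
    by blast+
qed

definition gip :: "('a \<Rightarrow> real) \<Rightarrow> ('a \<Rightarrow> 'a) \<Rightarrow> real" where
  "gip u V = ip (wgrad \<Omega> u) V"

lemma gip_add:
  assumes "u \<in> H1 \<Omega>" "v \<in> H1 \<Omega>" "V \<in> L2 \<Omega>"
  shows "gip (\<lambda>x. u x + v x) V = gip u V + gip v V"
proof -
  note L = wgrad_spec(1)[OF assms(1)] wgrad_spec(1)[OF assms(2)]
  have "gip (\<lambda>x. u x + v x) V = ip (\<lambda>x. wgrad \<Omega> u x + wgrad \<Omega> v x) V"
    unfolding gip_def
    by (rule ip_cong_AE[OF wgrad_spec(1)[OF H1_add(1)[OF assms(1,2)]] L2_add[OF L] assms(3)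
          H1_add(2)[OF assms(1,2)]])
  then show ?thesis
    by (simp add: gip_def ip_add_left[OF L assms(3)])
qed

lemma gip_cmult:
  assumes "u \<in> H1 \<Omega>" "V \<in> L2 \<Omega>"
  shows "gip (\<lambda>x. c * u x) V = c * gip u V"
proof -
  have "gip (\<lambda>x. c * u x) V = ip (\<lambda>x. c *\<^sub>R wgrad \<Omega> u x) V"
    unfolding gip_def
    by (rule ip_cong_AE[OF wgrad_spec(1)[OF H1_cmult(1)[OF assms(1)]]
          L2_scaleR[OF wgrad_spec(1)[OF assms(1)]] assms(2) H1_cmult(2)[OF assms(1)]])
  then show ?thesis
    by (simp add: gip_def ip_scaleR_left)
qed

lemma H1_diff: "u \<in> H1 \<Omega> \<Longrightarrow> v \<in> H1 \<Omega> \<Longrightarrow> (\<lambda>x. u x - v x) \<in> H1 \<Omega>"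
  using H1_add(1)[OF _ H1_cmult(1), of u v "-1"] by simp

lemma gip_diff: "u \<in> H1 \<Omega> \<Longrightarrow> v \<in> H1 \<Omega> \<Longrightarrow> V \<in> L2 \<Omega> \<Longrightarrow> gip (\<lambda>x. u x - v x) V = gip u V - gip v V"
  using gip_add[OF _ H1_cmult(1), of u v V "-1"] gip_cmult[of v V "-1"] by simp

lemma H1_zero: "(\<lambda>x. 0) \<in> H1 \<Omega>"
  using L2_zero[where 'b = real] L2_zero[where 'b = 'a]
  by (auto simp: H1_def is_weak_gradient_def intro!: bexI[of _ "\<lambda>x. 0"])

lemma H1_norm_ip: "H1_norm \<Omega> u = sqrt (ip u u + ip (wgrad \<Omega> u) (wgrad \<Omega> u))"
  by (simp add: H1_norm_def ip_self)

lemma H1_norm_nonneg: "H1_norm \<Omega> u \<ge> 0"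
  by (simp add: H1_norm_def)

lemma ip_le_H1_norm: "ip u u \<le> (H1_norm \<Omega> u)\<^sup>2" "ip (wgrad \<Omega> u) (wgrad \<Omega> u) \<le> (H1_norm \<Omega> u)\<^sup>2"
  using ip_self_nonneg[of u] ip_self_nonneg[of "wgrad \<Omega> u"] by (simp_all add: H1_norm_ip)

lemma ip_bound_H1:
  assumes "u \<in> H1 \<Omega>" "v \<in> L2 \<Omega>"
  shows "\<bar>ip u v\<bar> \<le> H1_norm \<Omega> u * sqrt (ip v v)"
proof -
  have "sqrt (ip u u) * sqrt (ip v v) \<le> H1_norm \<Omega> u * sqrt (ip v v)"
    using ip_self_nonneg[of v] ip_self_nonneg[of "wgrad \<Omega> u"]
    by (intro mult_right_mono) (simp_all add: H1_norm_ip)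
  then show ?thesis
    using ip_Cauchy_Schwarz[OF H1_L2[OF assms(1)] assms(2)] by linarith
qed

lemma gip_bound_H1:
  assumes "u \<in> H1 \<Omega>" "V \<in> L2 \<Omega>"
  shows "\<bar>gip u V\<bar> \<le> H1_norm \<Omega> u * sqrt (ip V V)"
proof -
  have "sqrt (ip (wgrad \<Omega> u) (wgrad \<Omega> u)) * sqrt (ip V V) \<le> H1_norm \<Omega> u * sqrt (ip V V)"
    using ip_self_nonneg[of u] ip_self_nonneg[of V]
    by (intro mult_right_mono) (simp_all add: H1_norm_ip)
  then show ?thesis
    using ip_Cauchy_Schwarz[OF wgrad_spec(1)[OF assms(1)] assms(2)] by (simp add: gip_def)
qed

definition grad :: "('a \<Rightarrow> real) \<Rightarrow> 'a \<Rightarrow> 'a" where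
  "grad \<phi> x = (\<Sum>b\<in>Basis. pd \<phi> b x *\<^sub>R b)"

lemma grad_inner: "b \<in> Basis \<Longrightarrow> grad \<phi> x \<bullet> b = pd \<phi> b x"
  by (simp add: grad_def inner_sum_left inner_Basis if_distrib cong: if_cong)

lemma L2_sum:
  fixes f :: "'i \<Rightarrow> 'a \<Rightarrow> 'b::euclidean_space"
  shows "finite A \<Longrightarrow> (\<And>i. i \<in> A \<Longrightarrow> f i \<in> L2 \<Omega>) \<Longrightarrow> (\<lambda>x. \<Sum>i\<in>A. f i x) \<in> L2 \<Omega>"
  by (induction A rule: finite_induct) (auto intro: L2_zero L2_add)

lemma test_H1:
  assumes \<phi>: "test_function \<Omega> \<phi>"
  shows "\<phi> \<in> H1 \<Omega>" "AE x in M. wgrad \<Omega> \<phi> x = grad \<phi> x" "grad \<phi> \<in> L2 \<Omega>"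
proof -
  have "(\<lambda>x. pd \<phi> b x *\<^sub>R b) \<in> L2 \<Omega>" if "b \<in> Basis" for b
    using L2D(1)[OF test_L2[OF test_function_pd[OF \<phi> that]]] that
    by (intro L2_bounded[OF test_L2[OF test_function_pd[OF \<phi> that]], where C = 1]) auto
  then show L: "grad \<phi> \<in> L2 \<Omega>"
    unfolding grad_def[abs_def] by (intro L2_sum) auto
  have "is_weak_gradient \<Omega> \<phi> (grad \<phi>)"
    unfolding is_weak_gradient_def
  proof (intro allI impI ballI)
    fix \<psi> b assume \<psi>: "test_function \<Omega> \<psi>" and b: "(b::'a) \<in> Basis"
    have out: "\<psi> x = 0" "pd \<psi> b x = 0" "\<phi> x = 0" if "x \<notin> \<Omega>" for x
      by (rule test_outside[OF _ that], intro \<psi> \<phi> b test_function_pd)+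
    have "(LINT x|M. \<phi> x * pd \<psi> b x) = (LINT x|lborel. \<phi> x * pd \<psi> b x)"
      using out test_borel[OF \<phi>] test_borel[OF test_function_pd[OF \<psi> b]]
      by (intro integral_dom_eq_lborel) auto
    also have "\<dots> = - (LINT x|lborel. pd \<phi> b x * \<psi> x)"
      by (rule integral_by_parts_test[OF \<psi> test_smooth[OF \<phi>] b])
    also have "(LINT x|lborel. pd \<phi> b x * \<psi> x) = (LINT x|M. pd \<phi> b x * \<psi> x)"
      using out test_borel[OF \<psi>] test_borel[OF test_function_pd[OF \<phi> b]]
      by (intro integral_dom_eq_lborel[symmetric]) auto
    finally show "(LINT x|M. \<phi> x * pd \<psi> b x) = - (LINT x|M. (grad \<phi> x \<bullet> b) * \<psi> x)"
      using b by (simp add: grad_inner)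
  qed
  from H1_wgradI[OF test_L2[OF \<phi>] L this]
  show "\<phi> \<in> H1 \<Omega>" "AE x in M. wgrad \<Omega> \<phi> x = grad \<phi> x"
    by blast+
qed

lemma gip_test: "test_function \<Omega> \<phi> \<Longrightarrow> V \<in> L2 \<Omega> \<Longrightarrow> gip \<phi> V = ip (grad \<phi>) V"
  unfolding gip_def using test_H1[of \<phi>] wgrad_spec(1)[of \<phi>] by (intro ip_cong_AE) auto

lemma H10I:
  fixes \<phi> :: "nat \<Rightarrow> 'a \<Rightarrow> real"
  assumes "u \<in> H1 \<Omega>" "\<And>n. test_function \<Omega> (\<phi> n)" "(\<lambda>n. H1_norm \<Omega> (\<lambda>x. u x - \<phi> n x)) \<longlonglongrightarrow> 0"
  shows "u \<in> H10 \<Omega>"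
  using assms by (auto simp: H10_def)

lemma H10E:
  assumes "u \<in> H10 \<Omega>"
  obtains \<phi> :: "nat \<Rightarrow> 'a \<Rightarrow> real" where "\<And>n. test_function \<Omega> (\<phi> n)"
    "(\<lambda>n. H1_norm \<Omega> (\<lambda>x. u x - \<phi> n x)) \<longlonglongrightarrow> 0"
  using assms by (auto simp: H10_def)

lemma H10_H1: "u \<in> H10 \<Omega> \<Longrightarrow> u \<in> H1 \<Omega>"
  by (simp add: H10_def)

lemma H10_L2: "u \<in> H10 \<Omega> \<Longrightarrow> u \<in> L2 \<Omega>"
  by (simp add: H10_H1 H1_L2)

lemma H1_norm_zero: "H1_norm \<Omega> (\<lambda>x. 0) = 0"
proof -
  have "gip (\<lambda>x. 0) V = 0" if "V \<in> L2 \<Omega>" for V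
    using gip_cmult[OF H1_zero that, of 0] by simp
  then show ?thesis
    using wgrad_spec(1)[OF H1_zero] by (simp add: H1_norm_ip gip_def) (simp add: ip_def)
qed

lemma test_H10:
  assumes "test_function \<Omega> \<phi>"
  shows "\<phi> \<in> H10 \<Omega>"
proof -
  have "(\<lambda>n::nat. H1_norm \<Omega> (\<lambda>x. \<phi> x - \<phi> x)) \<longlonglongrightarrow> 0"
    by (simp add: H1_norm_zero)
  then show ?thesis
    by (rule H10I[OF test_H1(1)[OF assms] assms])
qed

lemma H1_norm_cmult:
  assumes "u \<in> H1 \<Omega>"
  shows "H1_norm \<Omega> (\<lambda>x. c * u x) = \<bar>c\<bar> * H1_norm \<Omega> u"
proof -
  have "ip (\<lambda>x. c * u x) (\<lambda>x. c * u x) = c\<^sup>2 * ip u u"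
    by (simp add: ip_cmult_left ip_commute[of u "\<lambda>x. c * u x"] power2_eq_square)
  moreover have "ip (wgrad \<Omega> (\<lambda>x. c * u x)) (wgrad \<Omega> (\<lambda>x. c * u x)) = c\<^sup>2 * ip (wgrad \<Omega> u) (wgrad \<Omega> u)"
    using gip_cmult[OF assms, of "wgrad \<Omega> (\<lambda>x. c * u x)" c] gip_cmult[OF assms, of "wgrad \<Omega> u" c]
      wgrad_spec(1)[OF assms] wgrad_spec(1)[OF H1_cmult(1)[OF assms]]
    by (simp add: gip_def ip_commute[of "wgrad \<Omega> u" "wgrad \<Omega> (\<lambda>x. c * u x)"] power2_eq_square)
  ultimately have "H1_norm \<Omega> (\<lambda>x. c * u x) = sqrt (c\<^sup>2 * (ip u u + ip (wgrad \<Omega> u) (wgrad \<Omega> u)))"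
    unfolding H1_norm_ip by (simp only: distrib_left)
  then show ?thesis
    by (simp add: H1_norm_ip real_sqrt_mult)
qed

lemma H1_norm_triangle:
  assumes "u \<in> H1 \<Omega>" "v \<in> H1 \<Omega>"
  shows "H1_norm \<Omega> (\<lambda>x. u x + v x) \<le> H1_norm \<Omega> u + H1_norm \<Omega> v"
proof -
  let ?w = "\<lambda>x. u x + v x"
  note L = assms[THEN H1_L2] assms[THEN wgrad_spec(1)]
  have w: "?w \<in> H1 \<Omega>" by (rule H1_add(1)[OF assms])
  note Lw = H1_L2[OF w] wgrad_spec(1)[OF w]
  have 1: "ip ?w ?w = ip u u + 2 * ip u v + ip v v"
    using L(1,2) Lw(1) ip_add_left[OF L(1,2) Lw(1)] ip_add_left[OF L(1,2) L(1)] ip_add_left[OF L(1,2) L(2)]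
    by (simp add: ip_commute[of u ?w] ip_commute[of v ?w] ip_commute[of v u])
  have 2: "ip (wgrad \<Omega> ?w) (wgrad \<Omega> ?w) = ip (wgrad \<Omega> u) (wgrad \<Omega> u)
      + 2 * ip (wgrad \<Omega> u) (wgrad \<Omega> v) + ip (wgrad \<Omega> v) (wgrad \<Omega> v)"
    using gip_add[OF assms Lw(2)] gip_add[OF assms L(3)] gip_add[OF assms L(4)]
    by (simp add: gip_def ip_commute[of "wgrad \<Omega> u" "wgrad \<Omega> ?w"]
        ip_commute[of "wgrad \<Omega> v" "wgrad \<Omega> ?w"] ip_commute[of "wgrad \<Omega> v" "wgrad \<Omega> u"])
  define a b c d where "a = sqrt (ip u u)" and "b = sqrt (ip (wgrad \<Omega> u) (wgrad \<Omega> u))"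
    and "c = sqrt (ip v v)" and "d = sqrt (ip (wgrad \<Omega> v) (wgrad \<Omega> v))"
  have sq: "ip u u = a\<^sup>2" "ip (wgrad \<Omega> u) (wgrad \<Omega> u) = b\<^sup>2" "ip v v = c\<^sup>2"
    "ip (wgrad \<Omega> v) (wgrad \<Omega> v) = d\<^sup>2"
    by (simp_all add: a_def b_def c_def d_def ip_self_nonneg)
  have "ip u v \<le> a * c" "ip (wgrad \<Omega> u) (wgrad \<Omega> v) \<le> b * d"
    using ip_Cauchy_Schwarz[OF L(1,2)] ip_Cauchy_Schwarz[OF L(3,4)] by (auto simp: a_def b_def c_def d_def)
  moreover have "a * c + b * d \<le> sqrt (a\<^sup>2 + b\<^sup>2) * sqrt (c\<^sup>2 + d\<^sup>2)"
    using Cauchy_Schwarz_ineq2[of "(a, b)" "(c, d)"] by (simp add: norm_Pair)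
  ultimately have "ip ?w ?w + ip (wgrad \<Omega> ?w) (wgrad \<Omega> ?w)
      \<le> (a\<^sup>2 + b\<^sup>2) + 2 * (sqrt (a\<^sup>2 + b\<^sup>2) * sqrt (c\<^sup>2 + d\<^sup>2)) + (c\<^sup>2 + d\<^sup>2)"
    unfolding 1 2 sq by linarith
  also have "\<dots> = (sqrt (a\<^sup>2 + b\<^sup>2) + sqrt (c\<^sup>2 + d\<^sup>2))\<^sup>2"
    by (simp add: power2_sum)
  finally show ?thesis
    unfolding H1_norm_ip sq by (intro real_le_lsqrt) (auto simp: add_nonneg_nonneg)
qed

lemma H10_add:
  assumes "u \<in> H10 \<Omega>" "v \<in> H10 \<Omega>"
  shows "(\<lambda>x. u x + v x) \<in> H10 \<Omega>"
proof -
  obtain \<phi> \<psi> where \<phi>: "\<And>n::nat. test_function \<Omega> (\<phi> n)" "(\<lambda>n. H1_norm \<Omega> (\<lambda>x. u x - \<phi> n x)) \<longlonglongrightarrow> 0"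
    and \<psi>: "\<And>n::nat. test_function \<Omega> (\<psi> n)" "(\<lambda>n. H1_norm \<Omega> (\<lambda>x. v x - \<psi> n x)) \<longlonglongrightarrow> 0"
    using assms unfolding H10_def by blast
  have "H1_norm \<Omega> (\<lambda>x. u x + v x - (\<phi> n x + \<psi> n x))
      \<le> H1_norm \<Omega> (\<lambda>x. u x - \<phi> n x) + H1_norm \<Omega> (\<lambda>x. v x - \<psi> n x)" for n
    using H1_norm_triangle[OF H1_diff[OF H10_H1[OF assms(1)] test_H1(1)[OF \<phi>(1)]]
        H1_diff[OF H10_H1[OF assms(2)] test_H1(1)[OF \<psi>(1)]], of n n]
    by (simp add: add_diff_add)
  then have "(\<lambda>n. H1_norm \<Omega> (\<lambda>x. u x + v x - (\<phi> n x + \<psi> n x))) \<longlonglongrightarrow> 0"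
    by (intro Lim_null_comparison[OF always_eventually tendsto_add_zero[OF \<phi>(2) \<psi>(2)]])
       (simp add: H1_norm_nonneg)
  then show ?thesis
    by (rule H10I[OF H1_add(1)[OF assms[THEN H10_H1]] test_function_add[OF \<phi>(1) \<psi>(1)]])
qed

lemma H10_cmult:
  assumes "u \<in> H10 \<Omega>"
  shows "(\<lambda>x. c * u x) \<in> H10 \<Omega>"
proof -
  obtain \<phi> where \<phi>: "\<And>n::nat. test_function \<Omega> (\<phi> n)" "(\<lambda>n. H1_norm \<Omega> (\<lambda>x. u x - \<phi> n x)) \<longlonglongrightarrow> 0"
    using assms unfolding H10_def by blast
  have "H1_norm \<Omega> (\<lambda>x. c * u x - c * \<phi> n x) = \<bar>c\<bar> * H1_norm \<Omega> (\<lambda>x. u x - \<phi> n x)" for n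
    using H1_norm_cmult[OF H1_diff[OF H10_H1[OF assms] test_H1(1)[OF \<phi>(1)]], of c n]
    by (simp add: right_diff_distrib)
  then have "(\<lambda>n. H1_norm \<Omega> (\<lambda>x. c * u x - c * \<phi> n x)) \<longlonglongrightarrow> 0"
    using tendsto_mult[OF tendsto_const[of "\<bar>c\<bar>"] \<phi>(2)] by simp
  then show ?thesis
    by (rule H10I[OF H1_cmult(1)[OF assms[THEN H10_H1]] test_function_cmult[OF \<phi>(1)]])
qed

lemma H10_diff: "u \<in> H10 \<Omega> \<Longrightarrow> v \<in> H10 \<Omega> \<Longrightarrow> (\<lambda>x. u x - v x) \<in> H10 \<Omega>"
  using H10_add[OF _ H10_cmult, of u v "-1"] by simp

end

section \<open>Convolutions and Picone's inequality\<close>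

definition conv :: "('a::euclidean_space \<Rightarrow> real) \<Rightarrow> ('a \<Rightarrow> real) \<Rightarrow> 'a \<Rightarrow> real" where
  "conv f \<kappa> x = (LINT y|lborel. f y * \<kappa> (x - y))"

lemma conv_measurable_kernel:
  assumes "test_function S \<kappa>"
  shows "(\<lambda>y. \<kappa> (x - y)) \<in> borel_measurable lborel"
proof -
  have "continuous_on UNIV (\<lambda>y. \<kappa> (x - y))"
    by (rule continuous_on_compose2[OF smooth_continuous[OF test_smooth[OF assms], of UNIV]])
       (auto intro!: continuous_intros)
  then show ?thesis
    by (simp add: borel_measurable_continuous_onI)
qed

lemma conv_integrable:
  assumes "integrable lborel f" "test_function S \<kappa>"
  shows "integrable lborel (\<lambda>y. f y * \<kappa> (x - y))"
proof -
  obtain C where "\<And>x. \<bar>\<kappa> x\<bar> \<le> C"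
    using test_function_bounded[OF assms(2)] by blast
  then show ?thesis
    by (rule integrable_mult_bounded[OF assms(1) conv_measurable_kernel[OF assms(2)]])
qed

lemma conv_continuous:
  assumes f: "integrable lborel f" and \<kappa>: "test_function S \<kappa>"
  shows "continuous_on UNIV (conv f \<kappa>)"
proof -
  obtain C where C: "\<And>x. \<bar>\<kappa> x\<bar> \<le> C"
    using test_function_bounded[OF \<kappa>] by blast
  have "isCont (conv f \<kappa>) x" for x
    unfolding isCont_def tendsto_at_iff_sequentially
  proof (intro allI impI)
    fix X :: "nat \<Rightarrow> 'a" assume X: "\<forall>i. X i \<in> UNIV - {x}" "X \<longlonglongrightarrow> x"
    have "(\<lambda>i. LINT y|lborel. f y * \<kappa> (X i - y)) \<longlonglongrightarrow> (LINT y|lborel. f y * \<kappa> (x - y))"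
    proof (rule integral_dominated_convergence[where w = "\<lambda>y. C * \<bar>f y\<bar>"])
      have "isCont \<kappa> z" for z
        using smooth_continuous[OF test_smooth[OF \<kappa>], of UNIV] by (simp add: continuous_on_eq_continuous_at)
      then have "(\<lambda>i. \<kappa> (X i - y)) \<longlonglongrightarrow> \<kappa> (x - y)" for y
        by (rule isCont_tendsto_compose) (intro tendsto_diff X tendsto_const)
      then show "AE y in lborel. (\<lambda>i. f y * \<kappa> (X i - y)) \<longlonglongrightarrow> f y * \<kappa> (x - y)"
        by (intro always_eventually allI tendsto_mult tendsto_const)
      show "AE y in lborel. norm (f y * \<kappa> (X i - y)) \<le> C * \<bar>f y\<bar>" for i
        using mult_left_mono[OF C abs_ge_zero] by (intro always_eventually allI) (simp add: abs_mult mult.commute)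
      show "integrable lborel (\<lambda>y. C * \<bar>f y\<bar>)"
        using f by simp
    qed (use conv_integrable[OF f \<kappa>] in auto)
    then show "(conv f \<kappa> \<circ> X) \<longlonglongrightarrow> conv f \<kappa> x"
      by (simp add: conv_def comp_def)
  qed
  then show ?thesis
    by (simp add: continuous_at_imp_continuous_on)
qed

lemma conv_directional:
  assumes f: "integrable lborel f" and \<kappa>: "test_function S \<kappa>" and b: "b \<in> Basis"
  shows "((\<lambda>t. conv f \<kappa> (x + t *\<^sub>R b)) has_real_derivative conv f (pd \<kappa> b) x) (at 0)"
proof -
  note \<kappa>' = test_function_pd[OF \<kappa> b]
  obtain C D where C: "\<And>x. \<bar>\<kappa> x\<bar> \<le> C" and D: "\<And>x. \<bar>pd \<kappa> b x\<bar> \<le> D"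
    using test_function_bounded[OF \<kappa>] test_function_bounded[OF \<kappa>'] by blast
  have "((\<lambda>t. LINT y|lborel. f y * \<kappa> (x + t *\<^sub>R b - y)) has_real_derivative
      (LINT y|lborel. f y * pd \<kappa> b (x + 0 *\<^sub>R b - y))) (at 0)"
  proof (rule DERIV_integral[OF f, where r = 1 and C = C and L = D and K' = "\<lambda>t y. pd \<kappa> b (x + t *\<^sub>R b - y)"])
    fix t y
    have "((\<lambda>s. \<kappa> (x + t *\<^sub>R b - y + s *\<^sub>R b)) has_real_derivative pd \<kappa> b (x + t *\<^sub>R b - y)) (at 0)"
      by (rule smooth_directional[OF test_smooth[OF \<kappa>]])
    then show "((\<lambda>t. \<kappa> (x + t *\<^sub>R b - y)) has_real_derivative pd \<kappa> b (x + t *\<^sub>R b - y)) (at t)"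
      using DERIV_shift[of "\<lambda>s. \<kappa> (x + s *\<^sub>R b - y)" _ 0 t] by (simp add: algebra_simps)
  qed (use conv_measurable_kernel[OF \<kappa>] conv_measurable_kernel[OF \<kappa>', of "x + 0 *\<^sub>R b"] C D in auto)
  then show ?thesis
    by (simp add: conv_def)
qed

lemma integrable_continuous_compact:
  fixes f :: "'a::euclidean_space \<Rightarrow> real"
  assumes "continuous_on UNIV f" "compact K" "\<And>x. x \<notin> K \<Longrightarrow> f x = 0"
  shows "integrable lborel f"
  using compact_support_bounded[of f, OF assms] assms(3)
  by (auto intro!: integrable_bounded_support[of f _ K] borel_measurable_continuous_onI compact_imp_bounded assms(1,2))

lemma bump_bp0_pos:
  assumes "s > 0" "dist x y < 1 / s"
  shows "bump bp0 s x y > 0"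
proof -
  have "(s * norm (y - x))\<^sup>2 < 1"
    using assms by (subst power_less_one_iff)
      (simp_all add: dist_norm norm_minus_commute field_simps)
  then show ?thesis
    by (simp add: bump_def bexp_def bp0_def power2_norm_eq_inner[symmetric] power_mult_distrib)
qed

lemma picone_regularized:
  fixes f \<phi> :: "'a::euclidean_space \<Rightarrow> real"
  assumes f: "integrable lborel f" and \<kappa>: "test_function S \<kappa>" and \<phi>: "test_function \<Omega> \<phi>"
    and pos: "\<And>x. conv f \<kappa> x \<ge> 0" and "c > 0"
  shows "- (LINT x|lborel. conv f (lap \<kappa>) x * ((\<phi> x)\<^sup>2 / (conv f \<kappa> x + c)))
    \<le> (LINT x|lborel. (\<Sum>b\<in>Basis. (pd \<phi> b x)\<^sup>2))"
proof -
  obtain K where K: "smooth \<phi>" "compact K" "\<And>x. x \<notin> K \<Longrightarrow> \<phi> x = 0"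
    using test_functionE[OF \<phi>] by metis
  define V where "V = (\<lambda>x. conv f \<kappa> x + c)"
  define V1 where "V1 = (\<lambda>b. conv f (pd \<kappa> b))"
  define V2 where "V2 = (\<lambda>b. conv f (pd (pd \<kappa> b) b))"
  have Vpos: "V x > 0" for x
    using pos[of x] \<open>c > 0\<close> by (simp add: V_def)
  then have Vne: "V x \<noteq> 0" for x
    by (metis less_irrefl)
  have \<kappa>1: "test_function S (pd \<kappa> b)" and \<kappa>2: "test_function S (pd (pd \<kappa> b) b)" if "b \<in> Basis" for b
    using \<kappa> that by (auto intro: test_function_pd)
  have cV: "continuous_on UNIV V"
    unfolding V_def by (intro continuous_intros conv_continuous[OF f \<kappa>])
  have cV1: "continuous_on UNIV (V1 b)" and cV2: "continuous_on UNIV (V2 b)" if "b \<in> Basis" for b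
    unfolding V1_def V2_def using that by (auto intro: conv_continuous[OF f] \<kappa>1 \<kappa>2)
  have c\<phi>1: "continuous_on UNIV (pd \<phi> b)" if "b \<in> Basis" for b
    using K(1) that by (auto intro: smooth_continuous smooth_pd)
  have c\<phi>0: "continuous_on UNIV \<phi>"
    by (rule smooth_continuous[OF K(1)])
  let ?A = "\<lambda>b x. V2 b x * ((\<phi> x)\<^sup>2 / V x)"
  let ?B = "\<lambda>b x. 2 * \<phi> x * pd \<phi> b x * V1 b x / V x - (\<phi> x)\<^sup>2 * (V1 b x)\<^sup>2 / (V x)\<^sup>2"
  have intA: "integrable lborel (?A b)" and intB: "integrable lborel (?B b)"
    and intC: "integrable lborel (\<lambda>x. (pd \<phi> b x)\<^sup>2)" if b: "b \<in> Basis" for b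
    using cV cV1[OF b] cV2[OF b] c\<phi>0 c\<phi>1[OF b] Vne K pd_eq_0_outside[where f = \<phi>, OF K(2,3)]
    by (auto intro!: integrable_continuous_compact[OF _ K(2)] continuous_intros)
  have AB: "(LINT x|lborel. ?A b x + ?B b x) = 0" if b: "b \<in> Basis" for b
  proof (rule integral_partial_derivative_eq_0)
    show "((\<lambda>t. V1 b (x + t *\<^sub>R b) * ((\<phi> (x + t *\<^sub>R b))\<^sup>2 / V (x + t *\<^sub>R b))) has_real_derivative
        ?A b x + ?B b x) (at 0)" for x
    proof -
      have 1: "((\<lambda>t. V1 b (x + t *\<^sub>R b)) has_real_derivative V2 b x) (at 0)"
        unfolding V1_def V2_def by (rule conv_directional[OF f \<kappa>1[OF b] b])
      have 2: "((\<lambda>t. \<phi> (x + t *\<^sub>R b)) has_real_derivative pd \<phi> b x) (at 0)"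
        by (rule smooth_directional[OF K(1)])
      have 3: "((\<lambda>t. V (x + t *\<^sub>R b)) has_real_derivative V1 b x) (at 0)"
        unfolding V_def V1_def using DERIV_add[OF conv_directional[OF f \<kappa> b] DERIV_const] by simp
      have "((\<lambda>t. V1 b (x + t *\<^sub>R b) * ((\<phi> (x + t *\<^sub>R b) * \<phi> (x + t *\<^sub>R b)) / V (x + t *\<^sub>R b))) has_real_derivative
         V1 b (x + 0 *\<^sub>R b) * (((\<phi> (x + 0 *\<^sub>R b) * pd \<phi> b x + pd \<phi> b x * \<phi> (x + 0 *\<^sub>R b)) * V (x + 0 *\<^sub>R b)
           - (\<phi> (x + 0 *\<^sub>R b) * \<phi> (x + 0 *\<^sub>R b)) * V1 b x) / (V (x + 0 *\<^sub>R b) * V (x + 0 *\<^sub>R b)))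
           + V2 b x * ((\<phi> (x + 0 *\<^sub>R b) * \<phi> (x + 0 *\<^sub>R b)) / V (x + 0 *\<^sub>R b))) (at 0)"
        by (rule DERIV_mult'[OF 1 DERIV_divide[OF DERIV_mult'[OF 2 2] 3]]) (use Vne in simp)
      then show ?thesis
        using Vne[of x] by (simp add: power2_eq_square field_simps)
    qed
    show "continuous_on UNIV (\<lambda>x. V1 b x * ((\<phi> x)\<^sup>2 / V x))" "continuous_on UNIV (\<lambda>x. ?A b x + ?B b x)"
      using cV cV1[OF b] cV2[OF b] c\<phi>0 c\<phi>1[OF b] Vne by (auto intro!: continuous_intros)
    show "compact K" by fact
    show "V1 b x * ((\<phi> x)\<^sup>2 / V x) = 0" "?A b x + ?B b x = 0" if "x \<notin> K" for x
      using K(3)[OF that] by simp_all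
  qed
  have le: "- (LINT x|lborel. ?A b x) \<le> (LINT x|lborel. (pd \<phi> b x)\<^sup>2)" if b: "b \<in> Basis" for b
  proof -
    have "- (LINT x|lborel. ?A b x) = (LINT x|lborel. ?B b x)"
      using AB[OF b] intA[OF b] intB[OF b] by simp
    also have "\<dots> \<le> (LINT x|lborel. (pd \<phi> b x)\<^sup>2)"
    proof (rule integral_mono[OF intB[OF b] intC[OF b]])
      fix x
      have "0 \<le> (pd \<phi> b x - \<phi> x * V1 b x / V x)\<^sup>2"
        by simp
      then show "?B b x \<le> (pd \<phi> b x)\<^sup>2"
        by (simp add: power2_diff power_mult_distrib power_divide mult_ac)
    qed
    finally show ?thesis .
  qed
  have "conv f (lap \<kappa>) x = (\<Sum>b\<in>Basis. V2 b x)" for x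
    unfolding conv_def V2_def lap_def sum_distrib_left
    by (intro Bochner_Integration.integral_sum conv_integrable[OF f \<kappa>2])
  then have "(LINT x|lborel. conv f (lap \<kappa>) x * ((\<phi> x)\<^sup>2 / V x)) = (LINT x|lborel. (\<Sum>b\<in>Basis. ?A b x))"
    by (simp only: sum_distrib_right)
  also have "\<dots> = (\<Sum>b\<in>Basis. LINT x|lborel. ?A b x)"
    using intA by (intro Bochner_Integration.integral_sum) auto
  finally have "- (LINT x|lborel. conv f (lap \<kappa>) x * ((\<phi> x)\<^sup>2 / V x)) = (\<Sum>b\<in>Basis. - (LINT x|lborel. ?A b x))"
    by (simp add: sum_negf)
  also have "\<dots> \<le> (\<Sum>b\<in>Basis. LINT x|lborel. (pd \<phi> b x)\<^sup>2)"
    by (rule sum_mono) (rule le)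
  also have "\<dots> = (LINT x|lborel. (\<Sum>b\<in>Basis. (pd \<phi> b x)\<^sup>2))"
    using intC by (intro Bochner_Integration.integral_sum[symmetric]) auto
  finally show ?thesis
    unfolding V_def .
qed

text \<open>Picone's identity, applied to a mollification of the positive solution \<open>f\<close>.\<close>

lemma rayleigh_lower_bound:
  fixes f \<phi> :: "'a::euclidean_space \<Rightarrow> real"
  assumes f: "f \<in> borel_measurable borel" "integrable lborel f" and "open \<Omega>"
    and nonneg: "AE x in lborel. 0 \<le> f x" and pos: "AE x in lborel. x \<in> \<Omega> \<longrightarrow> 0 < f x"
    and sol: "\<And>\<psi>. test_function \<Omega> \<psi> \<Longrightarrow>
      (LINT x|lborel. f x * lap \<psi> x) = - \<mu> * (LINT x|lborel. f x * \<psi> x)"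
    and "\<mu> \<ge> 0" and \<phi>: "test_function \<Omega> \<phi>"
  shows "\<mu> * (LINT x|lborel. (\<phi> x)\<^sup>2) \<le> (LINT x|lborel. (\<Sum>b\<in>Basis. (pd \<phi> b x)\<^sup>2))" (is "\<mu> * ?A \<le> ?B")
proof -
  obtain K where K: "smooth \<phi>" "compact K" "K \<subseteq> \<Omega>" "\<And>x. x \<notin> K \<Longrightarrow> \<phi> x = 0"
    using \<phi> by (rule test_functionE) blast
  obtain e where e: "e > 0" "(\<Union>x\<in>K. cball x e) \<subseteq> \<Omega>"
    using compact_subset_open_imp_cball_epsilon_subset[OF K(2) \<open>open \<Omega>\<close> K(3)] by metis
  define s where "s = 1 / e"
  have s: "s > 0" "1 / s = e"
    using e(1) by (simp_all add: s_def)
  define \<kappa> where "\<kappa> = bump bp0 s (0::'a)"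
  have \<kappa>: "test_function UNIV \<kappa>"
    unfolding \<kappa>_def using s(1) by (intro test_function_bump) auto
  have sym: "\<kappa> (x - y) = bump bp0 s x y" "lap \<kappa> (x - y) = lap (bump bp0 s x) y" for x y
    unfolding \<kappa>_def lap_bump
    by (simp_all add: bump_def inner_diff_left inner_diff_right inner_commute algebra_simps)
  define U where "U = conv f \<kappa>"
  have U0: "U x \<ge> 0" for x
    unfolding U_def conv_def sym using nonneg
    by (intro integral_nonneg_AE) (auto elim!: eventually_mono intro!: mult_nonneg_nonneg bump_bp0_nonneg)
  have Upos: "U x > 0" if "x \<in> K" for x
  proof (rule ccontr)
    assume "\<not> U x > 0"
    then have "U x = 0"
      using U0[of x] by simp
    moreover have "AE y in lborel. 0 \<le> f y * \<kappa> (x - y)"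
      unfolding sym using nonneg by (auto elim!: eventually_mono intro!: mult_nonneg_nonneg bump_bp0_nonneg)
    ultimately have "AE y in lborel. f y * \<kappa> (x - y) = 0"
      unfolding U_def conv_def using integral_nonneg_eq_0_iff_AE conv_integrable[OF f(2) \<kappa>] by blast
    then have "AE y in lborel. y \<notin> ball x e"
      using pos
    proof eventually_elim
      fix y assume "f y * \<kappa> (x - y) = 0" "y \<in> \<Omega> \<longrightarrow> 0 < f y"
      moreover have "y \<in> \<Omega>" if "y \<in> ball x e"
        using that e(2) \<open>x \<in> K\<close> by (auto simp: subset_eq less_imp_le)
      moreover have "\<kappa> (x - y) > 0" if "y \<in> ball x e"
        unfolding sym using that s by (intro bump_bp0_pos) auto
      ultimately show "y \<notin> ball x e"
        by force
    qed
    then show False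
      using AE_lborel_open_empty[of "ball x e"] e(1) by simp
  qed
  have cU: "continuous_on UNIV U"
    unfolding U_def by (rule conv_continuous[OF f(2) \<kappa>])
  obtain m where m: "m > 0" "\<And>x. x \<in> K \<Longrightarrow> m \<le> U x"
  proof (cases "K = {}")
    case False
    then obtain z where "z \<in> K" "\<And>x. x \<in> K \<Longrightarrow> U z \<le> U x"
      using continuous_attains_inf[OF K(2) False continuous_on_subset[OF cU]] by auto
    then show thesis
      using that Upos by blast
  qed (use that[of 1] in simp)
  have c\<phi>: "continuous_on UNIV \<phi>"
    by (rule smooth_continuous[OF K(1)])
  have lapU: "conv f (lap \<kappa>) x = - \<mu> * U x" if "x \<in> K" for x
  proof -
    have "cball x (1 / s) \<subseteq> \<Omega>"
      using e(2) that s(2) by auto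
    from sol[OF test_function_bump[OF s(1) this]] show ?thesis
      unfolding U_def conv_def sym .
  qed
  have main: "\<mu> * ?A * m \<le> ?B * (m + c)" if "c > 0" for c
  proof -
    have Uc: "U x + c > 0" for x
      using U0[of x] that by simp
    then have Une: "U x + c \<noteq> 0" for x
      by (metis less_irrefl)
    have "\<mu> * (m / (m + c) * (LINT x|lborel. (\<phi> x)\<^sup>2)) = (LINT x|lborel. \<mu> * (m / (m + c) * (\<phi> x)\<^sup>2))"
      by simp
    also have "\<dots> \<le> (LINT x|lborel. \<mu> * (U x * ((\<phi> x)\<^sup>2 / (U x + c))))"
    proof (rule integral_mono)
      show "integrable lborel (\<lambda>x. \<mu> * (m / (m + c) * (\<phi> x)\<^sup>2))"
        using c\<phi> K(4) by (intro integrable_continuous_compact[OF _ K(2)] continuous_intros) auto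
      show "integrable lborel (\<lambda>x. \<mu> * (U x * ((\<phi> x)\<^sup>2 / (U x + c))))"
        using c\<phi> cU K(4) Une by (intro integrable_continuous_compact[OF _ K(2)] continuous_intros) auto
      show "\<mu> * (m / (m + c) * (\<phi> x)\<^sup>2) \<le> \<mu> * (U x * ((\<phi> x)\<^sup>2 / (U x + c)))" for x
      proof (cases "x \<in> K")
        case True
        then have "m / (m + c) \<le> U x / (U x + c)"
          using m that Uc[of x] by (simp add: frac_le_eq divide_le_0_iff field_simps)
        then have "m / (m + c) * (\<phi> x)\<^sup>2 \<le> U x / (U x + c) * (\<phi> x)\<^sup>2"
          by (rule mult_right_mono) simp
        then have "\<mu> * (m / (m + c) * (\<phi> x)\<^sup>2) \<le> \<mu> * (U x / (U x + c) * (\<phi> x)\<^sup>2)"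
          by (rule mult_left_mono[OF _ \<open>\<mu> \<ge> 0\<close>])
        then show ?thesis
          by simp
      qed (simp add: K(4))
    qed
    also have "\<dots> = - (LINT x|lborel. conv f (lap \<kappa>) x * ((\<phi> x)\<^sup>2 / (conv f \<kappa> x + c)))"
    proof -
      have eq: "conv f (lap \<kappa>) x * ((\<phi> x)\<^sup>2 / (conv f \<kappa> x + c)) = - (\<mu> * (U x * ((\<phi> x)\<^sup>2 / (U x + c))))" for x
        using lapU[of x] K(4)[of x] by (cases "x \<in> K") (simp_all add: U_def)
      show ?thesis
        unfolding eq by simp
    qed
    also have "\<dots> \<le> ?B"
      using U0 that unfolding U_def by (intro picone_regularized[OF f(2) \<kappa> \<phi>])
    finally show ?thesis
      using m(1) that by (simp add: field_simps)
  qed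
  have "\<mu> * ?A * m \<le> ?B * m + \<epsilon>" if "\<epsilon> > 0" for \<epsilon>
  proof -
    have B0: "?B \<ge> 0"
      by (intro integral_nonneg_AE always_eventually allI sum_nonneg) simp
    define c where "c = \<epsilon> / (?B + 1)"
    have "c > 0" "?B * c \<le> \<epsilon>"
      using that B0 by (simp_all add: c_def field_simps add_nonneg_pos)
    then show ?thesis
      using main[of c] by (simp add: distrib_left)
  qed
  then have "\<mu> * ?A * m \<le> ?B * m"
    by (rule field_le_epsilon)
  then show ?thesis
    using m(1) by simp
qed

section \<open>Simplicity of the first eigenvalue\<close>

context bounded_open
begin

lemma AE_dom_iff: "(AE x in M. P x) \<longleftrightarrow> (AE x in lborel. x \<in> \<Omega> \<longrightarrow> P x)"
  using dom_sets by (simp add: AE_restrict_space_iff AE_completion_iff)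

lemma ip_lap:
  assumes u: "u \<in> H1 \<Omega>" and v: "test_function \<Omega> v"
  shows "ip u (lap v) = - ip (wgrad \<Omega> u) (grad v)"
proof -
  have pdL: "pd v b \<in> L2 \<Omega>" "pd (pd v b) b \<in> L2 \<Omega>" if "b \<in> Basis" for b
    using v that by (auto intro: test_L2 test_function_pd)
  have "ip u (lap v) = (\<Sum>b\<in>Basis. ip u (pd (pd v b) b))"
    unfolding ip_def lap_def inner_sum_right
    by (intro Bochner_Integration.integral_sum ip_integrable H1_L2[OF u] pdL)
  also have "\<dots> = (\<Sum>b\<in>Basis. - ip (\<lambda>x. wgrad \<Omega> u x \<bullet> b) (pd v b))"
    by (intro sum.cong refl is_weak_gradientD[OF wgrad_spec(2)[OF u]] test_function_pd[OF v])
  also have "\<dots> = - (\<Sum>b\<in>Basis. ip (\<lambda>x. wgrad \<Omega> u x \<bullet> b) (pd v b))"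
    by (rule sum_negf)
  also have "(\<Sum>b\<in>Basis. ip (\<lambda>x. wgrad \<Omega> u x \<bullet> b) (pd v b))
      = (LINT x|M. (\<Sum>b\<in>Basis. (wgrad \<Omega> u x \<bullet> b) \<bullet> pd v b x))"
    unfolding ip_def
    by (intro Bochner_Integration.integral_sum[symmetric] ip_integrable L2_inner wgrad_spec(1)[OF u] pdL)
  also have "\<dots> = ip (wgrad \<Omega> u) (grad v)"
    unfolding ip_def grad_def inner_sum_right by (simp add: mult.commute)
  finally show ?thesis .
qed

definition dsol :: "real \<Rightarrow> ('a \<Rightarrow> real) \<Rightarrow> bool" where
  "dsol \<mu> p \<longleftrightarrow> p \<in> L2 \<Omega> \<and> (\<forall>v. test_function \<Omega> v \<longrightarrow> ip p (lap v) = - \<mu> * ip p v)"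

lemma lap_L2:
  assumes "test_function \<Omega> v"
  shows "lap v \<in> L2 \<Omega>"
  unfolding lap_def[abs_def] using assms by (intro L2_sum test_L2 test_function_pd) auto

lemma dsol_add: "dsol \<mu> p \<Longrightarrow> dsol \<mu> q \<Longrightarrow> dsol \<mu> (\<lambda>x. p x + q x)"
  by (simp add: dsol_def L2_add ip_add_left test_L2 lap_L2 algebra_simps)

lemma dsol_cmult: "dsol \<mu> p \<Longrightarrow> dsol \<mu> (\<lambda>x. c * p x)"
  by (simp add: dsol_def L2_cmult ip_cmult_left)

lemma dsol_borel_rep:
  assumes "dsol \<mu> p" "AE x in M. 0 \<le> p x"
  obtains f where "f \<in> borel_measurable borel" "integrable lborel f" "integrable lborel (\<lambda>x. (f x)\<^sup>2)"
    "AE x in M. f x = p x" "AE x in lborel. 0 \<le> f x"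
    "\<And>\<psi>. test_function \<Omega> \<psi> \<Longrightarrow> (LINT x|lborel. f x * lap \<psi> x) = - \<mu> * (LINT x|lborel. f x * \<psi> x)"
proof -
  have p: "p \<in> L2 \<Omega>"
    using assms(1) by (simp add: dsol_def)
  obtain f where f: "f \<in> borel_measurable borel" "integrable lborel f" "integrable lborel (\<lambda>x. (f x)\<^sup>2)"
    "AE x in M. f x = p x" "\<And>x. x \<notin> \<Omega> \<Longrightarrow> f x = 0"
    using L2_borel_rep[OF p] by blast
  have "AE x in M. 0 \<le> f x"
    using f(4) assms(2) by eventually_elim simp
  then have nonneg: "AE x in lborel. 0 \<le> f x"
    unfolding AE_dom_iff using f(5) by (auto elim!: eventually_mono)
  have "(LINT x|lborel. f x * lap \<psi> x) = - \<mu> * (LINT x|lborel. f x * \<psi> x)" if \<psi>: "test_function \<Omega> \<psi>" for \<psi>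
  proof -
    have "ip p (lap \<psi>) = - \<mu> * ip p \<psi>"
      using assms(1) \<psi> by (simp add: dsol_def)
    then show ?thesis
      using integral_rep[OF p f(1,4,5) lap_measurable(1)[OF test_smooth[OF \<psi>]]]
        integral_rep[OF p f(1,4,5) test_borel[OF \<psi>]]
      by (simp add: ip_def)
  qed
  then show thesis
    using that f nonneg by blast
qed

lemma dsol_positive:
  assumes p: "dsol \<mu> p" and "\<mu> \<ge> 0" and nonneg: "AE x in M. 0 \<le> p x" and "connected \<Omega>"
  shows "(AE x in M. p x = 0) \<or> (AE x in M. 0 < p x)"
proof -
  obtain f where f: "f \<in> borel_measurable borel" "integrable lborel f" "integrable lborel (\<lambda>x. (f x)\<^sup>2)"
    "AE x in M. f x = p x" "AE x in lborel. 0 \<le> f x"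
    "\<And>\<psi>. test_function \<Omega> \<psi> \<Longrightarrow> (LINT x|lborel. f x * lap \<psi> x) = - \<mu> * (LINT x|lborel. f x * \<psi> x)"
    using dsol_borel_rep[OF p nonneg] by blast
  have "superharmonic \<Omega> f"
    unfolding superharmonic_def
  proof (intro allI impI)
    fix \<phi> assume \<phi>: "test_function \<Omega> \<phi>" "\<forall>x. 0 \<le> \<phi> x"
    have "0 \<le> (LINT x|lborel. f x * \<phi> x)"
      using f(5) \<phi>(2) by (intro integral_nonneg_AE) (auto elim!: eventually_mono)
    then show "(LINT x|lborel. f x * lap \<phi> x) \<le> 0"
      unfolding f(6)[OF \<phi>(1)] using \<open>\<mu> \<ge> 0\<close> by simp
  qed
  from strong_maximum_principle[OF f(1-3) open_dom \<open>connected \<Omega>\<close> this f(5)]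
  have "(AE x in M. f x = 0) \<or> (AE x in M. 0 < f x)"
    unfolding AE_dom_iff .
  then show ?thesis
  proof
    assume "AE x in M. f x = 0"
    with f(4) have "AE x in M. p x = 0" by eventually_elim simp
    then show ?thesis ..
  next
    assume "AE x in M. 0 < f x"
    with f(4) have "AE x in M. 0 < p x" by eventually_elim simp
    then show ?thesis ..
  qed
qed

lemma dsol_rayleigh:
  assumes p: "dsol \<mu> p" and "\<mu> \<ge> 0" and pos: "AE x in M. 0 < p x" and \<phi>: "test_function \<Omega> \<phi>"
  shows "\<mu> * ip \<phi> \<phi> \<le> ip (grad \<phi>) (grad \<phi>)"
proof -
  have nonneg: "AE x in M. 0 \<le> p x"
    using pos by (auto elim!: eventually_mono)
  obtain f where f: "f \<in> borel_measurable borel" "integrable lborel f" "integrable lborel (\<lambda>x. (f x)\<^sup>2)"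
    "AE x in M. f x = p x" "AE x in lborel. 0 \<le> f x"
    "\<And>\<psi>. test_function \<Omega> \<psi> \<Longrightarrow> (LINT x|lborel. f x * lap \<psi> x) = - \<mu> * (LINT x|lborel. f x * \<psi> x)"
    using dsol_borel_rep[OF p nonneg] by blast
  have "AE x in M. 0 < f x"
    using f(4) pos by eventually_elim simp
  then have "AE x in lborel. x \<in> \<Omega> \<longrightarrow> 0 < f x"
    unfolding AE_dom_iff .
  from rayleigh_lower_bound[OF f(1,2) open_dom f(5) this f(6) \<open>\<mu> \<ge> 0\<close> \<phi>]
  have "\<mu> * (LINT x|lborel. (\<phi> x)\<^sup>2) \<le> (LINT x|lborel. (\<Sum>b\<in>Basis. (pd \<phi> b x)\<^sup>2))" .
  moreover have "ip \<phi> \<phi> = (LINT x|lborel. (\<phi> x)\<^sup>2)"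
    unfolding ip_self using test_borel[OF \<phi>] test_outside[OF \<phi>]
    by (subst integral_dom_eq_lborel) auto
  moreover have "ip (grad \<phi>) (grad \<phi>) = (LINT x|lborel. (\<Sum>b\<in>Basis. (pd \<phi> b x)\<^sup>2))"
  proof -
    have eq: "grad \<phi> x \<bullet> grad \<phi> x = (\<Sum>b\<in>Basis. (pd \<phi> b x)\<^sup>2)" for x
      by (subst euclidean_inner) (simp add: grad_inner power2_eq_square)
    have "(\<lambda>x. \<Sum>b\<in>Basis. (pd \<phi> b x)\<^sup>2) \<in> borel_measurable borel"
      using test_borel[OF test_function_pd[OF \<phi>]] by (intro borel_measurable_sum borel_measurable_power) auto
    then show ?thesis
      unfolding ip_def eq using test_outside[OF test_function_pd[OF \<phi>]]
      by (intro integral_dom_eq_lborel) (auto intro!: sum.neutral)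
  qed
  ultimately show ?thesis
    by simp
qed

lemma L2_convergence:
  fixes f :: "'a \<Rightarrow> 'b::euclidean_space"
  assumes f: "f \<in> L2 \<Omega>" and F: "\<And>n::nat. F n \<in> L2 \<Omega>"
    and lim: "(\<lambda>n. ip (\<lambda>x. F n x - f x) (\<lambda>x. F n x - f x)) \<longlonglongrightarrow> 0"
  shows "g \<in> L2 \<Omega> \<Longrightarrow> (\<lambda>n. ip (F n) g) \<longlonglongrightarrow> ip f g" and "(\<lambda>n. ip (F n) (F n)) \<longlonglongrightarrow> ip f f"
proof -
  let ?d = "\<lambda>n x. F n x - f x"
  have d: "?d n \<in> L2 \<Omega>" for n
    by (rule L2_diff[OF F f])
  have sq: "(\<lambda>n. sqrt (ip (?d n) (?d n))) \<longlonglongrightarrow> 0"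
    using tendsto_real_sqrt[OF lim] by simp
  have *: "(\<lambda>n. ip (F n) g) \<longlonglongrightarrow> ip f g" if g: "g \<in> L2 \<Omega>" for g
  proof -
    have "(\<lambda>n. ip (?d n) g) \<longlonglongrightarrow> 0"
    proof (rule Lim_null_comparison)
      show "\<forall>\<^sub>F n in sequentially. norm (ip (?d n) g) \<le> sqrt (ip (?d n) (?d n)) * sqrt (ip g g)"
        using ip_Cauchy_Schwarz[OF d g] by (intro always_eventually) simp
      show "(\<lambda>n. sqrt (ip (?d n) (?d n)) * sqrt (ip g g)) \<longlonglongrightarrow> 0"
        using tendsto_mult[OF sq tendsto_const[of "sqrt (ip g g)"]] by simp
    qed
    then have "(\<lambda>n. ip (?d n) g + ip f g) \<longlonglongrightarrow> 0 + ip f g"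
      by (intro tendsto_add tendsto_const)
    then show ?thesis
      by (simp add: ip_diff_left[OF F f g])
  qed
  then show "g \<in> L2 \<Omega> \<Longrightarrow> (\<lambda>n. ip (F n) g) \<longlonglongrightarrow> ip f g" .
  have "(\<lambda>n. ip (?d n) (?d n) + 2 * ip (F n) f - ip f f) \<longlonglongrightarrow> 0 + 2 * ip f f - ip f f"
    by (intro tendsto_add tendsto_diff tendsto_mult tendsto_const lim *[OF f])
  moreover have "ip (?d n) (?d n) + 2 * ip (F n) f - ip f f = ip (F n) (F n)" for n
    using ip_diff_left[OF F f d] ip_diff_left[OF F f F] ip_diff_left[OF F f f]
    by (simp add: ip_commute[of "F n" "?d n"] ip_commute[of f "?d n"] ip_commute[of f "F n"])
  ultimately show "(\<lambda>n. ip (F n) (F n)) \<longlonglongrightarrow> ip f f"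
    by simp
qed

lemma grad_diff_scale:
  assumes "smooth \<phi>" "smooth \<psi>"
  shows "grad (\<lambda>x. \<phi> x - t * \<psi> x) = (\<lambda>x. grad \<phi> x - t *\<^sub>R grad \<psi> x)"
proof
  fix x
  have "((\<lambda>x. \<phi> x - t * \<psi> x) has_derivative
      (\<lambda>h. frechet_derivative \<phi> (at x) h - t * frechet_derivative \<psi> (at x) h)) (at x)"
    by (intro has_derivative_diff has_derivative_mult_right smooth_has_derivative assms)
  from frechet_derivative_eqI[OF this]
  show "grad (\<lambda>x. \<phi> x - t * \<psi> x) x = grad \<phi> x - t *\<^sub>R grad \<psi> x"
    by (simp add: grad_def scaleR_diff_left sum_subtractf scaleR_sum_right)
qed

lemma soft_abs_L2_approx:
  assumes "f \<in> L2 \<Omega>" "g \<in> L2 \<Omega>" "d > 0" "(\<lambda>x. soft_abs d (g x)) \<in> L2 \<Omega>"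
  shows "ip (\<lambda>x. soft_abs d (g x) - \<bar>f x\<bar>) (\<lambda>x. soft_abs d (g x) - \<bar>f x\<bar>)
    \<le> 2 * d\<^sup>2 * measure M \<Omega> + 2 * ip (\<lambda>x. g x - f x) (\<lambda>x. g x - f x)"
proof -
  have fin: "integrable M (\<lambda>x. 2 * d\<^sup>2 :: real)"
    using finite_measure.integrable_const[OF finite_measure_dom] by auto
  have gf: "(\<lambda>x. g x - f x) \<in> L2 \<Omega>"
    by (rule L2_diff[OF assms(2,1)])
  have abs: "(\<lambda>x. \<bar>f x\<bar>) \<in> L2 \<Omega>"
    using L2D(1)[OF assms(1)] by (intro L2_bounded[OF assms(1), where C = 1]) auto
  have sf: "(\<lambda>x. soft_abs d (g x) - \<bar>f x\<bar>) \<in> L2 \<Omega>"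
    by (rule L2_diff[OF assms(4) abs])
  have "ip (\<lambda>x. soft_abs d (g x) - \<bar>f x\<bar>) (\<lambda>x. soft_abs d (g x) - \<bar>f x\<bar>)
      \<le> (LINT x|M. 2 * d\<^sup>2 + 2 * (norm (g x - f x))\<^sup>2)"
    unfolding ip_self
  proof (rule integral_mono)
    fix x
    have "\<bar>soft_abs d (g x) - \<bar>f x\<bar>\<bar> \<le> d + \<bar>g x - f x\<bar>"
      using soft_abs_approx[OF \<open>d > 0\<close>, of "g x"] by linarith
    then have "\<bar>soft_abs d (g x) - \<bar>f x\<bar>\<bar>\<^sup>2 \<le> (d + \<bar>g x - f x\<bar>)\<^sup>2"
      by (intro power_mono) auto
    also have "\<dots> \<le> 2 * d\<^sup>2 + 2 * \<bar>g x - f x\<bar>\<^sup>2"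
      using sum_squares_bound[of d "\<bar>g x - f x\<bar>"] by (simp add: power2_sum)
    finally show "(norm (soft_abs d (g x) - \<bar>f x\<bar>))\<^sup>2 \<le> 2 * d\<^sup>2 + 2 * (norm (g x - f x))\<^sup>2"
      by simp
  qed (use L2D(2)[OF sf] L2D(2)[OF gf] fin in auto)
  also have "\<dots> = (LINT x|M. 2 * d\<^sup>2) + (LINT x|M. 2 * (norm (g x - f x))\<^sup>2)"
    using L2D(2)[OF gf] fin by (intro Bochner_Integration.integral_add) auto
  also have "\<dots> = 2 * d\<^sup>2 * measure M \<Omega> + 2 * ip (\<lambda>x. g x - f x) (\<lambda>x. g x - f x)"
    unfolding ip_self by simp
  finally show ?thesis .
qed

text \<open>The truncations \<open>soft_abs d \<phi>\<close> of approximating test functions form a minimizing sequence for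
  the nonnegative form \<open>Q\<close>, so \<open>|w|\<close> is again a solution; that \<open>|w|\<close> belongs to \<open>H10\<close> is never needed.\<close>

lemma dsol_abs:
  assumes w: "w \<in> H10 \<Omega>" and eig: "ip (wgrad \<Omega> w) (wgrad \<Omega> w) = \<mu> * ip w w" and "\<mu> \<ge> 0"
    and ray: "\<And>\<phi>. test_function \<Omega> \<phi> \<Longrightarrow> \<mu> * ip \<phi> \<phi> \<le> ip (grad \<phi>) (grad \<phi>)"
  shows "dsol \<mu> (\<lambda>x. \<bar>w x\<bar>)"
proof -
  obtain \<phi> where \<phi>: "\<And>n::nat. test_function \<Omega> (\<phi> n)" "(\<lambda>n. H1_norm \<Omega> (\<lambda>x. w x - \<phi> n x)) \<longlonglongrightarrow> 0"
    using H10E[OF w] by blast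
  define d where "d = (\<lambda>n. 1 / real (Suc n))"
  have d: "d n > 0" for n
    by (simp add: d_def)
  have dlim: "d \<longlonglongrightarrow> 0"
    unfolding d_def by (rule LIMSEQ_Suc[OF lim_1_over_n[where 'a = real]])
  define \<psi> where "\<psi> = (\<lambda>n x. soft_abs (d n) (\<phi> n x))"
  have \<psi>: "test_function \<Omega> (\<psi> n)" for n
    unfolding \<psi>_def by (rule test_function_soft_abs[OF \<phi>(1) d])
  have wL: "w \<in> L2 \<Omega>" and wH: "w \<in> H1 \<Omega>"
    using w by (auto intro: H10_L2 H10_H1)
  have absL: "(\<lambda>x. \<bar>w x\<bar>) \<in> L2 \<Omega>"
    using L2D(1)[OF wL] by (intro L2_bounded[OF wL, where C = 1]) auto
  have dn: "(\<lambda>x. w x - \<phi> n x) \<in> H1 \<Omega>" for n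
    by (rule H1_diff[OF wH test_H1(1)[OF \<phi>(1)]])
  have sq: "(\<lambda>n. (H1_norm \<Omega> (\<lambda>x. w x - \<phi> n x))\<^sup>2) \<longlonglongrightarrow> 0"
    using tendsto_power[OF \<phi>(2), of 2] by simp
  have limphi: "(\<lambda>n. ip (\<lambda>x. \<phi> n x - w x) (\<lambda>x. \<phi> n x - w x)) \<longlonglongrightarrow> 0"
  proof (rule Lim_null_comparison[OF always_eventually sq], rule allI)
    fix n
    have "ip (\<lambda>x. \<phi> n x - w x) (\<lambda>x. \<phi> n x - w x) = ip (\<lambda>x. w x - \<phi> n x) (\<lambda>x. w x - \<phi> n x)"
      unfolding ip_self by (simp add: power2_commute)
    then show "norm (ip (\<lambda>x. \<phi> n x - w x) (\<lambda>x. \<phi> n x - w x)) \<le> (H1_norm \<Omega> (\<lambda>x. w x - \<phi> n x))\<^sup>2"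
      using ip_le_H1_norm(1)[of "\<lambda>x. w x - \<phi> n x"] ip_self_nonneg[of "\<lambda>x. w x - \<phi> n x"] by simp
  qed
  have limgrad: "(\<lambda>n. ip (\<lambda>x. grad (\<phi> n) x - wgrad \<Omega> w x) (\<lambda>x. grad (\<phi> n) x - wgrad \<Omega> w x)) \<longlonglongrightarrow> 0"
  proof (rule Lim_null_comparison[OF always_eventually sq], rule allI)
    fix n
    let ?w = "wgrad \<Omega> (\<lambda>x. w x - \<phi> n x)" and ?g = "\<lambda>x. wgrad \<Omega> w x - grad (\<phi> n) x"
    have gL: "?g \<in> L2 \<Omega>"
      by (rule L2_diff[OF wgrad_spec(1)[OF wH] test_H1(3)[OF \<phi>(1)]])
    have e: "ip ?w V = ip ?g V" if "V \<in> L2 \<Omega>" for V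
      using gip_diff[OF wH test_H1(1)[OF \<phi>(1)] that] gip_test[OF \<phi>(1) that]
        ip_diff_left[OF wgrad_spec(1)[OF wH] test_H1(3)[OF \<phi>(1)] that]
      by (simp add: gip_def)
    have "ip ?w ?w = ip ?g ?g"
      using e[OF wgrad_spec(1)[OF dn]] e[OF gL] ip_commute[of ?w ?g] by simp
    moreover have "ip (\<lambda>x. grad (\<phi> n) x - wgrad \<Omega> w x) (\<lambda>x. grad (\<phi> n) x - wgrad \<Omega> w x) = ip ?g ?g"
      unfolding ip_self by (simp add: norm_minus_commute)
    ultimately show "norm (ip (\<lambda>x. grad (\<phi> n) x - wgrad \<Omega> w x) (\<lambda>x. grad (\<phi> n) x - wgrad \<Omega> w x))
        \<le> (H1_norm \<Omega> (\<lambda>x. w x - \<phi> n x))\<^sup>2"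
      using ip_le_H1_norm(2)[of "\<lambda>x. w x - \<phi> n x"] ip_self_nonneg[of ?g] by simp
  qed
  have limpsi: "(\<lambda>n. ip (\<lambda>x. \<psi> n x - \<bar>w x\<bar>) (\<lambda>x. \<psi> n x - \<bar>w x\<bar>)) \<longlonglongrightarrow> 0"
  proof (rule Lim_null_comparison[OF always_eventually], rule allI)
    show "norm (ip (\<lambda>x. \<psi> n x - \<bar>w x\<bar>) (\<lambda>x. \<psi> n x - \<bar>w x\<bar>))
        \<le> 2 * (d n)\<^sup>2 * measure M \<Omega> + 2 * ip (\<lambda>x. \<phi> n x - w x) (\<lambda>x. \<phi> n x - w x)" for n
      using soft_abs_L2_approx[OF wL test_L2[OF \<phi>(1)] d, of n n] test_L2[OF \<psi>, of n]
        ip_self_nonneg[of "\<lambda>x. \<psi> n x - \<bar>w x\<bar>"]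
      by (simp add: \<psi>_def)
    have "(\<lambda>n. 2 * (d n)\<^sup>2 * measure M \<Omega> + 2 * ip (\<lambda>x. \<phi> n x - w x) (\<lambda>x. \<phi> n x - w x))
        \<longlonglongrightarrow> 2 * 0\<^sup>2 * measure M \<Omega> + 2 * 0"
      by (intro tendsto_add tendsto_mult tendsto_const tendsto_power dlim limphi)
    then show "(\<lambda>n. 2 * (d n)\<^sup>2 * measure M \<Omega> + 2 * ip (\<lambda>x. \<phi> n x - w x) (\<lambda>x. \<phi> n x - w x)) \<longlonglongrightarrow> 0"
      by simp
  qed
  note conv_psi = L2_convergence[OF absL test_L2[OF \<psi>] limpsi]
  define Q where "Q = (\<lambda>n. ip (grad (\<psi> n)) (grad (\<psi> n)) - \<mu> * ip (\<psi> n) (\<psi> n))"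
  have Q0: "Q n \<ge> 0" for n
    using ray[OF \<psi>] by (simp add: Q_def)
  have "Q \<longlonglongrightarrow> 0"
  proof (rule tendsto_sandwich[OF always_eventually always_eventually tendsto_const])
    show "\<forall>n. 0 \<le> Q n"
      using Q0 by simp
    show "\<forall>n. Q n \<le> ip (grad (\<phi> n)) (grad (\<phi> n)) - \<mu> * ip (\<psi> n) (\<psi> n)"
    proof
      fix n
      have le: "(norm (grad (\<psi> n) x))\<^sup>2 \<le> (norm (grad (\<phi> n) x))\<^sup>2" for x
      proof -
        have eq: "(norm (grad f x))\<^sup>2 = (\<Sum>b\<in>Basis. (pd f b x)\<^sup>2)" for f
          unfolding power2_norm_eq_inner by (subst euclidean_inner) (simp add: grad_inner power2_eq_square)
        show ?thesis
          unfolding eq \<psi>_def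
          by (intro sum_mono abs_le_square_iff[THEN iffD1] pd_soft_abs_le test_smooth[OF \<phi>(1)] d)
      qed
      have "ip (grad (\<psi> n)) (grad (\<psi> n)) \<le> ip (grad (\<phi> n)) (grad (\<phi> n))"
        unfolding ip_self
        by (intro integral_mono le L2D(2) test_H1(3) \<phi>(1) \<psi>)
      then show "Q n \<le> ip (grad (\<phi> n)) (grad (\<phi> n)) - \<mu> * ip (\<psi> n) (\<psi> n)"
        by (simp add: Q_def)
    qed
    have "(\<lambda>n. ip (grad (\<phi> n)) (grad (\<phi> n)) - \<mu> * ip (\<psi> n) (\<psi> n))
        \<longlonglongrightarrow> ip (wgrad \<Omega> w) (wgrad \<Omega> w) - \<mu> * ip (\<lambda>x. \<bar>w x\<bar>) (\<lambda>x. \<bar>w x\<bar>)"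
      by (intro tendsto_diff tendsto_mult tendsto_const conv_psi(2)
          L2_convergence(2)[OF wgrad_spec(1)[OF wH] test_H1(3)[OF \<phi>(1)] limgrad])
    moreover have "ip (\<lambda>x. \<bar>w x\<bar>) (\<lambda>x. \<bar>w x\<bar>) = ip w w"
      by (simp add: ip_self)
    ultimately show "(\<lambda>n. ip (grad (\<phi> n)) (grad (\<phi> n)) - \<mu> * ip (\<psi> n) (\<psi> n)) \<longlonglongrightarrow> 0"
      using eig by simp
  qed
  have "ip (\<lambda>x. \<bar>w x\<bar>) (lap v) = - \<mu> * ip (\<lambda>x. \<bar>w x\<bar>) v" if v: "test_function \<Omega> v" for v
  proof -
    let ?Qv = "ip (grad v) (grad v) - \<mu> * ip v v"
    define R where "R = (\<lambda>n. ip (grad (\<psi> n)) (grad v) - \<mu> * ip (\<psi> n) v)"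
    have "(R n)\<^sup>2 \<le> Q n * ?Qv" for n
    proof (rule nonneg_quadratic_imp)
      show "?Qv \<ge> 0"
        using ray[OF v] by simp
      fix t
      let ?z = "\<lambda>x. \<psi> n x - t * v x"
      have z: "test_function \<Omega> ?z"
        using test_function_add[OF \<psi>[of n] test_function_cmult[OF v, of "- t"]] by simp
      note L = test_L2[OF \<psi>[of n]] test_L2[OF v] L2_cmult[OF test_L2[OF v], of t]
      note G = test_H1(3)[OF \<psi>[of n]] test_H1(3)[OF v] L2_scaleR[OF test_H1(3)[OF v], of t]
      have expand: "ip (\<lambda>x. f x - t *\<^sub>R g x) (\<lambda>x. f x - t *\<^sub>R g x) = ip f f - 2 * t * ip f g + t\<^sup>2 * ip g g"
        if fg: "f \<in> L2 \<Omega>" "g \<in> L2 \<Omega>" for f g :: "'a \<Rightarrow> 'c::euclidean_space"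
      proof -
        note tg = L2_scaleR[OF fg(2), of t]
        have "ip (\<lambda>x. f x - t *\<^sub>R g x) h = ip f h - t * ip g h" if "h \<in> L2 \<Omega>" for h
          using ip_diff_left[OF fg(1) tg that] by (simp add: ip_scaleR_left)
        note e = this[OF L2_diff[OF fg(1) tg]] this[OF fg(1)] this[OF fg(2)]
        show ?thesis
          using e ip_commute[of f "\<lambda>x. f x - t *\<^sub>R g x"] ip_commute[of g "\<lambda>x. f x - t *\<^sub>R g x"] ip_commute[of g f]
          by (simp add: power2_eq_square algebra_simps)
      qed
      have "0 \<le> ip (grad ?z) (grad ?z) - \<mu> * ip ?z ?z"
        using ray[OF z] by simp
      also have "\<dots> = Q n - 2 * t * R n + t\<^sup>2 * ?Qv"
        unfolding grad_diff_scale[OF test_smooth[OF \<psi>] test_smooth[OF v]] expand[OF G(1,2)]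
          expand[OF L(1,2), unfolded real_scaleR_def] Q_def R_def
        by (simp add: algebra_simps)
      finally show "0 \<le> Q n - 2 * t * R n + t\<^sup>2 * ?Qv" .
    qed
    then have bd: "norm (R n) \<le> sqrt (Q n * ?Qv)" for n
      using real_sqrt_le_mono[of "(R n)\<^sup>2"] by simp
    have "(\<lambda>n. sqrt (Q n * ?Qv)) \<longlonglongrightarrow> 0"
      using tendsto_real_sqrt[OF tendsto_mult[OF \<open>Q \<longlonglongrightarrow> 0\<close> tendsto_const[of ?Qv]]] by simp
    then have "R \<longlonglongrightarrow> 0"
      by (rule Lim_null_comparison[OF always_eventually[OF allI[OF bd]]])
    moreover have "R n = - ip (\<psi> n) (lap v) - \<mu> * ip (\<psi> n) v" for n
      using ip_lap[OF test_H1(1)[OF \<psi>] v, of n] gip_test[OF \<psi> test_H1(3)[OF v], of n]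
      by (simp add: R_def gip_def)
    then have "R = (\<lambda>n. - ip (\<psi> n) (lap v) - \<mu> * ip (\<psi> n) v)"
      by (rule ext)
    then have "R \<longlonglongrightarrow> - ip (\<lambda>x. \<bar>w x\<bar>) (lap v) - \<mu> * ip (\<lambda>x. \<bar>w x\<bar>) v"
      by (simp only:) (intro tendsto_diff tendsto_minus tendsto_mult tendsto_const conv_psi(1) lap_L2[OF v] test_L2[OF v])
    ultimately have "- ip (\<lambda>x. \<bar>w x\<bar>) (lap v) - \<mu> * ip (\<lambda>x. \<bar>w x\<bar>) v = 0"
      by (metis LIMSEQ_unique)
    then show ?thesis
      by simp
  qed
  then show ?thesis
    using absL by (simp add: dsol_def)
qed

lemma dsol_of_eigen:
  assumes w: "w \<in> H10 \<Omega>" and eig: "\<And>v. v \<in> H10 \<Omega> \<Longrightarrow> ip (wgrad \<Omega> w) (wgrad \<Omega> v) = \<mu> * ip w v"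
  shows "dsol \<mu> w"
proof -
  have "ip w (lap v) = - \<mu> * ip w v" if v: "test_function \<Omega> v" for v
  proof -
    have "ip (wgrad \<Omega> w) (grad v) = ip (wgrad \<Omega> w) (wgrad \<Omega> v)"
      using gip_test[OF v wgrad_spec(1)[OF H10_H1[OF w]]]
      by (simp add: gip_def ip_commute)
    then show ?thesis
      using ip_lap[OF H10_H1[OF w] v] eig[OF test_H10[OF v]] by simp
  qed
  then show ?thesis
    using H10_L2[OF w] by (simp add: dsol_def)
qed

lemma eigen_sign:
  assumes "connected \<Omega>" "\<Omega> \<noteq> {}" "\<mu> \<ge> 0"
    and p: "dsol \<mu> p" "AE x in M. 0 < p x"
    and w: "w \<in> H10 \<Omega>" and eig: "\<And>v. v \<in> H10 \<Omega> \<Longrightarrow> ip (wgrad \<Omega> w) (wgrad \<Omega> v) = \<mu> * ip w v"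
    and orth: "ip w p = 0"
  shows "AE x in M. w x \<le> 0"
proof -
  have "dsol \<mu> (\<lambda>x. \<bar>w x\<bar>)"
    using w eig[OF w] \<open>\<mu> \<ge> 0\<close> dsol_rayleigh[OF p(1) \<open>\<mu> \<ge> 0\<close> p(2)] by (intro dsol_abs)
  then have "dsol \<mu> (\<lambda>x. (1/2) * (\<bar>w x\<bar> + w x))"
    by (intro dsol_cmult dsol_add dsol_of_eigen[OF w eig])
  from dsol_positive[OF this \<open>\<mu> \<ge> 0\<close> _ \<open>connected \<Omega>\<close>]
  consider "AE x in M. (1/2) * (\<bar>w x\<bar> + w x) = 0" | "AE x in M. 0 < (1/2) * (\<bar>w x\<bar> + w x)"
    by (auto simp: abs_if)
  then show ?thesis
  proof cases
    case 1
    then show ?thesis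
      by (rule eventually_mono) (auto simp: abs_if split: if_splits)
  next
    case 2
    then have pos: "AE x in M. 0 < w x * p x"
      using p(2) by eventually_elim (auto simp: abs_if split: if_splits)
    have pL: "p \<in> L2 \<Omega>"
      using p(1) by (simp add: dsol_def)
    have "AE x in M. 0 \<le> w x * p x"
      using pos by (auto elim!: eventually_mono)
    then have "AE x in M. w x * p x = 0"
      using orth ip_integrable[OF H10_L2[OF w] pL] by (simp add: ip_def integral_nonneg_eq_0_iff_AE)
    then have "AE x in M. False"
      using pos by eventually_elim auto
    then have "AE x in lborel. x \<notin> \<Omega>"
      unfolding AE_dom_iff by simp
    then show ?thesis
      using AE_lborel_open_empty[OF open_dom] \<open>\<Omega> \<noteq> {}\<close> by blast
  qed
qed

theorem first_eigenvalue_simple: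
  assumes "connected \<Omega>" "\<Omega> \<noteq> {}" "\<mu> \<ge> 0"
    and p: "dsol \<mu> p" "AE x in M. 0 < p x"
    and w: "w \<in> H10 \<Omega>" and eig: "\<And>v. v \<in> H10 \<Omega> \<Longrightarrow> ip (wgrad \<Omega> w) (wgrad \<Omega> v) = \<mu> * ip w v"
    and orth: "ip w p = 0"
  shows "AE x in M. w x = 0"
proof -
  have "AE x in M. w x \<le> 0"
    by (rule eigen_sign[OF assms])
  moreover have "AE x in M. - 1 * w x \<le> 0"
  proof (rule eigen_sign[OF assms(1-5) H10_cmult[OF w]])
    show "ip (\<lambda>x. - 1 * w x) p = 0"
      using orth ip_cmult_left[of "-1" w p] by simp
    fix v assume v: "v \<in> H10 \<Omega>"
    show "ip (wgrad \<Omega> (\<lambda>x. - 1 * w x)) (wgrad \<Omega> v) = \<mu> * ip (\<lambda>x. - 1 * w x) v"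
      using gip_cmult[OF H10_H1[OF w] wgrad_spec(1)[OF H10_H1[OF v]], of "-1"] eig[OF v] ip_cmult_left[of "-1" w v]
      by (simp add: gip_def)
  qed
  ultimately show ?thesis
    by eventually_elim simp
qed

end

section \<open>Comparison of power series coefficients\<close>

lemma powser_zero_coeff:
  fixes a :: "nat \<Rightarrow> real"
  assumes "r > 0" and zero: "\<And>x. \<bar>x\<bar> < r \<Longrightarrow> (\<lambda>n. a n * x ^ n) sums 0"
  shows "a m = 0"
proof (induction m rule: less_induct)
  case (less m)
  have "((\<lambda>x. 0) \<longlongrightarrow> a (0 + m)) (at (0::real))"
  proof (rule powser_limit_0_strong[OF \<open>r > 0\<close>, where a = "\<lambda>n. a (n + m)"])
    fix x :: real assume x: "x \<noteq> 0" "norm x < r"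
    have "(\<lambda>n. a (n + m) * x ^ (n + m)) sums 0"
      using zero[of x] x less by (subst sums_zero_iff_shift) auto
    then have "(\<lambda>n. (a (n + m) * x ^ (n + m)) / x ^ m) sums (0 / x ^ m)"
      by (rule sums_divide)
    then show "(\<lambda>n. a (n + m) * x ^ n) sums 0"
      using x(1) by (simp add: power_add)
  qed
  then show ?case
    using LIM_unique[OF tendsto_const[of 0 "at (0::real)"]] by (metis add_0 tendsto_const_iff trivial_limit_at)
qed

lemma powser_norm_summable:
  fixes a :: "nat \<Rightarrow> real"
  assumes "r > 0" "\<And>x. \<bar>x\<bar> < r \<Longrightarrow> summable (\<lambda>n. a n * x ^ n)" "\<bar>x\<bar> < r"
  shows "summable (\<lambda>n. norm (a n * x ^ n))"
proof -
  obtain y where y: "\<bar>x\<bar> < y" "y < r"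
    using dense[OF assms(3)] by blast
  then have "summable (\<lambda>n. a n * y ^ n)"
    by (intro assms(2)) auto
  then show ?thesis
    by (rule powser_insidea) (use y in auto)
qed

lemma powser_product:
  fixes l c :: "nat \<Rightarrow> real"
  assumes "r > 0" and l: "\<And>x. \<bar>x\<bar> < r \<Longrightarrow> (\<lambda>i. l i * x ^ i) sums l' x"
    and c: "\<And>x. \<bar>x\<bar> < r \<Longrightarrow> (\<lambda>i. c i * x ^ i) sums c' x" and x: "\<bar>x\<bar> < r"
  shows "(\<lambda>k. (\<Sum>i\<le>k. l i * c (k - i)) * x ^ k) sums (l' x * c' x)"
proof -
  have "(\<lambda>k. \<Sum>i\<le>k. (l i * x ^ i) * (c (k - i) * x ^ (k - i))) sums
      ((\<Sum>i. l i * x ^ i) * (\<Sum>i. c i * x ^ i))"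
    using l c by (intro Cauchy_product_sums powser_norm_summable[OF \<open>r > 0\<close>] x) (auto simp: sums_iff)
  moreover have "(\<Sum>i\<le>k. (l i * x ^ i) * (c (k - i) * x ^ (k - i))) = (\<Sum>i\<le>k. l i * c (k - i)) * x ^ k" for k
    unfolding sum_distrib_right
  proof (rule sum.cong)
    fix i assume "i \<in> {..k}"
    then have "x ^ k = x ^ i * x ^ (k - i)"
      by (simp flip: power_add)
    then show "l i * x ^ i * (c (k - i) * x ^ (k - i)) = l i * c (k - i) * x ^ k"
      by (simp add: mult_ac)
  qed simp
  ultimately show ?thesis
    using l[OF x] c[OF x] by (simp add: sums_iff)
qed

lemma triangle_bij_betw:
  "bij_betw (\<lambda>(k, i). (i, k - i)) (SIGMA k:UNIV. {..k}) (UNIV :: (nat \<times> nat) set)"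
  by (rule bij_betwI[where g = "\<lambda>(i, j). (i + j, i)"]) auto

lemma double_series_triangle:
  fixes g :: "nat \<Rightarrow> nat \<Rightarrow> real"
  assumes bd: "\<And>i j. \<bar>g i j\<bar> \<le> C * q ^ i * q ^ j" and q: "0 \<le> q" "q < 1"
    and inner: "\<And>i. g i sums s i" and outer: "s sums S"
  shows "(\<lambda>k. \<Sum>i\<le>k. g i (k - i)) sums S"
proof -
  let ?G = "\<lambda>(i, j). g i j"
  have geo: "(\<lambda>j. c * q ^ j) summable_on UNIV" for c :: real
    using q by (intro norm_summable_imp_summable_on) (simp add: abs_mult power_abs summable_mult summable_geometric)
  let ?K = "\<lambda>(i, j). C * q ^ i * q ^ j"
  have inf: "(\<Sum>\<^sub>\<infinity>j. norm (?K (i, j))) = (\<bar>C\<bar> * (\<Sum>\<^sub>\<infinity>j. q ^ j)) * q ^ i" for i :: nat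
  proof -
    have "(\<Sum>\<^sub>\<infinity>j. norm (?K (i, j))) = (\<Sum>\<^sub>\<infinity>j. (\<bar>C\<bar> * q ^ i) * q ^ j)"
      using q by (simp add: abs_mult)
    also have "\<dots> = (\<bar>C\<bar> * q ^ i) * (\<Sum>\<^sub>\<infinity>j. q ^ j)"
      by (rule infsum_cmult_right')
    finally show ?thesis
      by (simp add: mult_ac)
  qed
  have "(\<lambda>p. norm (?K p)) summable_on (UNIV \<times> UNIV :: (nat \<times> nat) set)"
  proof (rule Infinite_Sum.abs_summable_on_Sigma_iff[THEN iffD2], intro conjI ballI)
    show "(\<lambda>j. norm (?K (i, j))) summable_on UNIV" for i :: nat
      using geo[of "\<bar>C\<bar> * q ^ i"] q by (simp add: abs_mult)
    show "(\<lambda>i. norm (\<Sum>\<^sub>\<infinity>j. norm (?K (i, j)))) summable_on (UNIV :: nat set)"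
      unfolding inf using geo[of "\<bar>\<bar>C\<bar> * (\<Sum>\<^sub>\<infinity>j. q ^ j)\<bar>"] q by (simp add: abs_mult power_abs)
  qed
  then have "(\<lambda>p. norm (?G p)) summable_on (UNIV \<times> UNIV)"
  proof (rule Infinite_Sum.abs_summable_on_comparison_test)
    show "norm (?G p) \<le> norm (?K p)" for p
      using bd[of "fst p" "snd p"] by (simp add: case_prod_beta)
  qed
  then have sum: "?G summable_on (UNIV \<times> UNIV)"
    by (rule abs_summable_summable)
  have inf_sums: "f sums infsum f UNIV" if "f summable_on UNIV" for f :: "nat \<Rightarrow> real"
    using that by (intro has_sum_imp_sums) simp
  have inner_inf: "(\<Sum>\<^sub>\<infinity>j. g i j) = s i" for i
  proof -
    have "g i summable_on UNIV"
      using summable_on_SigmaD1[OF sum] by simp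
    from sums_unique2[OF inf_sums[OF this] inner] show ?thesis .
  qed
  have "infsum ?G (UNIV \<times> UNIV) = infsum s UNIV" "s summable_on UNIV"
    using infsum_Sigma_banach[OF sum] summable_on_Sigma_banach[of g UNIV "\<lambda>_. UNIV"] sum
    by (simp_all add: inner_inf)
  then have total: "infsum ?G (UNIV \<times> UNIV) = S"
    using inf_sums outer by (metis sums_unique2)
  let ?H = "\<lambda>(k, i). g i (k - i)"
  have H: "?H = (\<lambda>p. ?G ((\<lambda>(k, i). (i, k - i)) p))"
    by (auto simp: fun_eq_iff)
  have sumH: "?H summable_on (SIGMA k:UNIV. {..k})"
    unfolding H using sum summable_on_reindex_bij_betw[OF triangle_bij_betw, of ?G] by simp
  have "infsum ?H (SIGMA k:UNIV. {..k}) = S"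
    unfolding H using total infsum_reindex_bij_betw[OF triangle_bij_betw, of ?G] by simp
  then have "(\<Sum>\<^sub>\<infinity>k. \<Sum>i\<le>k. g i (k - i)) = S"
    using infsum_Sigma_banach[OF sumH] by simp
  moreover have "(\<lambda>k. \<Sum>i\<le>k. g i (k - i)) summable_on UNIV"
    using summable_on_Sigma_banach[OF sumH] by simp
  ultimately show ?thesis
    using inf_sums by metis
qed

context bounded_open
begin

lemma partial_sum_H1:
  assumes "\<And>i. u i \<in> H1 \<Omega>"
  shows "(\<lambda>x. \<Sum>i<n. \<epsilon> ^ i * u i x) \<in> H1 \<Omega>"
  by (induction n) (simp_all add: H1_zero H1_add H1_cmult assms)

lemma bounded_functional_sums:
  assumes add: "\<And>u v. u \<in> H1 \<Omega> \<Longrightarrow> v \<in> H1 \<Omega> \<Longrightarrow> L (\<lambda>x. u x + v x) = L u + L v"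
    and cmult: "\<And>c u. u \<in> H1 \<Omega> \<Longrightarrow> L (\<lambda>x. c * u x) = c * L u"
    and bound: "\<And>u. u \<in> H1 \<Omega> \<Longrightarrow> \<bar>L u\<bar> \<le> H1_norm \<Omega> u * C"
    and u: "\<And>i. u i \<in> H1 \<Omega>" and w: "w \<in> H1 \<Omega>"
    and lim: "(\<lambda>n. H1_norm \<Omega> (\<lambda>x. w x - (\<Sum>i<n. \<epsilon> ^ i * u i x))) \<longlonglongrightarrow> 0"
  shows "(\<lambda>i. L (u i) * \<epsilon> ^ i) sums L w"
proof -
  let ?S = "\<lambda>n x. \<Sum>i<n. \<epsilon> ^ i * u i x"
  have S: "?S n \<in> H1 \<Omega>" for n
    by (rule partial_sum_H1[OF u])
  have LS: "L (?S n) = (\<Sum>i<n. L (u i) * \<epsilon> ^ i)" for n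
  proof (induction n)
    case 0
    show ?case
      using cmult[OF H1_zero, of 0] by simp
  next
    case (Suc n)
    have "L (?S (Suc n)) = L (\<lambda>x. ?S n x + \<epsilon> ^ n * u n x)"
      by simp
    also have "\<dots> = L (?S n) + \<epsilon> ^ n * L (u n)"
      using add[OF S H1_cmult(1)[OF u]] cmult[OF u] by simp
    finally show ?case
      using Suc by (simp add: mult.commute)
  qed
  have diff: "L (\<lambda>x. w x - ?S n x) = L w - L (?S n)" for n
    using add[OF w H1_cmult(1)[OF S, of "-1"]] cmult[OF S, of "-1"] by simp
  have bd: "norm (L w - L (?S n)) \<le> H1_norm \<Omega> (\<lambda>x. w x - ?S n x) * C" for n
    using bound[OF H1_diff[OF w S]] diff by simp
  have "(\<lambda>n. L w - L (?S n)) \<longlonglongrightarrow> 0"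
  proof (rule Lim_null_comparison[OF always_eventually[OF allI[OF bd]]])
    show "(\<lambda>n. H1_norm \<Omega> (\<lambda>x. w x - ?S n x) * C) \<longlonglongrightarrow> 0"
      using tendsto_mult[OF lim tendsto_const[of C]] by simp
  qed
  then have "(\<lambda>n. L w - (L w - L (?S n))) \<longlonglongrightarrow> L w - 0"
    by (intro tendsto_diff tendsto_const)
  then show ?thesis
    by (simp add: sums_def LS)
qed

lemma ip_sums:
  assumes "\<And>i. u i \<in> H1 \<Omega>" "w \<in> H1 \<Omega>" "(\<lambda>n. H1_norm \<Omega> (\<lambda>x. w x - (\<Sum>i<n. \<epsilon> ^ i * u i x))) \<longlonglongrightarrow> 0"
    and v: "v \<in> L2 \<Omega>"
  shows "(\<lambda>i. ip (u i) v * \<epsilon> ^ i) sums ip w v"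
  by (rule bounded_functional_sums[where C = "sqrt (ip v v)", OF _ _ _ assms(1-3)])
     (simp_all add: ip_add_left H1_L2 v ip_cmult_left ip_bound_H1)

lemma gip_sums:
  assumes "\<And>i. u i \<in> H1 \<Omega>" "w \<in> H1 \<Omega>" "(\<lambda>n. H1_norm \<Omega> (\<lambda>x. w x - (\<Sum>i<n. \<epsilon> ^ i * u i x))) \<longlonglongrightarrow> 0"
    and V: "V \<in> L2 \<Omega>"
  shows "(\<lambda>i. gip (u i) V * \<epsilon> ^ i) sums gip w V"
  by (rule bounded_functional_sums[where C = "sqrt (ip V V)", OF _ _ _ assms(1-3)])
     (simp_all add: gip_add V gip_cmult gip_bound_H1)

lemma coefficients_bounded:
  assumes u: "\<And>i. u i \<in> H1 \<Omega>" and w: "w \<in> H1 \<Omega>"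
    and lim: "(\<lambda>n. H1_norm \<Omega> (\<lambda>x. w x - (\<Sum>i<n. \<rho> ^ i * u i x))) \<longlonglongrightarrow> 0" and "\<rho> > 0"
  shows "\<exists>C\<ge>0. \<forall>i. H1_norm \<Omega> (u i) * \<rho> ^ i \<le> C"
proof -
  let ?e = "\<lambda>n. H1_norm \<Omega> (\<lambda>x. w x - (\<Sum>i<n. \<rho> ^ i * u i x))"
  have "Bseq ?e"
    using lim by (intro convergent_imp_Bseq convergentI)
  then obtain C where C: "C > 0" "\<And>n. norm (?e n) \<le> C"
    by (rule BseqE) blast
  have "H1_norm \<Omega> (u i) * \<rho> ^ i \<le> 2 * C" for i
  proof -
    note S = partial_sum_H1[where u = u, OF u]
    have "H1_norm \<Omega> (u i) * \<rho> ^ i = H1_norm \<Omega> (\<lambda>x. \<rho> ^ i * u i x)"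
      using H1_norm_cmult[OF u, of "\<rho> ^ i" i] \<open>\<rho> > 0\<close> by simp
    also have "\<dots> = H1_norm \<Omega> (\<lambda>x. (w x - (\<Sum>j<i. \<rho> ^ j * u j x)) + - 1 * (w x - (\<Sum>j<Suc i. \<rho> ^ j * u j x)))"
      by (simp add: algebra_simps)
    also have "\<dots> \<le> ?e i + H1_norm \<Omega> (\<lambda>x. - 1 * (w x - (\<Sum>j<Suc i. \<rho> ^ j * u j x)))"
      by (rule H1_norm_triangle[OF H1_diff[OF w S] H1_cmult(1)[OF H1_diff[OF w S]]])
    also have "\<dots> = ?e i + ?e (Suc i)"
      by (subst H1_norm_cmult[OF H1_diff[OF w S]]) simp
    also have "\<dots> \<le> 2 * C"
      using C(2)[of i] C(2)[of "Suc i"] by (simp only: real_norm_def abs_le_iff) linarith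
    finally show ?thesis .
  qed
  then show ?thesis
    using C(1) by (intro exI[of _ "2 * C"]) auto
qed

lemma ip_self_sums:
  assumes u: "\<And>i. u i \<in> H1 \<Omega>" and w: "\<And>\<epsilon>. \<bar>\<epsilon>\<bar> < r \<Longrightarrow> w \<epsilon> \<in> H1 \<Omega>"
    and lim: "\<And>\<epsilon>. \<bar>\<epsilon>\<bar> < r \<Longrightarrow> (\<lambda>n. H1_norm \<Omega> (\<lambda>x. w \<epsilon> x - (\<Sum>i<n. \<epsilon> ^ i * u i x))) \<longlonglongrightarrow> 0"
    and \<epsilon>: "\<bar>\<epsilon>\<bar> < r / 2" and "r > 0"
  shows "(\<lambda>k. (\<Sum>i\<le>k. ip (u i) (u (k - i))) * \<epsilon> ^ k) sums ip (w \<epsilon>) (w \<epsilon>)"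
proof -
  define \<rho> where "\<rho> = r / 2"
  have \<rho>: "\<rho> > 0" "\<bar>\<rho>\<bar> < r"
    using \<open>r > 0\<close> by (simp_all add: \<rho>_def)
  have \<epsilon>r: "\<bar>\<epsilon>\<bar> < r"
    using \<epsilon> \<open>r > 0\<close> by linarith
  note uL = H1_L2[OF u]
  obtain C where C: "C \<ge> 0" "\<And>i. H1_norm \<Omega> (u i) * \<rho> ^ i \<le> C"
    using coefficients_bounded[OF u w[OF \<rho>(2)] lim[OF \<rho>(2)] \<rho>(1)] by blast
  define q where "q = \<bar>\<epsilon>\<bar> / \<rho>"
  have q: "0 \<le> q" "q < 1"
    using \<epsilon> \<rho>(1) by (simp_all add: q_def \<rho>_def)
  have uq: "H1_norm \<Omega> (u i) * \<bar>\<epsilon>\<bar> ^ i \<le> C * q ^ i" for i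
  proof -
    have "H1_norm \<Omega> (u i) * \<bar>\<epsilon>\<bar> ^ i = (H1_norm \<Omega> (u i) * \<rho> ^ i) * q ^ i"
      using \<rho>(1) by (simp add: q_def power_divide)
    also have "\<dots> \<le> C * q ^ i"
      using q(1) by (intro mult_right_mono C(2)) simp
    finally show ?thesis .
  qed
  let ?g = "\<lambda>i j. ip (u i) (u j) * \<epsilon> ^ j * \<epsilon> ^ i"
  have "(\<lambda>k. \<Sum>i\<le>k. ?g i (k - i)) sums ip (w \<epsilon>) (w \<epsilon>)"
  proof (rule double_series_triangle[OF _ q])
    show "\<bar>?g i j\<bar> \<le> (C * C) * q ^ i * q ^ j" for i j
    proof -
      have "sqrt (ip (u j) (u j)) \<le> H1_norm \<Omega> (u j)"
        unfolding H1_norm_ip using ip_self_nonneg by simp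
      then have "\<bar>ip (u i) (u j)\<bar> \<le> H1_norm \<Omega> (u i) * H1_norm \<Omega> (u j)"
        using ip_bound_H1[OF u uL, of i j] mult_left_mono[OF _ H1_norm_nonneg, of _ _ "u i"]
        by (meson order_trans)
      then have "\<bar>ip (u i) (u j)\<bar> * (\<bar>\<epsilon>\<bar> ^ j * \<bar>\<epsilon>\<bar> ^ i)
          \<le> (H1_norm \<Omega> (u i) * H1_norm \<Omega> (u j)) * (\<bar>\<epsilon>\<bar> ^ j * \<bar>\<epsilon>\<bar> ^ i)"
        by (rule mult_right_mono) simp
      then have "\<bar>?g i j\<bar> \<le> (H1_norm \<Omega> (u i) * H1_norm \<Omega> (u j)) * (\<bar>\<epsilon>\<bar> ^ j * \<bar>\<epsilon>\<bar> ^ i)"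
        by (simp add: abs_mult power_abs mult_ac)
      also have "\<dots> = (H1_norm \<Omega> (u i) * \<bar>\<epsilon>\<bar> ^ i) * (H1_norm \<Omega> (u j) * \<bar>\<epsilon>\<bar> ^ j)"
        by (simp add: mult_ac)
      also have "\<dots> \<le> (C * q ^ i) * (C * q ^ j)"
        using C(1) q(1) by (intro mult_mono uq) (auto intro!: mult_nonneg_nonneg H1_norm_nonneg)
      finally show ?thesis
        by (simp add: mult_ac)
    qed
    show "?g i sums (ip (u i) (w \<epsilon>) * \<epsilon> ^ i)" for i
      using ip_sums[OF u w[OF \<epsilon>r] lim[OF \<epsilon>r] uL[of i]]
      by (intro sums_mult2) (simp add: ip_commute[of "u i"])
    show "(\<lambda>i. ip (u i) (w \<epsilon>) * \<epsilon> ^ i) sums ip (w \<epsilon>) (w \<epsilon>)"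
      by (rule ip_sums[OF u w[OF \<epsilon>r] lim[OF \<epsilon>r] H1_L2[OF w[OF \<epsilon>r]]])
  qed
  moreover have "(\<Sum>i\<le>k. ?g i (k - i)) = (\<Sum>i\<le>k. ip (u i) (u (k - i))) * \<epsilon> ^ k" for k
    unfolding sum_distrib_right
    by (intro sum.cong refl) (simp add: mult.assoc flip: power_add)
  ultimately show ?thesis
    by simp
qed

end

section \<open>The expansion of the first eigenpair\<close>

context bounded_open
begin

lemma L2_indicator:
  fixes V :: "'a \<Rightarrow> 'b::euclidean_space"
  assumes "B \<in> sets lebesgue" "V \<in> L2 \<Omega>"
  shows "(\<lambda>x. indicator B x *\<^sub>R V x) \<in> L2 \<Omega>"
proof (rule L2_mult[OF assms(2), where C = 1])
  have "(indicator B :: 'a \<Rightarrow> real) \<in> borel_measurable lebesgue"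
    using assms(1) by simp
  then show "(indicator B :: 'a \<Rightarrow> real) \<in> borel_measurable M"
    by (rule measurable_restrict_space1)
qed (simp add: indicator_def)

definition gipB :: "'a set \<Rightarrow> ('a \<Rightarrow> real) \<Rightarrow> ('a \<Rightarrow> real) \<Rightarrow> real" where
  "gipB B u v = gip u (\<lambda>x. indicator B x *\<^sub>R wgrad \<Omega> v x)"

lemma integral_contrast:
  assumes "B \<in> sets lebesgue" "u \<in> H1 \<Omega>" "v \<in> H1 \<Omega>"
  shows "(LINT x|M. \<alpha> * (1 + \<epsilon> * indicator B x) * (wgrad \<Omega> u x \<bullet> wgrad \<Omega> v x))
    = \<alpha> * gip u (wgrad \<Omega> v) + \<epsilon> * (\<alpha> * gipB B u v)"
proof -
  note L = wgrad_spec(1)[OF assms(2)] wgrad_spec(1)[OF assms(3)]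
  note int = ip_integrable[OF L] ip_integrable[OF L(1) L2_indicator[OF assms(1) L(2)]]
  have "(LINT x|M. \<alpha> * (1 + \<epsilon> * indicator B x) * (wgrad \<Omega> u x \<bullet> wgrad \<Omega> v x))
      = (LINT x|M. \<alpha> * (wgrad \<Omega> u x \<bullet> wgrad \<Omega> v x)
          + \<epsilon> * (\<alpha> * (wgrad \<Omega> u x \<bullet> (indicator B x *\<^sub>R wgrad \<Omega> v x))))"
    by (intro Bochner_Integration.integral_cong refl) (simp add: algebra_simps)
  also have "\<dots> = \<alpha> * gip u (wgrad \<Omega> v) + \<epsilon> * (\<alpha> * gipB B u v)"
    using int by (simp add: gip_def gipB_def ip_def)
  finally show ?thesis .
qed

lemma integral_over_subset:
  assumes "B \<in> sets lebesgue" "B \<subseteq> \<Omega>"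
  shows "(LINT x|lebesgue_on B. \<alpha> * (wgrad \<Omega> u x \<bullet> wgrad \<Omega> v x)) = \<alpha> * gipB B u v"
proof -
  have "(LINT x|lebesgue_on B. \<alpha> * (wgrad \<Omega> u x \<bullet> wgrad \<Omega> v x))
      = \<alpha> * (LINT x|lebesgue_on B. wgrad \<Omega> u x \<bullet> wgrad \<Omega> v x)"
    by simp
  also have "(LINT x|lebesgue_on B. wgrad \<Omega> u x \<bullet> wgrad \<Omega> v x)
      = (LINT x|lebesgue. indicator B x *\<^sub>R (wgrad \<Omega> u x \<bullet> wgrad \<Omega> v x))"
    using assms(1) by (subst integral_restrict_space) auto
  also have "\<dots> = (LINT x|lebesgue. indicator \<Omega> x *\<^sub>R (wgrad \<Omega> u x \<bullet> (indicator B x *\<^sub>R wgrad \<Omega> v x)))"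
    using assms(2) by (intro Bochner_Integration.integral_cong) (auto simp: indicator_def)
  also have "\<dots> = gipB B u v"
    unfolding gipB_def gip_def ip_def using dom_sets by (subst integral_restrict_space) auto
  finally show ?thesis .
qed

lemma eigenfunction_const:
  "eigenfunction \<Omega> (\<lambda>x. \<alpha>) l w \<longleftrightarrow> w \<in> H10 \<Omega> \<and> \<not> (AE x in M. w x = 0) \<and>
    (\<forall>v\<in>H10 \<Omega>. \<alpha> * gip w (wgrad \<Omega> v) = l * ip w v)"
  by (simp add: eigenfunction_def gip_def ip_def)

lemma ip_not_AE_zero:
  assumes "ip w w = 1"
  shows "\<not> (AE x in M. (w x :: real) = 0)"
proof
  assume "AE x in M. w x = 0"
  then have "ip w w = 0"
    unfolding ip_def by (intro integral_eq_zero_AE) (auto elim!: eventually_mono)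
  then show False
    using assms by simp
qed

lemma weak_solution_iff:
  assumes w: "w \<in> H10 \<Omega>" and u: "\<And>i. u i \<in> H10 \<Omega>" and B: "B \<in> sets lebesgue"
  shows "weak_solution \<Omega> \<alpha> l (\<lambda>x. (\<alpha> * indicator B x) *\<^sub>R wgrad \<Omega> (u (i - 1)) x)
      (\<lambda>x. \<Sum>k=1..i. lam k * u (i - k) x) w \<longleftrightarrow>
    (\<forall>v\<in>H10 \<Omega>. \<alpha> * gip w (wgrad \<Omega> v) - l * ip w v
      = - (\<alpha> * gipB B (u (i - 1)) v) + (\<Sum>k=1..i. lam k * ip (u (i - k)) v))"
proof -
  have "(LINT x|M. (\<alpha> * indicator B x) *\<^sub>R wgrad \<Omega> (u (i - 1)) x \<bullet> wgrad \<Omega> v x) = \<alpha> * gipB B (u (i - 1)) v"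
    for v
    unfolding gipB_def gip_def ip_def
    by (subst integral_mult_right_zero[symmetric]) (simp add: mult.assoc)
  moreover have "(LINT x|M. (\<Sum>k=1..i. lam k * u (i - k) x) * v x) = (\<Sum>k=1..i. lam k * ip (u (i - k)) v)"
    if "v \<in> H10 \<Omega>" for v
  proof -
    have "(LINT x|M. (\<Sum>k=1..i. lam k * u (i - k) x) * v x) = (LINT x|M. (\<Sum>k=1..i. lam k * (u (i - k) x \<bullet> v x)))"
      by (simp add: sum_distrib_right mult.assoc)
    also have "\<dots> = (\<Sum>k=1..i. LINT x|M. lam k * (u (i - k) x \<bullet> v x))"
      using ip_integrable[OF H10_L2[OF u] H10_L2[OF that]]
      by (intro Bochner_Integration.integral_sum integrable_mult_right) auto
    finally show ?thesis
      by (simp add: ip_def)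
  qed
  ultimately show ?thesis
    using w unfolding weak_solution_def by (simp add: gip_def ip_def)
qed

end

lemma sum_atMost_split_first:
  fixes f :: "nat \<Rightarrow> real"
  shows "(\<Sum>k\<le>i. f k) = f 0 + (\<Sum>k=1..i. f k)"
  by (simp add: sum.atLeast_Suc_atMost atMost_atLeast0)

locale eigen_expansion = bounded_open \<Omega> for \<Omega> :: "'a::euclidean_space set" +
  fixes B :: "'a set" and \<alpha> r :: real and lamE :: "real \<Rightarrow> real" and uE :: "real \<Rightarrow> 'a \<Rightarrow> real"
    and lam :: "nat \<Rightarrow> real" and u :: "nat \<Rightarrow> 'a \<Rightarrow> real"
  assumes conn: "connected \<Omega>" and nonempty: "\<Omega> \<noteq> {}" and \<alpha>: "0 < \<alpha>"
    and B: "B \<in> sets lebesgue" "B \<subseteq> \<Omega>" and r: "r > 0"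
    and eig: "\<And>\<epsilon>. \<bar>\<epsilon>\<bar> < r \<Longrightarrow> eigenfunction \<Omega> (\<lambda>x. \<alpha> * (1 + \<epsilon> * indicator B x)) (lamE \<epsilon>) (uE \<epsilon>)"
    and uE_nonneg: "\<And>\<epsilon>. \<bar>\<epsilon>\<bar> < r \<Longrightarrow> AE x in lebesgue_on \<Omega>. 0 \<le> uE \<epsilon> x"
    and uE_norm: "\<And>\<epsilon>. \<bar>\<epsilon>\<bar> < r \<Longrightarrow> (LINT x|lebesgue_on \<Omega>. (uE \<epsilon> x)\<^sup>2) = 1"
    and lamE: "\<And>\<epsilon>. \<bar>\<epsilon>\<bar> < r \<Longrightarrow> (\<lambda>i. lam i * \<epsilon> ^ i) sums lamE \<epsilon>"
    and u: "\<And>i. u i \<in> H10 \<Omega>"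
    and uE: "\<And>\<epsilon>. \<bar>\<epsilon>\<bar> < r \<Longrightarrow> (\<lambda>n. H1_norm \<Omega> (\<lambda>x. uE \<epsilon> x - (\<Sum>i<n. \<epsilon> ^ i * u i x))) \<longlonglongrightarrow> 0"
begin

lemma uH1: "u i \<in> H1 \<Omega>" and uL2: "u i \<in> L2 \<Omega>"
  and uE_H1: "\<bar>\<epsilon>\<bar> < r \<Longrightarrow> uE \<epsilon> \<in> H1 \<Omega>"
  using u eig by (auto simp: eigenfunction_def intro: H10_H1 H10_L2)

lemma coefficient_equation:
  assumes v: "v \<in> H10 \<Omega>"
  shows "\<alpha> * gip (u i) (wgrad \<Omega> v) + (if i = 0 then 0 else \<alpha> * gipB B (u (i - 1)) v)
    = (\<Sum>k\<le>i. lam k * ip (u (i - k)) v)"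
proof -
  note vL = H10_L2[OF v] wgrad_spec(1)[OF H10_H1[OF v]]
  let ?a = "\<lambda>i. \<alpha> * gip (u i) (wgrad \<Omega> v)" and ?b = "\<lambda>i. \<alpha> * gipB B (u i) v"
    and ?c = "\<lambda>i. ip (u i) v"
  let ?e = "\<lambda>i. ?a i + (if i = 0 then 0 else ?b (i - 1)) - (\<Sum>k\<le>i. lam k * ?c (i - k))"
  have "?e i = 0"
  proof (rule powser_zero_coeff[OF r])
    fix \<epsilon> :: real assume \<epsilon>: "\<bar>\<epsilon>\<bar> < r"
    have a: "(\<lambda>i. ?a i * \<epsilon> ^ i) sums (\<alpha> * gip (uE \<epsilon>) (wgrad \<Omega> v))"
      using sums_mult[OF gip_sums[OF uH1 uE_H1[OF \<epsilon>] uE[OF \<epsilon>] vL(2)], of \<alpha>] by (simp add: mult.assoc)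
    have "(\<lambda>i. \<epsilon> * (?b i * \<epsilon> ^ i)) sums (\<epsilon> * (\<alpha> * gipB B (uE \<epsilon>) v))"
      using sums_mult[OF sums_mult[OF gip_sums[OF uH1 uE_H1[OF \<epsilon>] uE[OF \<epsilon>] L2_indicator[OF B(1) vL(2)]], of \<alpha>], of \<epsilon>]
      by (simp add: mult.assoc gipB_def)
    then have b: "(\<lambda>i. (if i = 0 then 0 else ?b (i - 1)) * \<epsilon> ^ i) sums (\<epsilon> * (\<alpha> * gipB B (uE \<epsilon>) v))"
      by (subst sums_Suc_iff[symmetric, where f = "\<lambda>i. (if i = 0 then 0 else ?b (i - 1)) * \<epsilon> ^ i", simplified])
         (simp add: mult_ac)
    have c: "(\<lambda>i. (\<Sum>k\<le>i. lam k * ?c (i - k)) * \<epsilon> ^ i) sums (lamE \<epsilon> * ip (uE \<epsilon>) v)"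
      by (rule powser_product[OF r lamE ip_sums[OF uH1 uE_H1 uE vL(1)] \<epsilon>])
    have "\<alpha> * gip (uE \<epsilon>) (wgrad \<Omega> v) + \<epsilon> * (\<alpha> * gipB B (uE \<epsilon>) v) = lamE \<epsilon> * ip (uE \<epsilon>) v"
      using eig[OF \<epsilon>] v integral_contrast[OF B(1) uE_H1[OF \<epsilon>] H10_H1[OF v], of \<alpha> \<epsilon>]
      by (simp add: eigenfunction_def ip_def)
    then show "(\<lambda>i. ?e i * \<epsilon> ^ i) sums 0"
      using sums_diff[OF sums_add[OF a b] c] by (simp add: algebra_simps)
  qed
  then show ?thesis
    by simp
qed

lemma normalization:
  "ip (u 0) (u 0) = 1" "i \<ge> 1 \<Longrightarrow> (\<Sum>k\<le>i. ip (u k) (u (i - k))) = 0"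
proof -
  let ?d = "\<lambda>i. \<Sum>k\<le>i. ip (u k) (u (i - k))"
  have *: "?d i - (if i = 0 then 1 else 0) = 0" for i
  proof (rule powser_zero_coeff[where r = "r / 2" and a = "\<lambda>i. ?d i - (if i = 0 then 1 else 0)"])
    show "r / 2 > 0"
      using r by simp
    fix \<epsilon> :: real assume \<epsilon>: "\<bar>\<epsilon>\<bar> < r / 2"
    then have "\<bar>\<epsilon>\<bar> < r"
      using r by linarith
    have "(\<lambda>i. ?d i * \<epsilon> ^ i) sums 1"
      using ip_self_sums[OF uH1 uE_H1 uE \<epsilon> r] uE_norm[OF \<open>\<bar>\<epsilon>\<bar> < r\<close>] by (simp add: ip_self)
    moreover have "(\<lambda>i. (if i = 0 then 1 else 0) * \<epsilon> ^ i) sums 1"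
    proof -
      have "(\<lambda>i. (if i = 0 then 1 else 0) * \<epsilon> ^ i) = (\<lambda>i. if i = 0 then \<epsilon> ^ i else 0)"
        by auto
      then show ?thesis
        using sums_single[of 0 "\<lambda>i. \<epsilon> ^ i"] by simp
    qed
    ultimately show "(\<lambda>i. (?d i - (if i = 0 then 1 else 0)) * \<epsilon> ^ i) sums 0"
      using sums_diff by (fastforce simp: left_diff_distrib)
  qed
  show "ip (u 0) (u 0) = 1"
    using *[of 0] by simp
  show "i \<ge> 1 \<Longrightarrow> ?d i = 0"
    using *[of i] by simp
qed

lemma ground_state: "v \<in> H10 \<Omega> \<Longrightarrow> \<alpha> * gip (u 0) (wgrad \<Omega> v) = lam 0 * ip (u 0) v"
  using coefficient_equation[of v 0] by simp

lemma lam0_nonneg: "lam 0 \<ge> 0"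
  using ground_state[OF u[of 0]] normalization(1) \<alpha> ip_self_nonneg[of "wgrad \<Omega> (u 0)"]
  by (simp add: gip_def) (metis mult_nonneg_nonneg less_imp_le)

lemma lamE_0: "lamE 0 = lam 0"
  using lamE[of 0] r by simp

lemma u0_nonneg: "AE x in M. 0 \<le> u 0 x"
proof -
  have "(\<Sum>i<Suc n. 0 ^ i * u i x) = u 0 x" for n x
    by (simp add: sum.lessThan_Suc_shift del: sum.lessThan_Suc)
  then have "(\<lambda>n. H1_norm \<Omega> (\<lambda>x. uE 0 x - u 0 x)) \<longlonglongrightarrow> 0"
    using LIMSEQ_Suc[OF uE[of 0]] r by simp
  then have "H1_norm \<Omega> (\<lambda>x. uE 0 x - u 0 x) = 0"
    by (simp add: LIMSEQ_const_iff)
  then have "ip (\<lambda>x. uE 0 x - u 0 x) (\<lambda>x. uE 0 x - u 0 x) = 0"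
    using ip_le_H1_norm(1)[of "\<lambda>x. uE 0 x - u 0 x"] ip_self_nonneg[of "\<lambda>x. uE 0 x - u 0 x"] by simp
  then have "AE x in M. uE 0 x - u 0 x = 0"
    using r by (intro ip_self_eq_0 H1_L2 H1_diff uE_H1 uH1) auto
  then show ?thesis
    using uE_nonneg[of 0] r by (auto elim!: eventually_elim2)
qed

lemma gip_eigen:
  assumes "\<alpha> * gip w V = l * c"
  shows "ip (wgrad \<Omega> w) V = (l / \<alpha>) * c"
  using assms \<alpha> by (simp add: gip_def field_simps)

lemma u0_dsol: "dsol (lam 0 / \<alpha>) (u 0)"
  by (rule dsol_of_eigen[OF u gip_eigen[OF ground_state]])

lemma mu_nonneg: "lam 0 / \<alpha> \<ge> 0"
  using lam0_nonneg \<alpha> by simp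

lemma u0_pos: "AE x in M. 0 < u 0 x"
  using dsol_positive[OF u0_dsol mu_nonneg u0_nonneg conn] ip_not_AE_zero[OF normalization(1)] by blast

lemma simple:
  assumes w: "w \<in> H10 \<Omega>" and eq: "\<And>v. v \<in> H10 \<Omega> \<Longrightarrow> \<alpha> * gip w (wgrad \<Omega> v) = lam 0 * ip w v"
    and "ip w (u 0) = 0"
  shows "AE x in M. w x = 0"
  by (rule first_eigenvalue_simple[OF conn nonempty mu_nonneg u0_dsol u0_pos w gip_eigen[OF eq] assms(3)])

lemma u0_unique:
  assumes w: "eigenfunction \<Omega> (\<lambda>x. \<alpha>) (lam 0) w" "AE x in M. 0 < w x" "(LINT x|M. (w x)\<^sup>2) = 1"
  shows "AE x in M. w x = u 0 x"
proof -
  have wH: "w \<in> H10 \<Omega>" and weq: "\<And>v. v \<in> H10 \<Omega> \<Longrightarrow> \<alpha> * gip w (wgrad \<Omega> v) = lam 0 * ip w v"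
    using w(1) by (auto simp: eigenfunction_const)
  note wL = H10_L2[OF wH]
  define t where "t = ip w (u 0)"
  note tu = H10_cmult[OF u[of 0], of t]
  have "AE x in M. w x - t * u 0 x = 0"
  proof (rule simple[OF H10_diff[OF wH tu]])
    show "ip (\<lambda>x. w x - t * u 0 x) (u 0) = 0"
      using ip_diff_left[OF wL H10_L2[OF tu] uL2[of 0]] normalization(1) by (simp add: ip_cmult_left t_def)
    fix v assume v: "v \<in> H10 \<Omega>"
    note vL = H10_L2[OF v] wgrad_spec(1)[OF H10_H1[OF v]]
    have "gip (\<lambda>x. w x - t * u 0 x) (wgrad \<Omega> v) = gip w (wgrad \<Omega> v) - t * gip (u 0) (wgrad \<Omega> v)"
      using gip_diff[OF H10_H1[OF wH] H10_H1[OF tu] vL(2)] gip_cmult[OF uH1[of 0] vL(2), of t] by simp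
    then have "\<alpha> * gip (\<lambda>x. w x - t * u 0 x) (wgrad \<Omega> v) = \<alpha> * gip w (wgrad \<Omega> v) - t * (\<alpha> * gip (u 0) (wgrad \<Omega> v))"
      by (simp only:) (simp add: algebra_simps)
    also have "\<dots> = lam 0 * ip w v - t * (lam 0 * ip (u 0) v)"
      unfolding weq[OF v] ground_state[OF v] ..
    also have "\<dots> = lam 0 * ip (\<lambda>x. w x - t * u 0 x) v"
      unfolding ip_diff_left[OF wL H10_L2[OF tu] vL(1)] ip_cmult_left by (simp add: algebra_simps)
    finally show "\<alpha> * gip (\<lambda>x. w x - t * u 0 x) (wgrad \<Omega> v) = lam 0 * ip (\<lambda>x. w x - t * u 0 x) v" .
  qed
  then have eq: "AE x in M. w x = t * u 0 x"
    by (auto elim!: eventually_mono)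
  have "1 = ip w w"
    using w(3) by (simp add: ip_self)
  also have "\<dots> = ip (\<lambda>x. t * u 0 x) w"
    by (rule ip_cong_AE[OF wL H10_L2[OF tu] wL eq])
  also have "\<dots> = t\<^sup>2"
    by (simp add: ip_cmult_left ip_commute[of "u 0" w] t_def power2_eq_square)
  finally have "t = 1 \<or> t = - 1"
    by (simp add: power2_eq_1_iff)
  moreover have "t \<ge> 0"
    unfolding t_def ip_def using w(2) u0_nonneg
    by (intro integral_nonneg_AE) (auto elim!: eventually_elim2)
  ultimately have "t = 1"
    by auto
  then show ?thesis
    using eq by simp
qed

lemma cross_term: "\<alpha> * gip (u i) (wgrad \<Omega> (u 0)) = lam 0 * ip (u i) (u 0)"
  using ground_state[OF u[of i]] by (simp add: gip_def ip_commute)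

lemma ip_u_u0:
  assumes "i \<ge> 1"
  shows "ip (u i) (u 0) = - 1/2 * (\<Sum>k=1..i - 1. ip (u k) (u (i - k)))"
proof -
  have "{1..i} = insert i {1..i - 1}"
    using assms by auto
  then have "(\<Sum>k\<le>i. ip (u k) (u (i - k))) = ip (u 0) (u i) + (ip (u i) (u 0) + (\<Sum>k=1..i - 1. ip (u k) (u (i - k))))"
    using assms by (simp add: sum_atMost_split_first)
  then show ?thesis
    using normalization(2)[OF assms] by (simp add: ip_commute[of "u 0"])
qed

lemma lam_formula:
  assumes "i \<ge> 1"
  shows "lam i = \<alpha> * gipB B (u (i - 1)) (u 0) - (\<Sum>k=2..i - 1. lam (i - k) * ip (u 0) (u k))"
proof -
  have "\<alpha> * gipB B (u (i - 1)) (u 0) = (\<Sum>k=1..i. lam k * ip (u (i - k)) (u 0))"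
    using coefficient_equation[OF u[of 0], of i] cross_term[of i] assms
    by (simp add: sum_atMost_split_first)
  also have "\<dots> = lam i + (\<Sum>k=1..i - 1. lam k * ip (u (i - k)) (u 0))"
  proof -
    have "{1..i} = insert i {1..i - 1}"
      using assms by auto
    then show ?thesis
      using assms normalization(1) by simp
  qed
  also have "(\<Sum>k=1..i - 1. lam k * ip (u (i - k)) (u 0)) = (\<Sum>k=1..i - 1. lam (i - k) * ip (u k) (u 0))"
    using assms by (intro sum.reindex_bij_witness[of _ "\<lambda>k. i - k" "\<lambda>k. i - k"]) auto
  also have "\<dots> = (\<Sum>k=2..i - 1. lam (i - k) * ip (u k) (u 0))"
  proof (rule sum.mono_neutral_right)
    show "\<forall>k\<in>{1..i - 1} - {2..i - 1}. lam (i - k) * ip (u k) (u 0) = 0"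
    proof
      fix k assume "k \<in> {1..i - 1} - {2..i - 1}"
      then have "k = 1"
        by auto
      then show "lam (i - k) * ip (u k) (u 0) = 0"
        using ip_u_u0[of 1] by simp
    qed
  qed auto
  finally show ?thesis
    by (simp add: ip_commute[of "u 0"])
qed

lemma u_weak_solution:
  assumes "i \<ge> 1"
  shows "weak_solution \<Omega> \<alpha> (lam 0) (\<lambda>x. (\<alpha> * indicator B x) *\<^sub>R wgrad \<Omega> (u (i - 1)) x)
    (\<lambda>x. \<Sum>k=1..i. lam k * u (i - k) x) (u i)"
  unfolding weak_solution_iff[where u = u, OF u u B(1)]
proof
  fix v assume "v \<in> H10 \<Omega>"
  from coefficient_equation[OF this, of i]
  show "\<alpha> * gip (u i) (wgrad \<Omega> v) - lam 0 * ip (u i) v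
      = - (\<alpha> * gipB B (u (i - 1)) v) + (\<Sum>k=1..i. lam k * ip (u (i - k)) v)"
    using assms by (simp add: sum_atMost_split_first)
qed

lemma u_unique:
  assumes i: "i \<ge> 1"
    and w: "weak_solution \<Omega> \<alpha> (lam 0) (\<lambda>x. (\<alpha> * indicator B x) *\<^sub>R wgrad \<Omega> (u (i - 1)) x)
      (\<lambda>x. \<Sum>k=1..i. lam k * u (i - k) x) w"
    and orth: "ip w (u 0) = ip (u i) (u 0)"
  shows "AE x in M. w x = u i x"
proof -
  have wH: "w \<in> H10 \<Omega>"
    using w by (simp add: weak_solution_def)
  note wL = H10_L2[OF wH]
  have "AE x in M. w x - u i x = 0"
  proof (rule simple[OF H10_diff[OF wH u]])
    show "ip (\<lambda>x. w x - u i x) (u 0) = 0"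
      using orth by (simp add: ip_diff_left wL uL2)
    fix v assume v: "v \<in> H10 \<Omega>"
    note vL = H10_L2[OF v] wgrad_spec(1)[OF H10_H1[OF v]]
    have "\<alpha> * gip w (wgrad \<Omega> v) - lam 0 * ip w v = \<alpha> * gip (u i) (wgrad \<Omega> v) - lam 0 * ip (u i) v"
      using w u_weak_solution[OF i] v unfolding weak_solution_iff[where u = u, OF wH u B(1)] weak_solution_iff[where u = u, OF u u B(1)]
      by simp
    then show "\<alpha> * gip (\<lambda>x. w x - u i x) (wgrad \<Omega> v) = lam 0 * ip (\<lambda>x. w x - u i x) v"
      unfolding gip_diff[OF H10_H1[OF wH] uH1[of i] vL(2)] ip_diff_left[OF wL uL2[of i] vL(1)]
      by (simp add: algebra_simps)
  qed
  then show ?thesis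
    by (auto elim!: eventually_mono)
qed

end

theorem mainTheorem1:
  fixes \<Omega> B :: "'a::euclidean_space set"
    and \<alpha> :: real
    and lamE :: "real \<Rightarrow> real" and uE :: "real \<Rightarrow> 'a \<Rightarrow> real"
    and lam :: "nat \<Rightarrow> real" and u :: "nat \<Rightarrow> 'a \<Rightarrow> real"
  assumes "open \<Omega>" and "connected \<Omega>" and "\<Omega> \<noteq> {}" and "bounded \<Omega>"
    and "0 < \<alpha>"
    and "B \<in> sets lebesgue" and "B \<subseteq> \<Omega>"
    and "\<forall>\<^sub>F \<epsilon> in nhds 0. first_eigenvalue \<Omega> (\<lambda>x. \<alpha> * (1 + \<epsilon> * indicator B x)) (lamE \<epsilon>)"
    and "\<forall>\<^sub>F \<epsilon> in nhds 0.
           eigenfunction \<Omega> (\<lambda>x. \<alpha> * (1 + \<epsilon> * indicator B x)) (lamE \<epsilon>) (uE \<epsilon>) \<and>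
           (AE x in lebesgue_on \<Omega>. 0 \<le> uE \<epsilon> x) \<and>
           (LINT x|lebesgue_on \<Omega>. (uE \<epsilon> x)\<^sup>2) = 1"
    and "\<forall>\<^sub>F \<epsilon> in nhds 0. (\<lambda>i. lam i * \<epsilon> ^ i) sums lamE \<epsilon>"
    and "\<forall>i. u i \<in> H10 \<Omega>"
    and "\<forall>\<^sub>F \<epsilon> in nhds 0.
           (\<lambda>n. H1_norm \<Omega> (\<lambda>x. uE \<epsilon> x - (\<Sum>i<n. \<epsilon> ^ i * u i x))) \<longlonglongrightarrow> 0"
  shows "(first_eigenvalue \<Omega> (\<lambda>x. \<alpha>) (lam 0) \<and>
          (let P = (\<lambda>w. eigenfunction \<Omega> (\<lambda>x. \<alpha>) (lam 0) w \<and>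
                        (AE x in lebesgue_on \<Omega>. 0 < w x) \<and>
                        (LINT x|lebesgue_on \<Omega>. (w x)\<^sup>2) = 1)
           in P (u 0) \<and> (\<forall>w. P w \<longrightarrow> (AE x in lebesgue_on \<Omega>. w x = u 0 x))))
       \<and> (\<forall>i\<ge>1. lam i =
            (LINT x|lebesgue_on B. \<alpha> * (wgrad \<Omega> (u (i - 1)) x \<bullet> wgrad \<Omega> (u 0) x))
            - (\<Sum>k=2..i - 1. lam (i - k) * (LINT x|lebesgue_on \<Omega>. u 0 x * u k x)))
       \<and> (\<forall>i\<ge>1.
            let P = (\<lambda>w. weak_solution \<Omega> \<alpha> (lam 0)
                           (\<lambda>x. (\<alpha> * indicator B x) *\<^sub>R wgrad \<Omega> (u (i - 1)) x)
                           (\<lambda>x. (\<Sum>k=1..i. lam k * u (i - k) x)) w \<and>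
                         (LINT x|lebesgue_on \<Omega>. w x * u 0 x)
                           = - 1/2 * (\<Sum>k=1..i - 1. LINT x|lebesgue_on \<Omega>. u k x * u (i - k) x))
            in P (u i) \<and> (\<forall>w. P w \<longrightarrow> (AE x in lebesgue_on \<Omega>. w x = u i x)))"
proof -
  obtain r where r: "r > 0"
    and ev: "\<And>\<epsilon>. \<bar>\<epsilon>\<bar> < r \<Longrightarrow>
      first_eigenvalue \<Omega> (\<lambda>x. \<alpha> * (1 + \<epsilon> * indicator B x)) (lamE \<epsilon>) \<and>
      (eigenfunction \<Omega> (\<lambda>x. \<alpha> * (1 + \<epsilon> * indicator B x)) (lamE \<epsilon>) (uE \<epsilon>) \<and>
        (AE x in lebesgue_on \<Omega>. 0 \<le> uE \<epsilon> x) \<and> (LINT x|lebesgue_on \<Omega>. (uE \<epsilon> x)\<^sup>2) = 1) \<and>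
      (\<lambda>i. lam i * \<epsilon> ^ i) sums lamE \<epsilon> \<and>
      (\<lambda>n. H1_norm \<Omega> (\<lambda>x. uE \<epsilon> x - (\<Sum>i<n. \<epsilon> ^ i * u i x))) \<longlonglongrightarrow> 0"
    using eventually_conj[OF assms(8) eventually_conj[OF assms(9) eventually_conj[OF assms(10) assms(12)]]]
    by (auto simp: eventually_nhds_metric)
  interpret eigen_expansion \<Omega> B \<alpha> r lamE uE lam u
    using assms(1-7,11) r ev by unfold_locales auto
  have first: "first_eigenvalue \<Omega> (\<lambda>x. \<alpha>) (lam 0)"
    using ev[of 0] r lamE_0 by simp
  have ground: "eigenfunction \<Omega> (\<lambda>x. \<alpha>) (lam 0) (u 0)"
    using u ground_state ip_not_AE_zero[OF normalization(1)] by (simp add: eigenfunction_const)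
  have norm: "(LINT x|lebesgue_on \<Omega>. (u 0 x)\<^sup>2) = 1"
    using normalization(1) by (simp add: ip_self)
  have ip_eq: "(LINT x|lebesgue_on \<Omega>. f x * g x) = ip f g" for f g :: "'a \<Rightarrow> real"
    by (simp add: ip_def)
  show ?thesis
    unfolding Let_def ip_eq integral_over_subset[OF B]
  proof (intro conjI allI impI)
    fix i :: nat assume "1 \<le> i"
    then show "lam i = \<alpha> * gipB B (u (i - 1)) (u 0) - (\<Sum>k=2..i - 1. lam (i - k) * ip (u 0) (u k))"
      "weak_solution \<Omega> \<alpha> (lam 0) (\<lambda>x. (\<alpha> * indicator B x) *\<^sub>R wgrad \<Omega> (u (i - 1)) x)
        (\<lambda>x. \<Sum>k=1..i. lam k * u (i - k) x) (u i)"
      "ip (u i) (u 0) = - 1/2 * (\<Sum>k=1..i - 1. ip (u k) (u (i - k)))"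
      by (rule lam_formula u_weak_solution ip_u_u0)+
  next
    fix i :: nat and w assume "1 \<le> i"
      "weak_solution \<Omega> \<alpha> (lam 0) (\<lambda>x. (\<alpha> * indicator B x) *\<^sub>R wgrad \<Omega> (u (i - 1)) x)
        (\<lambda>x. \<Sum>k=1..i. lam k * u (i - k) x) w \<and>
       ip w (u 0) = - 1/2 * (\<Sum>k=1..i - 1. ip (u k) (u (i - k)))"
    then show "AE x in lebesgue_on \<Omega>. w x = u i x"
      using u_unique[of i w] ip_u_u0[of i] by simp
  qed (use first ground u0_pos norm u0_unique in auto)
qed

end
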